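(* Let $\mathcal U,\mathcal Y,\mathcal E,\mathcal E'$ be separable Hilbert spaces and let $$\Phi=\begin{bmatrix}\Phi_{11}&\Phi_{12}\\ \Phi_{21}&\Phi_{22}\end{bmatrix}\in S(\mathcal E'\oplus\mathcal U,\ \mathcal E\oplus\mathcal Y).$$ Assume that $\Phi$ is two-sided inner and that $\Phi_{12}$ or $\Phi_{21}$ admits an $H^\infty$-inverse. Then for any $F,G\in S(\mathcal E,\mathcal E')$ with $\mathfrak R_\Phi[F]\stackrel{\infty}{\sim}\mathfrak R_\Phi[G]$ we have $F\stackrel{\infty}{\sim}G$.
   Context: Operators are bounded linear maps between Hilbert spaces; $\mathcal L_1(\mathcal H_1,\mathcal H_2)$ is the set of contractions. For a contraction $C$, $D_C=(I-C^*C)^{1/2}$ and $\mathcal D_C=\overline{\mathrm{Ran}}\,D_C$. For contractions $A,B\in\mathcal L_1(\mathcal H_1,\mathcal H_2)$, $A\prec B$ means $A-B=D_{B^*}XD_B$ for some bounded operator $X:\mathcal D_B\to\mathcal D_{B^*}$; this is a pre-order. The Schur class $S(\mathcal U,\mathcal Y)$ consists of all $\mathcal L_1(\mathcal U,\mathcal Y)$-valued analytic functions on the open unit disc $\mathbb D$. For $F\in S(\mathcal U,\mathcal Y)$, $T_F:H^2_{\mathcal U}\to H^2_{\mathcal Y}$, $(T_Fh)(\lambda)=F(\lambda)h(\lambda)$. For $F,G\in S(\mathcal U,\mathcal Y)$ write $F\stackrel{\infty}{\prec}G$ if $T_F\prec T_G$, and $F\stackrel{\infty}{\sim}G$ if $F\stackrel{\infty}{\prec}G$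 and $G\stackrel{\infty}{\prec}F$. A Schur class function is two-sided inner if its nontangential (strong operator) limits on the unit circle $\mathbb T$ are a.e. unitary (both isometries and co-isometries). A bounded analytic function $K\in H^\infty(\mathcal U,\mathcal Y)$ (bounded analytic $\mathcal L(\mathcal U,\mathcal Y)$-valued function on $\mathbb D$) has an $H^\infty$-inverse if $K(\lambda)$ is invertible for each $\lambda\in\mathbb D$ and $\lambda\mapsto K(\lambda)^{-1}$ is in $H^\infty(\mathcal Y,\mathcal U)$. In the block decomposition, $\Phi_{11}(\lambda):\mathcal E'\to\mathcal E$, $\Phi_{12}(\lambda):\mathcal U\to\mathcal E$, $\Phi_{21}(\lambda):\mathcal E'\to\mathcal Y$, $\Phi_{22}(\lambda):\mathcal U\to\mathcal Y$. The Redheffer map is $$\mathfrak R_\Phi[F](\lambda)=\Phi_{22}(\lambda)+\Phi_{21}(\lambda)F(\lambda)(I-\Phi_{11}(\lambda)F(\lambda))^{-1}\Phi_{12}(\lambda)\quad(\lambda\in\mathbb D),$$ defined for $F\in S(\mathcal E,\mathcal E')$ with $\|\Phi_{11}(0)F(0)\|<1$, with values in $S(\mathcal U,\mathcal Y)$. (Under the present hypotheses $\|\Phi_{11}\|_\infty<1$, so $\mathfrak R_\Phi$ is defined on all of $S(\mathcal E,\mathcal E')$.) *)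

theory Defs
  imports "HOL-Analysis.Analysis"
begin

section \<open>Complex Hilbert spaces\<close>

class scaleC =
  fixes scaleC :: "complex \<Rightarrow> 'a \<Rightarrow> 'a"  (infixr \<open>*\<^sub>C\<close> 75)

class complex_normed_vector = real_normed_vector + scaleC +
  assumes scaleC_add_right: "c *\<^sub>C (x + y) = c *\<^sub>C x + c *\<^sub>C y"
    and scaleC_add_left: "(c + d) *\<^sub>C x = c *\<^sub>C x + d *\<^sub>C x"
    and scaleC_scaleC: "c *\<^sub>C d *\<^sub>C x = (c * d) *\<^sub>C x"
    and scaleC_of_real: "complex_of_real r *\<^sub>C x = r *\<^sub>R x"
    and norm_scaleC: "norm (c *\<^sub>C x) = cmod c * norm x"

class cinner =
  fixes cinner :: "'a \<Rightarrow> 'a \<Rightarrow> complex"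

text \<open>The inner product is linear in its first argument.\<close>

class complex_inner = complex_normed_vector + cinner +
  assumes cinner_add_left: "cinner (x + y) z = cinner x z + cinner y z"
    and cinner_scaleC_left: "cinner (c *\<^sub>C x) y = c * cinner x y"
    and cinner_commute: "cinner y x = cnj (cinner x y)"
    and cinner_self: "cinner x x = complex_of_real ((norm x)\<^sup>2)"

class chilbert_space = complex_inner + banach

subsection \<open>Direct sums and bounded operators\<close>

instantiation prod :: (complex_normed_vector, complex_normed_vector) complex_normed_vector
begin

definition scaleC_prod :: "complex \<Rightarrow> 'a \<times> 'b \<Rightarrow> 'a \<times> 'b"
  where "scaleC_prod c p = (c *\<^sub>C fst p, c *\<^sub>C snd p)"

instance
proof
  fix c d :: complex and r :: real and x y :: "'a \<times> 'b"
  show "c *\<^sub>C (x + y) = c *\<^sub>C x + c *\<^sub>C y"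
    by (simp add: scaleC_prod_def scaleC_add_right)
  show "(c + d) *\<^sub>C x = c *\<^sub>C x + d *\<^sub>C x"
    by (simp add: scaleC_prod_def scaleC_add_left)
  show "c *\<^sub>C d *\<^sub>C x = (c * d) *\<^sub>C x"
    by (simp add: scaleC_prod_def scaleC_scaleC)
  show "complex_of_real r *\<^sub>C x = r *\<^sub>R x"
    by (simp add: scaleC_prod_def scaleC_of_real scaleR_prod_def)
  show "norm (c *\<^sub>C x) = cmod c * norm x"
    by (simp add: scaleC_prod_def norm_prod_def norm_scaleC power_mult_distrib
        real_sqrt_mult flip: distrib_left)
qed

end

instantiation prod :: (complex_inner, complex_inner) complex_inner
begin

definition cinner_prod :: "'a \<times> 'b \<Rightarrow> 'a \<times> 'b \<Rightarrow> complex"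
  where "cinner_prod p q = cinner (fst p) (fst q) + cinner (snd p) (snd q)"

instance
proof
  fix c :: complex and x y z :: "'a \<times> 'b"
  show "cinner (x + y) z = cinner x z + cinner y z"
    by (simp add: cinner_prod_def cinner_add_left)
  show "cinner (c *\<^sub>C x) y = c * cinner x y"
    by (simp add: cinner_prod_def scaleC_prod_def cinner_scaleC_left distrib_left)
  show "cinner y x = cnj (cinner x y)"
    by (simp add: cinner_prod_def flip: cinner_commute)
  show "cinner x x = complex_of_real ((norm x)\<^sup>2)"
    by (simp add: cinner_prod_def cinner_self norm_prod_def)
qed

end

instance prod :: (chilbert_space, chilbert_space) chilbert_space ..

instantiation blinfun :: (real_normed_vector, complex_normed_vector) complex_normed_vector
begin

lift_definition scaleC_blinfun :: "complex \<Rightarrow> 'a \<Rightarrow>\<^sub>L 'b \<Rightarrow> 'a \<Rightarrow>\<^sub>L 'b" is "\<lambda>c f x. c *\<^sub>C f x"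
proof -
  fix c :: complex and f :: "'a \<Rightarrow> 'b"
  assume f: "bounded_linear f"
  have "bounded_linear (\<lambda>y::'b. c *\<^sub>C y)"
  proof (rule bounded_linear_intro[where K = "cmod c"])
    fix r and x :: 'b
    show "c *\<^sub>C r *\<^sub>R x = r *\<^sub>R c *\<^sub>C x"
      by (simp add: scaleC_scaleC mult.commute flip: scaleC_of_real)
  qed (simp_all add: scaleC_add_right norm_scaleC mult.commute)
  from bounded_linear_compose[OF this f] show "bounded_linear (\<lambda>x. c *\<^sub>C f x)" .
qed

instance
proof
  fix c d :: complex and r :: real and x y :: "'a \<Rightarrow>\<^sub>L 'b"
  show "c *\<^sub>C (x + y) = c *\<^sub>C x + c *\<^sub>C y"
    by transfer (simp add: scaleC_add_right)
  show "(c + d) *\<^sub>C x = c *\<^sub>C x + d *\<^sub>C x"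
    by transfer (simp add: scaleC_add_left)
  show "c *\<^sub>C d *\<^sub>C x = (c * d) *\<^sub>C x"
    by transfer (simp add: scaleC_scaleC)
  show "complex_of_real r *\<^sub>C x = r *\<^sub>R x"
    by transfer (simp add: scaleC_of_real)
  have le: "norm (c *\<^sub>C x) \<le> cmod c * norm x" for c and x :: "'a \<Rightarrow>\<^sub>L 'b"
    by (rule norm_blinfun_bound)
      (auto simp: scaleC_blinfun.rep_eq norm_scaleC mult.assoc intro: mult_left_mono norm_blinfun)
  show "norm (c *\<^sub>C x) = cmod c * norm x"
  proof (cases "c = 0")
    case True
    then show ?thesis using le[of 0 x] by simp
  next
    case False
    have "inverse c *\<^sub>C c *\<^sub>C x = x"
      using False by transfer (simp add: scaleC_scaleC scaleC_of_real[of 1, simplified])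
    then have "norm x \<le> cmod (inverse c) * norm (c *\<^sub>C x)"
      using le[of "inverse c" "c *\<^sub>C x"] by simp
    then have "cmod c * norm x \<le> norm (c *\<^sub>C x)"
      using False by (simp add: norm_inverse pos_le_divide_eq mult.commute divide_inverse[symmetric]
          flip: divide_inverse_commute)
    with le[of c x] show ?thesis by simp
  qed
qed

end

section \<open>Operators\<close>

text \<open>
  The library type of bounded operators only demands linearity over the reals;
  complex linearity is imposed by the following predicate.
\<close>

definition clinear :: "('a::complex_normed_vector \<Rightarrow>\<^sub>L 'b::complex_normed_vector) \<Rightarrow> bool"
  where "clinear A \<longleftrightarrow> (\<forall>c x. A (c *\<^sub>C x) = c *\<^sub>C A x)"

definition adj :: "('a::chilbert_space \<Rightarrow>\<^sub>L 'b::chilbert_space) \<Rightarrow> 'b \<Rightarrow>\<^sub>L 'a"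
  where "adj A = (THE B :: 'b \<Rightarrow>\<^sub>L 'a. \<forall>x y. cinner (A x) y = cinner x (B y))"

definition unitary_op :: "('a::chilbert_space \<Rightarrow>\<^sub>L 'b::chilbert_space) \<Rightarrow> bool"
  where "unitary_op V \<longleftrightarrow>
    clinear V \<and> adj V o\<^sub>L V = id_blinfun \<and> V o\<^sub>L adj V = id_blinfun"

definition invertible_op :: "('a::complex_normed_vector \<Rightarrow>\<^sub>L 'b::complex_normed_vector) \<Rightarrow> bool"
  where "invertible_op A \<longleftrightarrow> (\<exists>B. B o\<^sub>L A = id_blinfun \<and> A o\<^sub>L B = id_blinfun)"

definition inv_op :: "('a::complex_normed_vector \<Rightarrow>\<^sub>L 'b::complex_normed_vector) \<Rightarrow> 'b \<Rightarrow>\<^sub>L 'a"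
  where "inv_op A = (THE B. B o\<^sub>L A = id_blinfun \<and> A o\<^sub>L B = id_blinfun)"

definition positive_op :: "('a::chilbert_space \<Rightarrow>\<^sub>L 'a) \<Rightarrow> bool"
  where "positive_op P \<longleftrightarrow> clinear P \<and> (\<forall>x. cinner (P x) x \<in> \<real>\<^sub>\<ge>\<^sub>0)"

text \<open>Positive operators have a unique positive square root.\<close>

definition sqrt_op :: "('a::chilbert_space \<Rightarrow>\<^sub>L 'a) \<Rightarrow> 'a \<Rightarrow>\<^sub>L 'a"
  where "sqrt_op P = (THE R. positive_op R \<and> R o\<^sub>L R = P)"

subsection \<open>The relation on contractions\<close>

definition defect_op :: "('a::chilbert_space \<Rightarrow>\<^sub>L 'b::chilbert_space) \<Rightarrow> 'a \<Rightarrow>\<^sub>L 'a"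
  where "defect_op C = sqrt_op (id_blinfun - (adj C o\<^sub>L C))"

definition defect_space :: "('a::chilbert_space \<Rightarrow>\<^sub>L 'b::chilbert_space) \<Rightarrow> 'a set"
  where "defect_space C = closure (range (defect_op C))"

definition bounded_operator_between ::
    "'a::complex_normed_vector set \<Rightarrow> 'b::complex_normed_vector set \<Rightarrow> ('a \<Rightarrow> 'b) \<Rightarrow> bool"
  where "bounded_operator_between S T X \<longleftrightarrow>
    X ` S \<subseteq> T \<and>
    (\<forall>x\<in>S. \<forall>y\<in>S. X (x + y) = X x + X y) \<and>
    (\<forall>c. \<forall>x\<in>S. X (c *\<^sub>C x) = c *\<^sub>C X x) \<and>
    (\<exists>M. \<forall>x\<in>S. norm (X x) \<le> M * norm x)"

text \<open>The relation \<open>\<prec>\<close> is meant for contractions, for which the defect operators exist.\<close>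

definition op_prec ::
    "('a::chilbert_space \<Rightarrow>\<^sub>L 'b::chilbert_space) \<Rightarrow> ('a \<Rightarrow>\<^sub>L 'b) \<Rightarrow> bool"  (infix \<open>\<prec>\<close> 50)
  where "A \<prec> B \<longleftrightarrow>
    (\<exists>X. bounded_operator_between (defect_space B) (defect_space (adj B)) X \<and>
      (\<forall>x. (A - B) x = defect_op (adj B) (X (defect_op B x))))"

section \<open>Analytic functions on the unit disc\<close>

text \<open>Functions on the disc are total functions whose values off the disc are irrelevant.\<close>

abbreviation unit_disc :: "complex set"  (\<open>\<bbbD>\<close>)
  where "\<bbbD> \<equiv> ball 0 1"

definition analytic_on_disc :: "(complex \<Rightarrow> 'a::complex_normed_vector) \<Rightarrow> bool"
  where "analytic_on_disc f \<longleftrightarrow>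
    (\<forall>z\<in>\<bbbD>. \<exists>D. (f has_derivative (\<lambda>h. h *\<^sub>C D)) (at z))"

definition Hinf :: "(complex \<Rightarrow> 'u::chilbert_space \<Rightarrow>\<^sub>L 'y::chilbert_space) set"
  where "Hinf = {F. analytic_on_disc F \<and> (\<forall>z\<in>\<bbbD>. clinear (F z)) \<and>
    (\<exists>M. \<forall>z\<in>\<bbbD>. norm (F z) \<le> M)}"

definition schur :: "(complex \<Rightarrow> 'u::chilbert_space \<Rightarrow>\<^sub>L 'y::chilbert_space) set"
  where "schur = {F. analytic_on_disc F \<and> (\<forall>z\<in>\<bbbD>. clinear (F z)) \<and>
    (\<forall>z\<in>\<bbbD>. norm (F z) \<le> 1)}"

definition has_Hinf_inverse :: "(complex \<Rightarrow> 'u::chilbert_space \<Rightarrow>\<^sub>L 'y::chilbert_space) \<Rightarrow> bool"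
  where "has_Hinf_inverse K \<longleftrightarrow>
    (\<forall>z\<in>\<bbbD>. invertible_op (K z)) \<and> (\<lambda>z. inv_op (K z)) \<in> Hinf"

text \<open>The nontangential approach region of aperture \<open>\<alpha>\<close> at a point \<open>\<zeta>\<close> of the unit circle.\<close>

definition stolz_region :: "real \<Rightarrow> complex \<Rightarrow> complex set"
  where "stolz_region \<alpha> \<zeta> = {z \<in> \<bbbD>. cmod (z - \<zeta>) < \<alpha> * (1 - cmod z)}"

definition nontangential_sot_limit ::
    "(complex \<Rightarrow> 'u::chilbert_space \<Rightarrow>\<^sub>L 'y::chilbert_space) \<Rightarrow> complex \<Rightarrow> 'u \<Rightarrow>\<^sub>L 'y \<Rightarrow> bool"
  where "nontangential_sot_limit F \<zeta> V \<longleftrightarrow>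
    (\<forall>x. \<forall>\<alpha>>1. ((\<lambda>z. F z x) \<longlongrightarrow> V x) (at \<zeta> within stolz_region \<alpha> \<zeta>))"

definition two_sided_inner :: "(complex \<Rightarrow> 'u::chilbert_space \<Rightarrow>\<^sub>L 'y::chilbert_space) \<Rightarrow> bool"
  where "two_sided_inner F \<longleftrightarrow>
    (AE t in lebesgue_on {0..2 * pi}. \<exists>V. nontangential_sot_limit F (cis t) V \<and> unitary_op V)"

section \<open>The Hardy space and multiplication operators\<close>

definition l2seq :: "(nat \<Rightarrow> 'a::chilbert_space) \<Rightarrow> bool"
  where "l2seq a \<longleftrightarrow> summable (\<lambda>n. (norm (a n))\<^sup>2)"

definition hardy_series :: "(nat \<Rightarrow> 'a::chilbert_space) \<Rightarrow> complex \<Rightarrow> 'a"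
  where "hardy_series a z = (if z \<in> \<bbbD> then \<Sum>n. z ^ n *\<^sub>C a n else 0)"

lemma l2seq_0: "l2seq (\<lambda>n. 0)"
  by (simp add: l2seq_def)

lemma l2seq_scaleC: "l2seq a \<Longrightarrow> l2seq (\<lambda>n. c *\<^sub>C a n)"
  by (simp add: l2seq_def norm_scaleC power_mult_distrib summable_mult)

lemma l2seq_add:
  assumes "l2seq a" "l2seq b"
  shows "l2seq (\<lambda>n. a n + b n)"
  unfolding l2seq_def
proof (rule summable_comparison_test')
  show "summable (\<lambda>n. 2 * (norm (a n))\<^sup>2 + 2 * (norm (b n))\<^sup>2)"
    using assms by (intro summable_add summable_mult) (auto simp: l2seq_def)
  fix n
  have "(norm (a n + b n))\<^sup>2 \<le> (norm (a n) + norm (b n))\<^sup>2"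
    by (intro power_mono norm_triangle_ineq) auto
  also have "\<dots> \<le> 2 * (norm (a n))\<^sup>2 + 2 * (norm (b n))\<^sup>2"
    using sum_squares_bound[of "norm (a n)" "norm (b n)"] by (simp add: power2_sum)
  finally show "norm ((norm (a n + b n))\<^sup>2) \<le> 2 * (norm (a n))\<^sup>2 + 2 * (norm (b n))\<^sup>2"
    by simp
qed

lemma scaleC_zero_right [simp]: "c *\<^sub>C (0::'a::complex_normed_vector) = 0"
  using norm_scaleC[of c "0::'a"] by simp

lemma scaleC_minus_one: "(-1) *\<^sub>C (x::'a::complex_normed_vector) = - x"
  using scaleC_of_real[of "-1" x] by simp

lemma bounded_linear_scaleC: "bounded_linear ((*\<^sub>C) c :: 'a::complex_normed_vector \<Rightarrow> 'a)"
proof (rule bounded_linear_intro[where K = "cmod c"])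
  fix r and x :: 'a
  show "c *\<^sub>C r *\<^sub>R x = r *\<^sub>R c *\<^sub>C x"
    by (simp add: scaleC_scaleC mult.commute flip: scaleC_of_real)
qed (simp_all add: scaleC_add_right norm_scaleC mult.commute)

lemma l2seq_bounded:
  assumes "l2seq a"
  obtains M where "\<And>n. norm (a n) \<le> M" "0 \<le> M"
proof
  let ?M = "sqrt (\<Sum>n. (norm (a n))\<^sup>2)"
  show "norm (a n) \<le> ?M" for n
    using sum_le_suminf[of "\<lambda>n. (norm (a n))\<^sup>2" "{n}"] assms
    by (intro real_le_rsqrt) (simp add: l2seq_def)
  show "0 \<le> ?M"
    using assms by (auto simp: l2seq_def intro: suminf_nonneg)
qed

lemma summable_hardy_series:
  assumes "l2seq a" "z \<in> \<bbbD>"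
  shows "summable (\<lambda>n. z ^ n *\<^sub>C a n)"
proof -
  obtain M where M: "\<And>n. norm (a n) \<le> M" using assms(1) l2seq_bounded by blast
  show ?thesis
  proof (rule summable_comparison_test')
    show "summable (\<lambda>n. cmod z ^ n * M)"
      using assms(2) by (intro summable_mult2 summable_geometric) simp
    show "norm (z ^ n *\<^sub>C a n) \<le> cmod z ^ n * M" for n
      by (simp add: norm_scaleC norm_power mult_left_mono M)
  qed
qed

lemma hardy_series_add:
  "l2seq a \<Longrightarrow> l2seq b \<Longrightarrow> hardy_series (\<lambda>n. a n + b n) = (\<lambda>z. hardy_series a z + hardy_series b z)"
  by (auto simp: hardy_series_def scaleC_add_right suminf_add summable_hardy_series)

lemma hardy_series_scaleC: "l2seq a \<Longrightarrow> hardy_series (\<lambda>n. c *\<^sub>C a n) = (\<lambda>z. c *\<^sub>C hardy_series a z)"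
  using bounded_linear.suminf[OF bounded_linear_scaleC summable_hardy_series, of a _ c]
  by (auto simp: hardy_series_def scaleC_scaleC mult.commute)

lemma cinner_bound_sq: "cmod (cinner x y) \<le> (norm x)\<^sup>2 + (norm y)\<^sup>2"
  for x y :: "'a::complex_inner"
proof -
  have add_right: "cinner u (v + w) = cinner u v + cinner u w" for u v w :: 'a
    by (metis cinner_add_left cinner_commute complex_cnj_add)
  have scale_right: "cinner u (c *\<^sub>C v) = cnj c * cinner u v" for u v :: 'a and c
    by (metis cinner_scaleC_left cinner_commute complex_cnj_mult)
  have re: "2 * \<bar>Re (cinner u v)\<bar> \<le> (norm u)\<^sup>2 + (norm v)\<^sup>2" for u v :: 'a
  proof -
    have pos: "0 \<le> (norm u)\<^sup>2 + (norm v)\<^sup>2 + 2 * Re (cinner u v)" for u v :: 'a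
    proof -
      have "complex_of_real ((norm (u + v))\<^sup>2) = cinner (u + v) (u + v)"
        by (rule cinner_self[symmetric])
      also have "\<dots> = of_real ((norm u)\<^sup>2) + cinner u v + cnj (cinner u v) + of_real ((norm v)\<^sup>2)"
        by (simp only: cinner_add_left add_right cinner_self[of u] cinner_self[of v]
            cinner_commute[of v u] ac_simps)
      finally have "(norm (u + v))\<^sup>2 = (norm u)\<^sup>2 + (norm v)\<^sup>2 + 2 * Re (cinner u v)"
        by (simp add: complex_eq_iff)
      then show ?thesis by (metis zero_le_power2)
    qed
    have "cinner u (- v) = - cinner u v"
      using scale_right[of u "-1" v] by (simp add: scaleC_minus_one)
    with pos[of u v] pos[of u "- v"] show ?thesis by simp
  qed
  have "cinner x (\<i> *\<^sub>C y) = - \<i> * cinner x y" by (simp add: scale_right)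
  with re[of x "\<i> *\<^sub>C y"] have "2 * \<bar>Im (cinner x y)\<bar> \<le> (norm x)\<^sup>2 + (norm y)\<^sup>2"
    by (simp add: norm_scaleC)
  with re[of x y] cmod_le[of "cinner x y"] show ?thesis by linarith
qed

lemma cinner_bound: "cmod (cinner x y) \<le> norm x * (2 * norm y)"
  for x y :: "'a::complex_inner"
proof (cases "x = 0 \<or> y = 0")
  case True
  have "cinner 0 v = 0" for v :: 'a
    using cinner_scaleC_left[of 0 0 v] by simp
  with True show ?thesis by (metis cinner_commute complex_cnj_zero mult_eq_0_iff norm_zero order_refl mult_zero_right)
next
  case False
  define a b where "a = norm x" and "b = norm y"
  have ab: "a > 0" "b > 0" using False by (auto simp: a_def b_def)
  let ?x = "complex_of_real (inverse a) *\<^sub>C x" and ?y = "complex_of_real (inverse b) *\<^sub>C y"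
  have "cinner ?x ?y = of_real (inverse a) * cnj (of_real (inverse b) * cinner y x)"
    by (simp only: cinner_scaleC_left flip: cinner_commute[of ?y x])
      (simp only: cinner_commute[of x ?y] cinner_scaleC_left)
  then have "cmod (cinner ?x ?y) = inverse a * inverse b * cmod (cinner x y)"
    using ab by (simp add: norm_mult norm_inverse flip: cinner_commute[of x y])
  moreover have "cmod (cinner ?x ?y) \<le> 2"
    using cinner_bound_sq[of ?x ?y] ab
    by (simp add: norm_scaleC norm_mult norm_inverse flip: a_def b_def)
  ultimately have "cmod (cinner x y) / (a * b) \<le> 2"
    by (simp add: divide_inverse mult.commute)
  then have "cmod (cinner x y) \<le> 2 * (a * b)"
    using ab by (simp add: pos_divide_le_eq)
  then show ?thesis by (simp add: a_def b_def mult.left_commute)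
qed

lemma bounded_linear_cinner_left: "bounded_linear (\<lambda>x::'a::complex_inner. cinner x y)"
proof (rule bounded_linear_intro[where K = "2 * norm y"])
  fix r and x :: 'a
  show "cinner (r *\<^sub>R x) y = r *\<^sub>R cinner x y"
    by (simp add: cinner_scaleC_left scaleR_conv_of_real flip: scaleC_of_real)
qed (simp_all add: cinner_add_left cinner_bound)

lemma hardy_series_inj:
  assumes a: "l2seq a" and b: "l2seq b" and eq: "hardy_series a = hardy_series b"
  shows "a = b"
proof
  fix n
  have fps: "\<exists>r>0. ereal r \<le> fps_conv_radius (Abs_fps (\<lambda>n. cinner (c n) y)) \<and>
      (\<forall>z. cmod z < r \<longrightarrow> eval_fps (Abs_fps (\<lambda>n. cinner (c n) y)) z = cinner (hardy_series c z) y)"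
    if c: "l2seq c" for c :: "nat \<Rightarrow> 'a" and y
  proof -
    have sums: "(\<lambda>n. cinner (c n) y * z ^ n) sums cinner (hardy_series c z) y" if "cmod z < 1" for z
      using bounded_linear.sums[OF bounded_linear_cinner_left summable_sums[OF summable_hardy_series[OF c, of z]], of y] that
      by (simp add: hardy_series_def cinner_scaleC_left mult.commute)
    have "ereal (1/2) \<le> fps_conv_radius (Abs_fps (\<lambda>n. cinner (c n) y))"
      using conv_radius_geI[OF sums_summable[OF sums[of "1/2"]]]
      by (simp add: fps_conv_radius_def)
    then show ?thesis
      using sums by (intro exI[of _ "1/2"]) (auto simp: eval_fps_def sums_iff)
  qed
  have "cinner (a n) y = cinner (b n) y" for y
  proof -
    obtain r where r: "r > 0" "ereal r \<le> fps_conv_radius (Abs_fps (\<lambda>n. cinner (a n) y))"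
      "\<And>z. cmod z < r \<Longrightarrow> eval_fps (Abs_fps (\<lambda>n. cinner (a n) y)) z = cinner (hardy_series a z) y"
      using fps[OF a, of y] by blast
    obtain s where s: "s > 0" "ereal s \<le> fps_conv_radius (Abs_fps (\<lambda>n. cinner (b n) y))"
      "\<And>z. cmod z < s \<Longrightarrow> eval_fps (Abs_fps (\<lambda>n. cinner (b n) y)) z = cinner (hardy_series b z) y"
      using fps[OF b, of y] by blast
    have "eventually (\<lambda>z. z \<in> ball 0 (min r s)) (nhds (0::complex))"
      using r s by (intro eventually_nhds_in_open) auto
    then have "Abs_fps (\<lambda>n. cinner (a n) y) = Abs_fps (\<lambda>n. cinner (b n) y)"
      using r s eq
      by (intro eval_fps_eqD)
        (auto elim!: eventually_mono intro: less_le_trans[of 0 "ereal r"] less_le_trans[of 0 "ereal s"])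
    then show ?thesis by (simp add: fps_eq_iff)
  qed
  moreover have "cinner (a n - b n) y = cinner (a n) y - cinner (b n) y" for y
    using linear_diff[OF bounded_linear.linear[OF bounded_linear_cinner_left]] .
  ultimately have "cinner (a n - b n) (a n - b n) = 0"
    by simp
  then show "a n = b n" by (simp add: cinner_self)
qed

text \<open>
  \<open>'a hardy2\<close> is the space of functions on the disc with square-summable Taylor
  coefficients. Its elements are represented by total functions vanishing off the disc.
\<close>

typedef (overloaded) ('a::chilbert_space) hardy2 = "{hardy_series a | a :: nat \<Rightarrow> 'a. l2seq a}"
  morphisms hardy_apply Hardy
  using l2seq_0 by blast

setup_lifting type_definition_hardy2

definition hardy_coeff :: "'a::chilbert_space hardy2 \<Rightarrow> nat \<Rightarrow> 'a"
  where "hardy_coeff h = (THE a. l2seq a \<and> hardy_series a = hardy_apply h)"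

lemma hardy_coeff: "l2seq (hardy_coeff h)" "hardy_series (hardy_coeff h) = hardy_apply h"
proof -
  have "\<exists>!a. l2seq a \<and> hardy_series a = hardy_apply h"
    using hardy_apply[of h] hardy_series_inj by (force simp: eq_commute)
  from theI'[OF this] show "l2seq (hardy_coeff h)" "hardy_series (hardy_coeff h) = hardy_apply h"
    by (auto simp: hardy_coeff_def)
qed

lemma hardy_coeff_eqI: "l2seq a \<Longrightarrow> hardy_series a = hardy_apply h \<Longrightarrow> hardy_coeff h = a"
  by (metis hardy_coeff hardy_series_inj)

lemma hardy2_eqI: "(\<And>n. hardy_coeff f n = hardy_coeff g n) \<Longrightarrow> f = g"
  by (metis hardy_coeff(2) ext hardy_apply_inject)

lemma hardy_coeff_Hardy: "l2seq a \<Longrightarrow> hardy_coeff (Hardy (hardy_series a)) = a"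
  by (intro hardy_coeff_eqI) (auto intro!: Hardy_inverse[symmetric])

definition hardy_norm :: "'a::chilbert_space hardy2 \<Rightarrow> real"
  where "hardy_norm f = sqrt (\<Sum>n. (norm (hardy_coeff f n))\<^sup>2)"

instantiation hardy2 :: (chilbert_space) "{zero, plus, uminus, minus, scaleR, scaleC, cinner}"
begin

lift_definition zero_hardy2 :: "'a hardy2" is "\<lambda>z. 0"
proof -
  have "(\<lambda>z. 0) = hardy_series (\<lambda>n. 0 :: 'a)" by (auto simp: hardy_series_def)
  with l2seq_0 show "\<exists>a :: nat \<Rightarrow> 'a. (\<lambda>z. 0) = hardy_series a \<and> l2seq a" by blast
qed

lift_definition plus_hardy2 :: "'a hardy2 \<Rightarrow> 'a hardy2 \<Rightarrow> 'a hardy2" is "\<lambda>f g z. f z + g z"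
  using hardy_series_add[symmetric] l2seq_add by blast

lift_definition scaleC_hardy2 :: "complex \<Rightarrow> 'a hardy2 \<Rightarrow> 'a hardy2" is "\<lambda>c f z. c *\<^sub>C f z"
  using hardy_series_scaleC[symmetric] l2seq_scaleC by blast

definition scaleR_hardy2 :: "real \<Rightarrow> 'a hardy2 \<Rightarrow> 'a hardy2"
  where "scaleR_hardy2 r f = complex_of_real r *\<^sub>C f"

definition uminus_hardy2 :: "'a hardy2 \<Rightarrow> 'a hardy2"
  where "uminus_hardy2 f = (-1) *\<^sub>C f"

definition minus_hardy2 :: "'a hardy2 \<Rightarrow> 'a hardy2 \<Rightarrow> 'a hardy2"
  where "minus_hardy2 f g = f + - g"

definition cinner_hardy2 :: "'a hardy2 \<Rightarrow> 'a hardy2 \<Rightarrow> complex"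
  where "cinner_hardy2 f g = (\<Sum>n. cinner (hardy_coeff f n) (hardy_coeff g n))"

instance ..

end

lemma hardy_coeff_zero: "hardy_coeff 0 = (\<lambda>n. 0)"
  by (intro hardy_coeff_eqI l2seq_0) (auto simp: hardy_series_def zero_hardy2.rep_eq)

lemma hardy_coeff_plus: "hardy_coeff (f + g) = (\<lambda>n. hardy_coeff f n + hardy_coeff g n)"
  by (intro hardy_coeff_eqI l2seq_add hardy_coeff)
    (simp add: hardy_series_add hardy_coeff plus_hardy2.rep_eq)

lemma hardy_coeff_scaleC: "hardy_coeff (c *\<^sub>C f) = (\<lambda>n. c *\<^sub>C hardy_coeff f n)"
  by (intro hardy_coeff_eqI l2seq_scaleC hardy_coeff)
    (simp add: hardy_series_scaleC hardy_coeff scaleC_hardy2.rep_eq)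

lemma hardy_coeff_scaleR: "hardy_coeff (r *\<^sub>R f) = (\<lambda>n. r *\<^sub>R hardy_coeff f n)"
  by (simp add: scaleR_hardy2_def hardy_coeff_scaleC scaleC_of_real)

lemma hardy_coeff_uminus: "hardy_coeff (- f) = (\<lambda>n. - hardy_coeff f n)"
  by (simp add: uminus_hardy2_def hardy_coeff_scaleC scaleC_minus_one)

lemma hardy_coeff_minus: "hardy_coeff (f - g) = (\<lambda>n. hardy_coeff f n - hardy_coeff g n)"
  by (simp add: minus_hardy2_def hardy_coeff_plus hardy_coeff_uminus)

lemmas hardy_coeff_simps = hardy_coeff_zero hardy_coeff_plus hardy_coeff_scaleC
  hardy_coeff_scaleR hardy_coeff_uminus hardy_coeff_minus

lemma summable_norm_hardy_coeff: "summable (\<lambda>n. (norm (hardy_coeff f n))\<^sup>2)"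
  using hardy_coeff(1) by (simp add: l2seq_def)

lemma summable_cinner_hardy_coeff: "summable (\<lambda>n. cinner (hardy_coeff f n) (hardy_coeff g n))"
  by (rule summable_comparison_test'[OF summable_add[OF summable_norm_hardy_coeff[of f]
        summable_norm_hardy_coeff[of g]]])
    (rule cinner_bound_sq)

lemma hardy_norm_sq: "(hardy_norm f)\<^sup>2 = (\<Sum>n. (norm (hardy_coeff f n))\<^sup>2)"
  unfolding hardy_norm_def
  by (rule real_sqrt_pow2) (simp add: suminf_nonneg summable_norm_hardy_coeff)

lemma L2_set_le_hardy_norm: "L2_set (\<lambda>n. norm (hardy_coeff f n)) {..<m} \<le> hardy_norm f"
  unfolding L2_set_def hardy_norm_def
  by (intro real_sqrt_le_mono sum_le_suminf summable_norm_hardy_coeff) auto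

lemma hardy_norm_leI:
  assumes "\<And>m. L2_set (\<lambda>n. norm (hardy_coeff f n)) {..<m} \<le> c"
  shows "hardy_norm f \<le> c"
proof -
  have c: "0 \<le> c" using assms[of 0] by simp
  have "(\<Sum>n<m. (norm (hardy_coeff f n))\<^sup>2) \<le> c\<^sup>2" for m
    using assms[of m] unfolding L2_set_def by (rule sqrt_le_D)
  then have "(\<Sum>n. (norm (hardy_coeff f n))\<^sup>2) \<le> c\<^sup>2"
    by (intro suminf_le_const summable_norm_hardy_coeff)
  then show ?thesis using c unfolding hardy_norm_def by (intro real_le_lsqrt)
qed

lemma hardy_norm_scaleC: "hardy_norm (c *\<^sub>C f) = cmod c * hardy_norm f"
  by (simp add: hardy_norm_def hardy_coeff_simps norm_scaleC power_mult_distrib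
      suminf_mult[OF summable_norm_hardy_coeff] real_sqrt_mult)

lemma hardy_norm_eq_0: "hardy_norm f = 0 \<longleftrightarrow> f = 0"
proof
  assume "hardy_norm f = 0"
  then have "(\<Sum>n. (norm (hardy_coeff f n))\<^sup>2) = 0" by (simp add: hardy_norm_def)
  then have "\<forall>n. (norm (hardy_coeff f n))\<^sup>2 = 0"
    using suminf_eq_zero_iff[OF summable_norm_hardy_coeff[of f]] by simp
  then show "f = 0" by (intro hardy2_eqI) (simp add: hardy_coeff_simps)
qed (simp add: hardy_norm_def hardy_coeff_simps)

lemma hardy_norm_triangle: "hardy_norm (f + g) \<le> hardy_norm f + hardy_norm g"
proof (rule hardy_norm_leI)
  fix m
  have "L2_set (\<lambda>n. norm (hardy_coeff (f + g) n)) {..<m}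
      \<le> L2_set (\<lambda>n. norm (hardy_coeff f n) + norm (hardy_coeff g n)) {..<m}"
    unfolding hardy_coeff_simps by (intro L2_set_mono norm_triangle_ineq norm_ge_zero)
  also have "\<dots> \<le> L2_set (\<lambda>n. norm (hardy_coeff f n)) {..<m} + L2_set (\<lambda>n. norm (hardy_coeff g n)) {..<m}"
    by (rule L2_set_triangle_ineq)
  also have "\<dots> \<le> hardy_norm f + hardy_norm g"
    by (intro add_mono L2_set_le_hardy_norm)
  finally show "L2_set (\<lambda>n. norm (hardy_coeff (f + g) n)) {..<m} \<le> hardy_norm f + hardy_norm g" .
qed

instance hardy2 :: (chilbert_space) real_vector
proof
  fix r s :: real and f g h :: "'a hardy2"
  show "f + g + h = f + (g + h)"
    by (rule hardy2_eqI) (simp add: hardy_coeff_simps add.assoc)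
  show "f + g = g + f"
    by (rule hardy2_eqI) (simp add: hardy_coeff_simps add.commute)
  show "0 + f = f"
    by (rule hardy2_eqI) (simp add: hardy_coeff_simps)
  show "- f + f = 0"
    by (rule hardy2_eqI) (simp add: hardy_coeff_simps)
  show "f - g = f + - g"
    by (rule minus_hardy2_def)
  show "r *\<^sub>R (f + g) = r *\<^sub>R f + r *\<^sub>R g"
    by (rule hardy2_eqI) (simp add: hardy_coeff_simps scaleR_add_right)
  show "(r + s) *\<^sub>R f = r *\<^sub>R f + s *\<^sub>R f"
    by (rule hardy2_eqI) (simp add: hardy_coeff_simps scaleR_add_left)
  show "r *\<^sub>R s *\<^sub>R f = (r * s) *\<^sub>R f"
    by (rule hardy2_eqI) (simp add: hardy_coeff_simps)
  show "1 *\<^sub>R f = f"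
    by (rule hardy2_eqI) (simp add: hardy_coeff_simps)
qed

instantiation hardy2 :: (chilbert_space) real_normed_vector
begin

definition norm_hardy2 :: "'a hardy2 \<Rightarrow> real"
  where "norm_hardy2 f = hardy_norm f"

definition dist_hardy2 :: "'a hardy2 \<Rightarrow> 'a hardy2 \<Rightarrow> real"
  where "dist_hardy2 f g = norm (f - g)"

definition sgn_hardy2 :: "'a hardy2 \<Rightarrow> 'a hardy2"
  where "sgn_hardy2 f = inverse (norm f) *\<^sub>R f"

definition uniformity_hardy2 :: "('a hardy2 \<times> 'a hardy2) filter"
  where "uniformity_hardy2 = (INF e\<in>{0 <..}. principal {(f, g). dist f g < e})"

definition open_hardy2 :: "'a hardy2 set \<Rightarrow> bool"
  where "open_hardy2 S = (\<forall>x\<in>S. \<forall>\<^sub>F (x', y) in uniformity. x' = x \<longrightarrow> y \<in> S)"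

instance
proof
  fix r :: real and f g :: "'a hardy2" and S :: "'a hardy2 set"
  show "norm f = 0 \<longleftrightarrow> f = 0"
    unfolding norm_hardy2_def by (rule hardy_norm_eq_0)
  show "norm (f + g) \<le> norm f + norm g"
    unfolding norm_hardy2_def by (rule hardy_norm_triangle)
  show "norm (r *\<^sub>R f) = \<bar>r\<bar> * norm f"
    unfolding norm_hardy2_def scaleR_hardy2_def hardy_norm_scaleC norm_of_real ..
  show "dist f g = norm (f - g)"
    by (rule dist_hardy2_def)
  show "sgn f = inverse (norm f) *\<^sub>R f"
    by (rule sgn_hardy2_def)
  show "uniformity = (INF e\<in>{0 <..}. principal {(f, g :: 'a hardy2). dist f g < e})"
    by (rule uniformity_hardy2_def)
  show "open S = (\<forall>x\<in>S. \<forall>\<^sub>F (x', y) in uniformity. x' = x \<longrightarrow> y \<in> S)"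
    by (rule open_hardy2_def)
qed

end

instance hardy2 :: (chilbert_space) complex_inner
proof
  fix c d :: complex and r :: real and f g h :: "'a hardy2"
  show "c *\<^sub>C (f + g) = c *\<^sub>C f + c *\<^sub>C g"
    by (rule hardy2_eqI) (simp add: hardy_coeff_simps scaleC_add_right)
  show "(c + d) *\<^sub>C f = c *\<^sub>C f + d *\<^sub>C f"
    by (rule hardy2_eqI) (simp add: hardy_coeff_simps scaleC_add_left)
  show "c *\<^sub>C d *\<^sub>C f = (c * d) *\<^sub>C f"
    by (rule hardy2_eqI) (simp add: hardy_coeff_simps scaleC_scaleC)
  show "complex_of_real r *\<^sub>C f = r *\<^sub>R f"
    by (simp add: scaleR_hardy2_def)
  show "norm (c *\<^sub>C f) = cmod c * norm f"
    by (simp add: norm_hardy2_def hardy_norm_scaleC)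
  show "cinner (f + g) h = cinner f h + cinner g h"
    unfolding cinner_hardy2_def hardy_coeff_simps cinner_add_left
    by (intro suminf_add[symmetric] summable_cinner_hardy_coeff)
  show "cinner (c *\<^sub>C f) g = c * cinner f g"
    unfolding cinner_hardy2_def hardy_coeff_simps cinner_scaleC_left
    by (intro suminf_mult summable_cinner_hardy_coeff)
  show "cinner g f = cnj (cinner f g)"
    unfolding cinner_hardy2_def
      bounded_linear.suminf[OF bounded_linear_cnj summable_cinner_hardy_coeff[of f g]]
    by (intro arg_cong[of _ _ suminf] ext cinner_commute)
  show "cinner f f = complex_of_real ((norm f)\<^sup>2)"
    unfolding cinner_hardy2_def norm_hardy2_def hardy_norm_sq cinner_self
    by (intro suminf_of_real[symmetric] summable_norm_hardy_coeff)
qed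

instance hardy2 :: (chilbert_space) chilbert_space
proof
  fix X :: "nat \<Rightarrow> 'a hardy2"
  assume "Cauchy X"
  note L2_set_le = L2_set_le_hardy_norm[folded norm_hardy2_def]
    and norm_leI = hardy_norm_leI[folded norm_hardy2_def]
  have hardy_coeff_le: "norm (hardy_coeff f n) \<le> norm f" for f :: "'a hardy2" and n
    using L2_set_le[of f "Suc n"] member_le_L2_set[of "{..<Suc n}" n "\<lambda>n. norm (hardy_coeff f n)"]
    by simp
  have "Cauchy (\<lambda>k. hardy_coeff (X k) n)" for n
  proof (rule metric_CauchyI)
    fix e :: real assume "e > 0"
    then obtain N where "\<forall>k\<ge>N. \<forall>l\<ge>N. dist (X k) (X l) < e"
      using \<open>Cauchy X\<close> by (meson metric_CauchyD)
    then show "\<exists>N. \<forall>k\<ge>N. \<forall>l\<ge>N. dist (hardy_coeff (X k) n) (hardy_coeff (X l) n) < e"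
      using hardy_coeff_le[of "X _ - X _" n]
      by (intro exI[of _ N]) (simp add: dist_norm hardy_coeff_simps, meson le_less_trans)
  qed
  then have "\<forall>n. \<exists>l. (\<lambda>k. hardy_coeff (X k) n) \<longlonglongrightarrow> l"
    using Cauchy_convergent convergent_def by blast
  then obtain a where a: "\<And>n. (\<lambda>k. hardy_coeff (X k) n) \<longlonglongrightarrow> a n" by metis
  have close: "\<exists>N. \<forall>k\<ge>N. \<forall>m. L2_set (\<lambda>n. norm (hardy_coeff (X k) n - a n)) {..<m} \<le> e" if "e > 0" for e
  proof -
    obtain N where N: "\<And>k l. k \<ge> N \<Longrightarrow> l \<ge> N \<Longrightarrow> norm (X k - X l) < e"
      using metric_CauchyD[OF \<open>Cauchy X\<close> \<open>e > 0\<close>] unfolding dist_norm by blast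
    have "L2_set (\<lambda>n. norm (hardy_coeff (X k) n - a n)) {..<m} \<le> e" if "k \<ge> N" for k m
    proof (rule LIMSEQ_le_const2)
      show "(\<lambda>l. L2_set (\<lambda>n. norm (hardy_coeff (X k) n - hardy_coeff (X l) n)) {..<m})
          \<longlonglongrightarrow> L2_set (\<lambda>n. norm (hardy_coeff (X k) n - a n)) {..<m}"
        unfolding L2_set_def by (intro tendsto_intros a)
      show "\<exists>M. \<forall>l\<ge>M. L2_set (\<lambda>n. norm (hardy_coeff (X k) n - hardy_coeff (X l) n)) {..<m} \<le> e"
        using L2_set_le[of "X k - X _" m] N[OF that]
        by (intro exI[of _ N]) (simp add: hardy_coeff_simps, meson order_trans less_imp_le)
    qed
    then show ?thesis by blast
  qed
  obtain N where N: "\<And>m. L2_set (\<lambda>n. norm (hardy_coeff (X N) n - a n)) {..<m} \<le> 1"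
    using close[of 1] by auto
  have "l2seq (\<lambda>n. hardy_coeff (X N) n - a n)"
    unfolding l2seq_def
  proof (rule summableI_nonneg_bounded)
    show "(\<Sum>n<m. (norm (hardy_coeff (X N) n - a n))\<^sup>2) \<le> 1" for m
      using N[of m] by (simp add: L2_set_def)
  qed simp
  from l2seq_add[OF hardy_coeff(1)[of "X N"] l2seq_scaleC[OF this, of "-1"]]
  have a_l2: "l2seq a" by (simp add: scaleC_minus_one)
  define Y where "Y = Hardy (hardy_series a)"
  have "X \<longlonglongrightarrow> Y"
  proof (rule metric_LIMSEQ_I)
    fix e :: real assume "e > 0"
    then obtain N where N: "\<And>k m. k \<ge> N \<Longrightarrow> L2_set (\<lambda>n. norm (hardy_coeff (X k) n - a n)) {..<m} \<le> e / 2"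
      using close[of "e / 2"] by auto
    have "dist (X k) Y \<le> e / 2" if "k \<ge> N" for k
      unfolding dist_norm using N[OF that]
      by (intro norm_leI) (simp add: hardy_coeff_simps Y_def hardy_coeff_Hardy a_l2)
    then show "\<exists>N. \<forall>k\<ge>N. dist (X k) Y < e"
      using \<open>e > 0\<close> by (intro exI[of _ N]) force
  qed
  then show "convergent X" by (rule convergentI)
qed

text \<open>
  For \<open>F\<close> in the Schur class, pointwise multiplication by \<open>F\<close> is a contraction between the Hardy
  spaces, so that \<open>Hardy\<close> and \<open>Blinfun\<close> are applied to arguments in their proper domains.
\<close>

definition mult_op ::
    "(complex \<Rightarrow> 'u::chilbert_space \<Rightarrow>\<^sub>L 'y::chilbert_space) \<Rightarrow> 'u hardy2 \<Rightarrow>\<^sub>L 'y hardy2"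
  where "mult_op F =
    Blinfun (\<lambda>h. Hardy (\<lambda>z. if z \<in> \<bbbD> then F z (hardy_apply h z) else 0))"

definition schur_prec ::
    "(complex \<Rightarrow> 'u::chilbert_space \<Rightarrow>\<^sub>L 'y::chilbert_space) \<Rightarrow> (complex \<Rightarrow> 'u \<Rightarrow>\<^sub>L 'y) \<Rightarrow> bool"
    (infix \<open>\<prec>\<^sub>\<infinity>\<close> 50)
  where "F \<prec>\<^sub>\<infinity> G \<longleftrightarrow> mult_op F \<prec> mult_op G"

definition schur_equiv ::
    "(complex \<Rightarrow> 'u::chilbert_space \<Rightarrow>\<^sub>L 'y::chilbert_space) \<Rightarrow> (complex \<Rightarrow> 'u \<Rightarrow>\<^sub>L 'y) \<Rightarrow> bool"
    (infix \<open>\<sim>\<^sub>\<infinity>\<close> 50)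
  where "F \<sim>\<^sub>\<infinity> G \<longleftrightarrow> F \<prec>\<^sub>\<infinity> G \<and> G \<prec>\<^sub>\<infinity> F"

section \<open>The Redheffer map\<close>

definition block11 :: "('a::chilbert_space \<times> 'b::chilbert_space) \<Rightarrow>\<^sub>L ('c::chilbert_space \<times> 'd::chilbert_space)
    \<Rightarrow> 'a \<Rightarrow>\<^sub>L 'c"
  where "block11 A = Blinfun (\<lambda>x. fst (A (x, 0)))"

definition block12 :: "('a::chilbert_space \<times> 'b::chilbert_space) \<Rightarrow>\<^sub>L ('c::chilbert_space \<times> 'd::chilbert_space)
    \<Rightarrow> 'b \<Rightarrow>\<^sub>L 'c"
  where "block12 A = Blinfun (\<lambda>y. fst (A (0, y)))"

definition block21 :: "('a::chilbert_space \<times> 'b::chilbert_space) \<Rightarrow>\<^sub>L ('c::chilbert_space \<times> 'd::chilbert_space)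
    \<Rightarrow> 'a \<Rightarrow>\<^sub>L 'd"
  where "block21 A = Blinfun (\<lambda>x. snd (A (x, 0)))"

definition block22 :: "('a::chilbert_space \<times> 'b::chilbert_space) \<Rightarrow>\<^sub>L ('c::chilbert_space \<times> 'd::chilbert_space)
    \<Rightarrow> 'b \<Rightarrow>\<^sub>L 'd"
  where "block22 A = Blinfun (\<lambda>y. snd (A (0, y)))"

definition redheffer ::
    "(complex \<Rightarrow> ('f::chilbert_space \<times> 'u::chilbert_space) \<Rightarrow>\<^sub>L ('e::chilbert_space \<times> 'y::chilbert_space))
      \<Rightarrow> (complex \<Rightarrow> 'e \<Rightarrow>\<^sub>L 'f) \<Rightarrow> complex \<Rightarrow> 'u \<Rightarrow>\<^sub>L 'y"
  where "redheffer \<Phi> F z =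
    block22 (\<Phi> z) + (block21 (\<Phi> z) o\<^sub>L F z o\<^sub>L
      inv_op (id_blinfun - (block11 (\<Phi> z) o\<^sub>L F z)) o\<^sub>L block12 (\<Phi> z))"

end

(*
  By Riesz and Douglas, A \<prec> B holds iff |<(A - B) x, y>| \<le> c q_B(x) q_{B*}(y), where
  q_B(x)^2 = |x|^2 - |B x|^2.

  Suppose that Phi_12 is invertible. Radial limits and Parseval's identity show that
  multiplication by Phi is an isometry M. Solving x = M11 B x + M12 u for u and
  A* w = M11 w + M12 v for v, and putting y = M21 w + M22 v, one gets
    <(R[A] - R[B]) u, y> = <(A - B) x, w>,  q_{R[B]}(u) = q_B(x),  q_{R[A]*}(y) = q_{A*}(w).
  Equivalent contractions have comparable defects, so |<(A - B) x, w>| \<le> c q_B(x) q_{A*}(w); the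
  remaining comparison of q_A with q_B follows because x depends on A only through M11 (A - B).

  The case of Phi_21 reduces to this one by the reflection F~(z) = F(cnj z)*: reversing the
  coordinates in finite sections of T_F shows that T_F \<prec> T_G implies T_{F~} \<prec> T_{G~}, and
  multiplication by Phi~ is an isometry because the boundary values of Phi are co-isometric.
*)

theory Submission
  imports Defs "HOL-Complex_Analysis.Complex_Analysis"
begin

section \<open>Operators on complex Hilbert spaces\<close>

text \<open>Only one off-diagonal block is invertible, so the Redheffer images cannot be tested
  against arbitrary pairs of vectors. Inputs are produced from \<open>B\<close> and outputs from
  \<open>A\<close>: with this crossed choice the difference of the images reduces exactly to that of
  \<open>A\<close> and \<open>B\<close>, whereas taking both from the same operator would bring in a
  second state. The price is a bound mixing the defect of \<open>B\<close> with that of the adjoint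
  of \<open>A\<close>, and removing the mixture uses both halves of the equivalence. The strict
  bound on \<open>block11\<close> behind all resolvents is not assumed: it is forced by a
  contractive first row whose second entry has a bounded right inverse. Multiplication by a
  two-sided inner function is in general an isometry but not unitary. The second case therefore
  cannot be obtained by taking adjoints of Hardy space operators; the adjoint is taken pointwise in
  the symbol. Boundary values enter only through the isometry property. It is checked on
  polynomials, where just scalar functions are integrated, so that measurability of an operator
  valued boundary function never comes up.\<close>

lemma cinner_add_right: "cinner x (y + z) = cinner x y + cinner x z"
  for x y z :: "'a::complex_inner"
  by (metis cinner_add_left cinner_commute complex_cnj_add)

lemma cinner_scaleC_right: "cinner x (c *\<^sub>C y) = cnj c * cinner x y"
  for x y :: "'a::complex_inner"
  by (metis cinner_scaleC_left cinner_commute complex_cnj_mult)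

lemma bounded_linear_cinner_right: "bounded_linear (\<lambda>y::'a::complex_inner. cinner x y)"
proof -
  have "bounded_linear (\<lambda>y. cnj (cinner y x))"
    by (rule bounded_linear_compose[OF bounded_linear_cnj bounded_linear_cinner_left])
  then show ?thesis by (simp flip: cinner_commute)
qed

lemmas cinner_diff_left = linear_diff[OF bounded_linear.linear[OF bounded_linear_cinner_left]]
lemmas cinner_diff_right = linear_diff[OF bounded_linear.linear[OF bounded_linear_cinner_right]]
lemmas cinner_zero_left [simp] = linear_0[OF bounded_linear.linear[OF bounded_linear_cinner_left]]
lemmas cinner_zero_right [simp] = linear_0[OF bounded_linear.linear[OF bounded_linear_cinner_right]]
lemmas cinner_sum_left = linear_sum[OF bounded_linear.linear[OF bounded_linear_cinner_left]]
lemmas cinner_sum_right = linear_sum[OF bounded_linear.linear[OF bounded_linear_cinner_right]]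
lemmas tendsto_cinner_left = bounded_linear.tendsto[OF bounded_linear_cinner_left]
lemmas tendsto_cinner_right = bounded_linear.tendsto[OF bounded_linear_cinner_right]

lemma scaleC_diff_right: "c *\<^sub>C (x - y) = c *\<^sub>C x - c *\<^sub>C y"
  for x y :: "'a::complex_normed_vector"
  by (rule linear_diff[OF bounded_linear.linear[OF bounded_linear_scaleC]])

lemma scaleC_sum_right: "c *\<^sub>C (\<Sum>i\<in>A. f i) = (\<Sum>i\<in>A. c *\<^sub>C f i)"
  for f :: "'i \<Rightarrow> 'a::complex_normed_vector"
  by (rule linear_sum[OF bounded_linear.linear[OF bounded_linear_scaleC]])

lemma scaleC_one [simp]: "1 *\<^sub>C x = x" for x :: "'a::complex_normed_vector"
  using scaleC_of_real[of 1 x] by simp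

lemma scaleC_zero_left [simp]: "0 *\<^sub>C x = 0" for x :: "'a::complex_normed_vector"
  using scaleC_of_real[of 0 x] by simp

lemma norm_sq_add: "(norm (x + y))\<^sup>2 = (norm x)\<^sup>2 + 2 * Re (cinner x y) + (norm y)\<^sup>2"
  for x y :: "'a::complex_inner"
proof -
  have "complex_of_real ((norm (x + y))\<^sup>2) = cinner (x + y) (x + y)"
    by (rule cinner_self[symmetric])
  also have "\<dots> = of_real ((norm x)\<^sup>2) + cinner x y + cnj (cinner x y) + of_real ((norm y)\<^sup>2)"
    by (simp only: cinner_add_left cinner_add_right cinner_self[of x] cinner_self[of y]
        cinner_commute[of y x] ac_simps)
  finally show ?thesis by (simp add: complex_eq_iff)
qed

lemma norm_sq_diff: "(norm (x - y))\<^sup>2 = (norm x)\<^sup>2 - 2 * Re (cinner x y) + (norm y)\<^sup>2"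
  for x y :: "'a::complex_inner"
  using norm_sq_add[of x "-y"] cinner_diff_right[of x 0 y] by simp

lemma cinner_eqI: "(\<And>y. cinner x y = cinner x' y) \<Longrightarrow> x = x'" for x x' :: "'a::complex_inner"
  using cinner_self[of "x - x'"] by (simp add: cinner_diff_left)

lemma cinner_Cauchy_Schwarz: "cmod (cinner x y) \<le> norm x * norm y"
  for x y :: "'a::complex_inner"
proof (cases "y = 0")
  case False
  then have y: "(norm y)\<^sup>2 > 0" by simp
  define c where "c = cinner x y / of_real ((norm y)\<^sup>2)"
  have "Re (cinner x (c *\<^sub>C y)) = (cmod (cinner x y))\<^sup>2 / (norm y)\<^sup>2"
    by (simp add: cinner_scaleC_right c_def complex_norm_square[symmetric] mult.commute
        flip: of_real_power of_real_divide)
  moreover have "(norm (c *\<^sub>C y))\<^sup>2 = (cmod (cinner x y))\<^sup>2 / (norm y)\<^sup>2"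
    using y by (simp add: norm_scaleC c_def norm_divide norm_mult power_mult_distrib
        power2_eq_square)
  ultimately have "0 \<le> (norm x)\<^sup>2 - (cmod (cinner x y))\<^sup>2 / (norm y)\<^sup>2"
    using norm_sq_diff[of x "c *\<^sub>C y"] zero_le_power2[of "norm (x - c *\<^sub>C y)"] by linarith
  then have "(cmod (cinner x y))\<^sup>2 \<le> (norm x * norm y)\<^sup>2"
    using y by (simp add: field_simps power_mult_distrib)
  then show ?thesis by (rule power2_le_imp_le) simp
qed simp

lemma norm_le_by_cinner:
  fixes x :: "'a::complex_inner"
  assumes "\<And>y. cmod (cinner x y) \<le> c * norm y" and "0 \<le> c"
  shows "norm x \<le> c"
proof (cases "x = 0")
  case False
  have "norm x * norm x \<le> c * norm x"
    using assms(1)[of x] by (simp add: cinner_self norm_mult power2_eq_square)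
  with False show ?thesis by simp
qed (use assms(2) in simp)

lemma clinearD: "clinear A \<Longrightarrow> A (c *\<^sub>C x) = c *\<^sub>C A x"
  by (simp add: clinear_def)

text \<open>
  A form dominated by the semi-norm of \<open>D\<close> in its first argument is represented, for each second
  argument, by the minimiser over the closure of the range of \<open>D\<close> of the corresponding quadratic
  functional. This one variational statement yields the Riesz theorem (\<open>D\<close> the identity), hence
  adjoints, as well as Douglas factorisation.
\<close>

lemma functional_rep:
  fixes D :: "'a::complex_normed_vector \<Rightarrow>\<^sub>L 'b::chilbert_space" and f :: "'a \<Rightarrow> complex"
  assumes D: "clinear D"
    and add: "\<And>x x'. f (x + x') = f x + f x'" and scale: "\<And>c x. f (c *\<^sub>C x) = c * f x"
    and bound: "\<And>x. cmod (f x) \<le> N * norm (D x)"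
    and "0 \<le> N"
  shows "\<exists>w\<in>closure (range D). (\<forall>x. f x = cinner (D x) w) \<and> norm w \<le> N"
proof -
  \<comment> \<open>The representing vector is the limit of \<open>D\<close> along a minimising
    sequence of this functional; it lies in the closure of the range, which need not be closed. Only
    real parts enter; imaginary parts are recovered at the end by replacing x with i x.\<close>
  define J where "J x = (norm (D x))\<^sup>2 - 2 * Re (f x)" for x
  have J_lower: "- (N\<^sup>2) \<le> J x" for x
  proof -
    have "Re (f x) \<le> N * norm (D x)" using complex_Re_le_cmod[of "f x"] bound[of x] by linarith
    then show ?thesis
      using sum_squares_bound[of "N" "norm (D x)"] unfolding J_def by linarith
  qed
  define m where "m = Inf (range J)"
  have m_le: "m \<le> J x" for x
    unfolding m_def by (rule cInf_lower) (auto intro!: bdd_belowI2[of _ "-(N\<^sup>2)"] J_lower)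
  have "\<exists>x. J x < m + 1 / real (Suc n)" for n
    using cInf_lessD[of "range J" "m + 1 / real (Suc n)"] unfolding m_def by auto
  then obtain X where X: "\<And>n. J (X n) < m + 1 / real (Suc n)" by metis
  \<comment> \<open>The parallelogram law makes \<open>D (X n)\<close> Cauchy, although
    \<open>X n\<close> itself need not converge.\<close>
  have para: "(norm (D x - D x'))\<^sup>2 \<le> 2 * J x + 2 * J x' - 4 * m" for x x'
  proof -
    define y where "y = (1/2) *\<^sub>R (x + x')"
    have Dy: "D y = (1/2) *\<^sub>R (D x + D x')" by (simp add: y_def blinfun.bilinear_simps)
    have fy: "f y = (1/2) * (f x + f x')"
      using scale[of "complex_of_real (1/2)" "x + x'"] add[of x x'] unfolding y_def by (simp only: scaleC_of_real) simp
    have "4 * (norm (D y))\<^sup>2 + (norm (D x - D x'))\<^sup>2 = 2 * (norm (D x))\<^sup>2 + 2 * (norm (D x'))\<^sup>2"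
    proof -
      have "(norm (D y))\<^sup>2 = (norm (D x + D x'))\<^sup>2 / 4" unfolding Dy by (simp add: power_divide)
      then show ?thesis
        using norm_sq_add[of "D x" "D x'"] norm_sq_diff[of "D x" "D x'"] by linarith
    qed
    moreover have "m \<le> (norm (D y))\<^sup>2 - (Re (f x) + Re (f x'))"
      using m_le[of y] fy by (simp add: J_def add_divide_distrib)
    ultimately show ?thesis unfolding J_def by argo
  qed
  have "Cauchy (\<lambda>n. D (X n))"
  proof (rule metric_CauchyI)
    fix e :: real assume "e > 0"
    then have "e\<^sup>2 > 0" by simp
    then obtain M where M: "1 / real (Suc M) < e\<^sup>2 / 4"
      using nat_approx_posE[of "e\<^sup>2 / 4"] by auto
    have *: "J (X n) < m + e\<^sup>2 / 4" if "n \<ge> M" for n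
    proof -
      have "1 / real (Suc n) \<le> 1 / real (Suc M)" using that by (simp add: frac_le)
      then show ?thesis using X[of n] M by linarith
    qed
    have "dist (D (X k)) (D (X l)) < e" if "k \<ge> M" "l \<ge> M" for k l
    proof -
      have "(norm (D (X k) - D (X l)))\<^sup>2 < e\<^sup>2"
        using para[of "X k" "X l"] *[OF that(1)] *[OF that(2)] by linarith
      then show ?thesis unfolding dist_norm by (rule power2_less_imp_less) (use \<open>e > 0\<close> in simp)
    qed
    then show "\<exists>M. \<forall>k\<ge>M. \<forall>l\<ge>M. dist (D (X k)) (D (X l)) < e" by blast
  qed
  then obtain w where w: "(\<lambda>n. D (X n)) \<longlonglongrightarrow> w"
    using Cauchy_convergent convergent_def by blast
  have re: "Re (f x) = Re (cinner (D x) w)" for x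
  proof -
    \<comment> \<open>First variation in the direction \<open>x\<close>: the slack
      \<open>1 / Suc n\<close> by which \<open>X n\<close> may miss the infimum disappears in the
      limit.\<close>
    have "0 \<le> t\<^sup>2 * (norm (D x))\<^sup>2 + 2 * t * (Re (cinner (D x) w) - Re (f x))" for t
    proof (rule LIMSEQ_le)
      show "(\<lambda>n. - (1 / real (Suc n))) \<longlonglongrightarrow> 0"
        using tendsto_minus[OF LIMSEQ_Suc[OF lim_1_over_n[where 'a=real]]] by simp
      show "(\<lambda>n. t\<^sup>2 * (norm (D x))\<^sup>2 + 2 * t * (Re (cinner (D x) (D (X n))) - Re (f x)))
          \<longlonglongrightarrow> t\<^sup>2 * (norm (D x))\<^sup>2 + 2 * t * (Re (cinner (D x) w) - Re (f x))"
        by (intro tendsto_intros tendsto_cinner_right w)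
      have "- (1 / real (Suc n)) \<le> t\<^sup>2 * (norm (D x))\<^sup>2 + 2 * t * (Re (cinner (D x) (D (X n))) - Re (f x))" for n
      proof -
        have "J (X n + t *\<^sub>R x) = J (X n) + t\<^sup>2 * (norm (D x))\<^sup>2
            + 2 * t * (Re (cinner (D x) (D (X n))) - Re (f x))"
          unfolding J_def
          using scale[of "complex_of_real t" x] norm_sq_add[of "D (X n)" "t *\<^sub>R D x"]
            cinner_scaleC_right[of "D (X n)" "complex_of_real t" "D x"]
            arg_cong[OF cinner_commute[of "D x" "D (X n)"], of Re]
          by (simp add: add blinfun.bilinear_simps scaleC_of_real power_mult_distrib algebra_simps)
        then show ?thesis using m_le[of "X n + t *\<^sub>R x"] X[of n] by linarith
      qed
      then show "\<exists>N. \<forall>n\<ge>N. - (1 / real (Suc n)) \<le> t\<^sup>2 * (norm (D x))\<^sup>2 + 2 * t * (Re (cinner (D x) (D (X n))) - Re (f x))"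
        by blast
    qed
    note pos = this
    define b where "b = Re (cinner (D x) w) - Re (f x)"
    \<comment> \<open>Adding 1 keeps \<open>s\<close> positive when \<open>D x = 0\<close>; then
      \<open>t = - b / s\<close> makes the quadratic negative unless \<open>b = 0\<close>.\<close>
    define s where "s = (norm (D x))\<^sup>2 + 1"
    have s: "s \<ge> 1" unfolding s_def by simp
    have "0 \<le> (- b / s)\<^sup>2 * (s - 1) + 2 * (- b / s) * b"
      using pos[of "- b / s"] unfolding s_def b_def by simp
    also have "\<dots> = - (b\<^sup>2 * (s + 1) / s\<^sup>2)"
      using s by (simp add: field_simps power2_eq_square)
    finally have "b\<^sup>2 * (s + 1) / s\<^sup>2 \<le> 0" by simp
    moreover have "0 < s\<^sup>2" using s by simp
    ultimately have "b\<^sup>2 * (s + 1) \<le> 0" by (simp add: divide_le_0_iff)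
    then have "b = 0" using s by (simp add: mult_le_0_iff)
    then show ?thesis by (simp add: b_def)
  qed
  have eq: "f x = cinner (D x) w" for x
  proof -
    have "Re (f (\<i> *\<^sub>C x)) = Re (cinner (D (\<i> *\<^sub>C x)) w)" by (rule re)
    then have "Im (f x) = Im (cinner (D x) w)"
      by (simp add: scale clinearD[OF D] cinner_scaleC_left)
    with re[of x] show ?thesis by (simp add: complex_eq_iff)
  qed
  have "(\<lambda>n. cmod (cinner (D (X n)) w)) \<longlonglongrightarrow> cmod (cinner w w)"
    by (intro tendsto_intros tendsto_cinner_left w)
  moreover have "(\<lambda>n. N * norm (D (X n))) \<longlonglongrightarrow> N * norm w"
    by (intro tendsto_intros w)
  ultimately have "cmod (cinner w w) \<le> N * norm w"
    by (rule LIMSEQ_le) (use bound eq in auto)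
  then have "norm w * norm w \<le> N * norm w"
    by (simp add: cinner_self norm_mult power2_eq_square)
  then have "norm w \<le> N"
    using \<open>0 \<le> N\<close> by (cases "w = 0") auto
  moreover have "w \<in> closure (range D)"
    unfolding closure_sequential by (rule exI[of _ "\<lambda>n. D (X n)"]) (use w in simp)
  ultimately show ?thesis using eq by (intro bexI[of _ w] conjI allI)
qed

lemma closure_rangeE:
  fixes f :: "'a \<Rightarrow> 'b::metric_space"
  assumes "u \<in> closure (range f)"
  obtains p where "(\<lambda>n. f (p n)) \<longlonglongrightarrow> u"
proof -
  obtain x where x: "\<And>n. x n \<in> range f" "x \<longlonglongrightarrow> u"
    using assms unfolding closure_sequential by blast
  then obtain p where "x = (\<lambda>n. f (p n))" by (metis image_iff)
  with x(2) that show thesis by simp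
qed

text \<open>Inside the closure of the range the representing vector is unique, because a vector
  there orthogonal to the range vanishes; uniqueness makes the chosen representatives depend
  linearly on \<open>y\<close>. The bound \<open>N y\<close> is kept apart from
  \<open>M * norm y\<close> so that a finer semi-norm in the second argument survives and the lemma
  can be applied again to \<open>W\<close>.\<close>

lemma form_rep:
  fixes D :: "'a::complex_normed_vector \<Rightarrow>\<^sub>L 'b::chilbert_space"
    and b :: "'a \<Rightarrow> 'c::complex_normed_vector \<Rightarrow> complex"
  assumes D: "clinear D"
    and add: "\<And>x x' y. b (x + x') y = b x y + b x' y" and scale: "\<And>c x y. b (c *\<^sub>C x) y = c * b x y"
    and add': "\<And>x y y'. b x (y + y') = b x y + b x y'" and scale': "\<And>c x y. b x (c *\<^sub>C y) = cnj c * b x y"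
    and bound: "\<And>x y. cmod (b x y) \<le> N y * norm (D x)"
    and N: "\<And>y. 0 \<le> N y" "\<And>y. N y \<le> M * norm y"
  obtains W :: "'c \<Rightarrow>\<^sub>L 'b" where "clinear W" "\<And>y. W y \<in> closure (range D)"
    "\<And>x y. b x y = cinner (D x) (W y)" "\<And>y. norm (W y) \<le> N y"
proof -
  have "\<forall>y. \<exists>w\<in>closure (range D). (\<forall>x. b x y = cinner (D x) w) \<and> norm w \<le> N y"
    using functional_rep[OF D, of "\<lambda>x. b x _" "N _"] add scale bound N(1) by auto
  then obtain W where W: "\<And>y. W y \<in> closure (range D)" "\<And>x y. b x y = cinner (D x) (W y)"
    "\<And>y. norm (W y) \<le> N y" by metis
  have sub: "u + c *\<^sub>C v \<in> closure (range D)" if u: "u \<in> closure (range D)" and v: "v \<in> closure (range D)" for u v c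
  proof -
    obtain p where p: "(\<lambda>n. D (p n)) \<longlonglongrightarrow> u" using u by (rule closure_rangeE)
    obtain q where q: "(\<lambda>n. D (q n)) \<longlonglongrightarrow> v" using v by (rule closure_rangeE)
    have "(\<lambda>n. D (p n) + c *\<^sub>C D (q n)) \<longlonglongrightarrow> u + c *\<^sub>C v"
      by (intro tendsto_intros p q bounded_linear.tendsto[OF bounded_linear_scaleC])
    moreover have "D (p n) + c *\<^sub>C D (q n) = D (p n + c *\<^sub>C q n)" for n
      by (simp add: clinearD[OF D] blinfun.bilinear_simps)
    ultimately have "(\<lambda>n. D (p n + c *\<^sub>C q n)) \<longlonglongrightarrow> u + c *\<^sub>C v" by simp
    then show ?thesis
      unfolding closure_sequential by (intro exI[of _ "\<lambda>n. D (p n + c *\<^sub>C q n)"]) simp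
  qed
  have zero: "u = 0" if u: "u \<in> closure (range D)" and orth: "\<And>x. cinner (D x) u = 0" for u
  proof -
    obtain p where "(\<lambda>n. D (p n)) \<longlonglongrightarrow> u"
      using u by (rule closure_rangeE)
    then have "(\<lambda>n. cinner (D (p n)) u) \<longlonglongrightarrow> cinner u u" by (rule tendsto_cinner_left)
    with orth have "cinner u u = 0" by (simp add: LIMSEQ_const_iff)
    then show ?thesis by (simp add: cinner_self)
  qed
  have add_W: "W (y + c *\<^sub>C y') = W y + c *\<^sub>C W y'" for y y' c
  proof -
    have "W (y + c *\<^sub>C y') + (-1) *\<^sub>C (W y + c *\<^sub>C W y') = 0"
    proof (rule zero)
      show "cinner (D x) (W (y + c *\<^sub>C y') + (-1) *\<^sub>C (W y + c *\<^sub>C W y')) = 0" for x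
        by (simp add: cinner_add_right cinner_scaleC_right add' scale' flip: W(2))
    qed (intro sub W)
    then show ?thesis by (simp only: scaleC_minus_one add_uminus_conv_diff right_minus_eq)
  qed
  have W0: "W 0 = 0" using order_trans[OF W(3)[of 0] N(2)[of 0]] by simp
  have W_add: "W (y + y') = W y + W y'" for y y' using add_W[of y 1 y'] by simp
  have W_scale: "W (c *\<^sub>C y) = c *\<^sub>C W y" for y c using add_W[of 0 c y] W0 by simp
  have lin: "bounded_linear W"
  proof (rule bounded_linear_intro[where K = M])
    show "W (r *\<^sub>R y) = r *\<^sub>R W y" for r y
      using W_scale[of "complex_of_real r" y] by (simp add: scaleC_of_real)
    show "norm (W y) \<le> norm y * M" for y
      using W(3)[of y] N(2)[of y] by (simp add: mult.commute)
  qed (rule W_add)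
  show thesis
    by (rule that[of "Blinfun W"])
      (use W W_scale in \<open>simp_all add: clinear_def bounded_linear_Blinfun_apply[OF lin]\<close>)
qed

lemmas compose_add_left = bounded_bilinear.add_left[OF bounded_bilinear_blinfun_compose]
lemmas compose_add_right = bounded_bilinear.add_right[OF bounded_bilinear_blinfun_compose]
lemmas compose_diff_right = bounded_bilinear.diff_right[OF bounded_bilinear_blinfun_compose]
lemmas compose_scaleR_left = bounded_bilinear.scaleR_left[OF bounded_bilinear_blinfun_compose]
lemmas compose_scaleR_right = bounded_bilinear.scaleR_right[OF bounded_bilinear_blinfun_compose]
lemmas compose_tendsto = bounded_bilinear.tendsto[OF bounded_bilinear_blinfun_compose]

lemma compose_assoc: "(A o\<^sub>L B) o\<^sub>L C = A o\<^sub>L (B o\<^sub>L C)"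
  by (rule blinfun_eqI) simp

lemma clinear_id [simp]: "clinear id_blinfun" by (simp add: clinear_def)
lemma clinear_0 [simp]: "clinear 0" by (simp add: clinear_def)
lemma clinear_compose [intro]: "clinear A \<Longrightarrow> clinear B \<Longrightarrow> clinear (A o\<^sub>L B)" by (simp add: clinear_def)
lemma clinear_add [intro]: "clinear A \<Longrightarrow> clinear B \<Longrightarrow> clinear (A + B)"
  by (simp add: clinear_def blinfun.bilinear_simps scaleC_add_right)
lemma clinear_diff [intro]: "clinear A \<Longrightarrow> clinear B \<Longrightarrow> clinear (A - B)"
  by (simp add: clinear_def blinfun.bilinear_simps scaleC_diff_right)
lemma clinear_scaleC [intro]: "clinear A \<Longrightarrow> clinear (c *\<^sub>C A)"
  by (simp add: clinear_def scaleC_blinfun.rep_eq scaleC_scaleC mult.commute)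

subsection \<open>Adjoints\<close>

lemma adj_unique: "(\<And>x y. cinner (A x) y = cinner x (B y)) \<Longrightarrow> adj A = B"
  for B :: "'b::chilbert_space \<Rightarrow>\<^sub>L 'a::chilbert_space" and A :: "'a::chilbert_space \<Rightarrow>\<^sub>L 'b::chilbert_space"
  unfolding adj_def
proof (rule the_equality)
  fix B' :: "'b \<Rightarrow>\<^sub>L 'a"
  assume AB: "\<And>x y. cinner (A x) y = cinner x (B y)"
    and AB': "\<forall>x y. cinner (A x) y = cinner x (B' y)"
  show "B' = B"
    by (intro blinfun_eqI cinner_eqI) (metis AB AB' cinner_commute)
qed simp

lemma
  fixes A :: "'a::chilbert_space \<Rightarrow>\<^sub>L 'b::chilbert_space"
  assumes A: "clinear A"
  shows cinner_adj_right: "cinner x (adj A y) = cinner (A x) y"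
    and clinear_adj: "clinear (adj A)"
    and norm_adj_le: "norm (adj A) \<le> norm A"
proof -
  obtain W :: "'b \<Rightarrow>\<^sub>L 'a" where W: "clinear W"
    "\<And>x y. cinner (A x) y = cinner ((id_blinfun :: 'a \<Rightarrow>\<^sub>L 'a) x) (W y)"
    "\<And>y. norm (W y) \<le> norm A * norm y"
  proof (rule form_rep[where D = "id_blinfun :: 'a \<Rightarrow>\<^sub>L 'a" and b = "\<lambda>x y. cinner (A x) y"
        and N = "\<lambda>y. norm A * norm y" and M = "norm A"])
    show "cmod (cinner (A x) y) \<le> norm A * norm y * norm ((id_blinfun :: 'a \<Rightarrow>\<^sub>L 'a) x)" for x y
      using cinner_Cauchy_Schwarz[of "A x" y] mult_right_mono[OF norm_blinfun[of A x], of "norm y"]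
      by (simp add: ac_simps)
  qed (simp_all add: blinfun.bilinear_simps cinner_add_left cinner_add_right clinearD[OF A]
      cinner_scaleC_left cinner_scaleC_right)
  have "adj A = W" by (rule adj_unique) (simp add: W(2))
  with W show "cinner x (adj A y) = cinner (A x) y" "clinear (adj A)" "norm (adj A) \<le> norm A"
    by (auto intro: norm_blinfun_bound)
qed

lemma cinner_adj_left: "clinear A \<Longrightarrow> cinner (adj A y) x = cinner y (A x)"
  by (metis cinner_adj_right cinner_commute)

lemma adj_adj: "clinear A \<Longrightarrow> adj (adj A) = A"
  by (intro adj_unique) (simp add: cinner_adj_left)

lemma norm_adj: "clinear A \<Longrightarrow> norm (adj A) = norm A"
  by (metis adj_adj clinear_adj norm_adj_le order_antisym)

lemma adj_id [simp]: "adj id_blinfun = id_blinfun"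
  by (intro adj_unique) simp

lemma adj_compose: "clinear A \<Longrightarrow> clinear B \<Longrightarrow> adj (A o\<^sub>L B) = adj B o\<^sub>L adj A"
  by (intro adj_unique) (simp add: cinner_adj_right)

subsection \<open>Square roots and defect operators\<close>

text \<open>Polarisation: the form is real on the diagonal, hence at \<open>x + y\<close> and at x +
  i y, which forces hermitian symmetry.\<close>

lemma self_adjoint_positive:
  assumes "positive_op P" shows "cinner (P x) y = cinner x (P y)"
proof -
  have P: "clinear P" and real: "Im (cinner (P x) x) = 0" for x
    using assms by (auto simp: positive_op_def complex_nonneg_Reals_iff)
  have "Im (cinner (P x) y + cinner (P y) x) = 0" for x y
    using real[of "x + y"] real[of x] real[of y]
    by (simp add: blinfun.bilinear_simps cinner_add_left cinner_add_right)
  from this[of x y] this[of x "\<i> *\<^sub>C y"] have "cinner (P x) y = cnj (cinner (P y) x)"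
    by (simp add: clinearD[OF P] cinner_scaleC_left cinner_scaleC_right complex_eq_iff)
  then show ?thesis by (simp flip: cinner_commute)
qed

text \<open>
  The majorant \<open>sqrt_maj\<close> of the iteration \<open>Y \<mapsto> (X + Y\<^sup>2) / 2\<close> for \<open>I - sqrt (I - X)\<close>
  is the same iteration for the scalar \<open>X = 1\<close>.
\<close>

primrec sqrt_it :: "('a::real_normed_vector \<Rightarrow>\<^sub>L 'a) \<Rightarrow> nat \<Rightarrow> 'a \<Rightarrow>\<^sub>L 'a" where
  "sqrt_it X 0 = 0"
| "sqrt_it X (Suc n) = (1/2) *\<^sub>R (X + (sqrt_it X n o\<^sub>L sqrt_it X n))"

primrec sqrt_maj :: "nat \<Rightarrow> real" where
  "sqrt_maj 0 = 0"
| "sqrt_maj (Suc n) = (1 + (sqrt_maj n)\<^sup>2) / 2"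

lemma sqrt_maj_bounds: "0 \<le> sqrt_maj n \<and> sqrt_maj n \<le> 1"
proof (induction n)
  case (Suc n)
  then have "(sqrt_maj n)\<^sup>2 \<le> 1" by (simp add: power_le_one)
  then show ?case by simp
qed simp

lemma sqrt_maj_mono: "sqrt_maj n \<le> sqrt_maj (Suc n)"
proof -
  have "0 \<le> (1 - sqrt_maj n)\<^sup>2" by simp
  then show ?thesis by (simp add: power2_eq_square algebra_simps)
qed

lemma commute_sqrt_it:
  assumes "S o\<^sub>L X = X o\<^sub>L S" shows "S o\<^sub>L sqrt_it X n = sqrt_it X n o\<^sub>L S"
proof (induction n)
  case (Suc n)
  have "S o\<^sub>L (sqrt_it X n o\<^sub>L sqrt_it X n) = (sqrt_it X n o\<^sub>L sqrt_it X n) o\<^sub>L S"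
    by (metis Suc compose_assoc)
  then show ?case using assms
    by (simp add: compose_add_right compose_add_left compose_scaleR_left
        compose_scaleR_right)
qed (simp add: blinfun_compose_zero)

lemma norm_sqrt_it:
  assumes "norm X \<le> 1" shows "norm (sqrt_it X n) \<le> sqrt_maj n"
proof (induction n)
  case (Suc n)
  have "norm (sqrt_it X n o\<^sub>L sqrt_it X n) \<le> (sqrt_maj n)\<^sup>2"
    using norm_blinfun_compose[of "sqrt_it X n" "sqrt_it X n"] mult_mono[OF Suc Suc] sqrt_maj_bounds[of n]
    unfolding power2_eq_square by (meson norm_ge_zero order_trans)
  then show ?case
    using assms norm_triangle_ineq[of X "sqrt_it X n o\<^sub>L sqrt_it X n"] by simp
qed simp

text \<open>Consecutive iterates \<open>Y\<close> and \<open>Z\<close> commute, so the difference of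
  their squares factors as \<open>(Z + Y) o\<^sub>L (Z - Y)\<close>, and each factor is dominated by
  its scalar counterpart.\<close>

lemma norm_sqrt_it_diff:
  assumes X: "norm X \<le> 1"
  shows "norm (sqrt_it X (Suc n) - sqrt_it X n) \<le> sqrt_maj (Suc n) - sqrt_maj n"
proof (induction n)
  case 0
  then show ?case using X by (simp add: blinfun_compose_zero)
next
  case (Suc n)
  define Y Z where "Y = sqrt_it X n" and "Z = sqrt_it X (Suc n)"
  define y z where "y = sqrt_maj n" and "z = sqrt_maj (Suc n)"
  have "Y o\<^sub>L X = X o\<^sub>L Y" unfolding Y_def by (metis commute_sqrt_it)
  then have comm: "Y o\<^sub>L Z = Z o\<^sub>L Y" unfolding Z_def by (rule commute_sqrt_it)
  have "sqrt_it X (Suc (Suc n)) - sqrt_it X (Suc n) = (1/2) *\<^sub>R ((Z o\<^sub>L Z) - (Y o\<^sub>L Y))"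
    unfolding sqrt_it.simps(2)[of X "Suc n"] Z_def[symmetric]
    by (simp add: Z_def Y_def[symmetric] scaleR_diff_right flip: scaleR_diff_right)
  also have "(Z o\<^sub>L Z) - (Y o\<^sub>L Y) = (Z + Y) o\<^sub>L (Z - Y)"
    using comm by (simp add: compose_add_left compose_diff_right)
  finally have "norm (sqrt_it X (Suc (Suc n)) - sqrt_it X (Suc n)) \<le> (1/2) * (norm (Z + Y) * norm (Z - Y))"
    using norm_blinfun_compose[of "Z + Y" "Z - Y"] by simp
  also have "norm (Z + Y) * norm (Z - Y) \<le> (z + y) * (z - y)"
  proof (rule mult_mono)
    show "norm (Z + Y) \<le> z + y"
      using norm_triangle_ineq[of Z Y] norm_sqrt_it[OF X, of n] norm_sqrt_it[OF X, of "Suc n"]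
      unfolding Y_def Z_def y_def z_def by linarith
    show "norm (Z - Y) \<le> z - y" using Suc unfolding Y_def Z_def y_def z_def .
    show "0 \<le> z + y" using sqrt_maj_bounds[of n] sqrt_maj_bounds[of "Suc n"] unfolding y_def z_def by linarith
  qed simp
  also have "(1/2) * ((z + y) * (z - y)) = sqrt_maj (Suc (Suc n)) - sqrt_maj (Suc n)"
    unfolding sqrt_maj.simps(2)[of "Suc n"] z_def[symmetric]
    by (simp add: z_def y_def power2_eq_square algebra_simps)
  finally show ?case by simp
qed

text \<open>Increments telescope against the majorant, which converges merely by being monotone and
  bounded; no rate is involved, so \<open>norm X = 1\<close> is allowed.\<close>

lemma sqrt_it_convergent:
  fixes X :: "'a::banach \<Rightarrow>\<^sub>L 'a"
  assumes X: "norm X \<le> 1"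
  shows "convergent (sqrt_it X)"
proof -
  have tele: "norm (sqrt_it X (n + k) - sqrt_it X n) \<le> sqrt_maj (n + k) - sqrt_maj n" for n k
  proof (induction k)
    case (Suc k)
    then show ?case
      using norm_sqrt_it_diff[OF X, of "n + k"]
        norm_triangle_ineq[of "sqrt_it X (Suc (n + k)) - sqrt_it X (n + k)" "sqrt_it X (n + k) - sqrt_it X n"]
      by (simp only: add_Suc_right diff_add_eq_diff_diff_swap add_diff_eq diff_add_cancel)
  qed simp
  have "incseq sqrt_maj" by (rule incseq_SucI) (rule sqrt_maj_mono)
  then have "convergent sqrt_maj"
    using incseq_convergent[of sqrt_maj 1] sqrt_maj_bounds by (metis convergentI)
  then have c: "Cauchy sqrt_maj" by (rule convergent_Cauchy)
  have "Cauchy (sqrt_it X)"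
  proof (rule metric_CauchyI)
    fix e :: real assume "e > 0"
    then obtain M where M: "\<And>m n. m \<ge> M \<Longrightarrow> n \<ge> M \<Longrightarrow> dist (sqrt_maj m) (sqrt_maj n) < e"
      using metric_CauchyD[OF c] by blast
    have le: "dist (sqrt_it X m) (sqrt_it X n) < e" if "m \<ge> n" "n \<ge> M" for m n
      using tele[of n "m - n"] M[of m n] that by (simp add: dist_norm)
    have "dist (sqrt_it X m) (sqrt_it X n) < e" if "m \<ge> M" "n \<ge> M" for m n
      using le[of n m] le[of m n] that by (metis dist_commute linear)
    then show "\<exists>M. \<forall>m\<ge>M. \<forall>n\<ge>M. dist (sqrt_it X m) (sqrt_it X n) < e" by blast
  qed
  then show ?thesis by (rule Cauchy_convergent)
qed

lemma clinear_lim: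
  assumes "\<And>n. clinear (A n)" "A \<longlonglongrightarrow> B" shows "clinear B"
  unfolding clinear_def
proof (intro allI)
  fix c x
  have lim: "(\<lambda>n. A n y) \<longlonglongrightarrow> B y" for y
    by (intro blinfun.tendsto assms tendsto_const)
  have "(\<lambda>n. c *\<^sub>C A n x) \<longlonglongrightarrow> c *\<^sub>C B x"
    by (intro bounded_linear.tendsto[OF bounded_linear_scaleC] lim)
  then have "(\<lambda>n. A n (c *\<^sub>C x)) \<longlonglongrightarrow> c *\<^sub>C B x"
    using assms(1) by (simp add: clinearD)
  then show "B (c *\<^sub>C x) = c *\<^sub>C B x" by (metis lim LIMSEQ_unique)
qed

text \<open>The limit \<open>Y\<close> of the iteration satisfies 2 Y = X + Y^2, which says that I -
  Y squares to I - X; positivity of I - Y comes from \<open>norm Y \<le> 1\<close>. The commutation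
  clause is what uniqueness of the root consumes.\<close>

lemma sqrt_exists:
  fixes X :: "'a::chilbert_space \<Rightarrow>\<^sub>L 'a"
  assumes X: "norm X \<le> 1" "clinear X" "\<And>x y. cinner (X x) y = cinner x (X y)"
  shows "\<exists>R. positive_op R \<and> R o\<^sub>L R = id_blinfun - X \<and> (\<forall>S. S o\<^sub>L X = X o\<^sub>L S \<longrightarrow> S o\<^sub>L R = R o\<^sub>L S)"
proof -
  obtain Y where Y: "sqrt_it X \<longlonglongrightarrow> Y"
    using sqrt_it_convergent[OF X(1)] convergent_def by blast
  have clin: "clinear (sqrt_it X n)" for n
  proof (induction n)
    case (Suc n)
    have "clinear (complex_of_real (1/2) *\<^sub>C (X + (sqrt_it X n o\<^sub>L sqrt_it X n)))"
      by (intro clinear_scaleC clinear_add clinear_compose Suc X)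
    then show ?case by (simp only: scaleC_of_real sqrt_it.simps)
  qed simp
  have sa: "cinner (sqrt_it X n x) y = cinner x (sqrt_it X n y)" for n x y
  proof (induction n arbitrary: x y)
    case (Suc n)
    have s: "cinner ((1/2) *\<^sub>R u) v = cinner u ((1/2) *\<^sub>R v)" for u v :: 'a
      using cinner_scaleC_left[of "complex_of_real (1/2)" u v] cinner_scaleC_right[of u "complex_of_real (1/2)" v]
      unfolding scaleC_of_real complex_cnj_complex_of_real by (rule trans[OF _ sym])
    show ?case
      by (simp add: blinfun.bilinear_simps s cinner_add_left X(3) Suc scaleR_add_right flip: cinner_add_right)
  qed simp
  have Yc: "clinear Y" by (rule clinear_lim[OF clin Y])
  have limY: "(\<lambda>n. sqrt_it X n x) \<longlonglongrightarrow> Y x" for x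
    by (intro blinfun.tendsto Y tendsto_const)
  have Ysa: "cinner (Y x) y = cinner x (Y y)" for x y
    using LIMSEQ_unique[OF tendsto_cinner_left[OF limY[of x], of y]]
      tendsto_cinner_right[OF limY[of y], of x] sa by simp
  have Yn: "norm Y \<le> 1"
    by (rule LIMSEQ_le_const2[OF tendsto_norm[OF Y]])
      (use norm_sqrt_it[OF X(1)] sqrt_maj_bounds order_trans in blast)
  have Yeq: "Y = (1/2) *\<^sub>R (X + (Y o\<^sub>L Y))"
  proof (rule LIMSEQ_unique)
    show "(\<lambda>n. sqrt_it X (Suc n)) \<longlonglongrightarrow> Y" by (rule LIMSEQ_Suc[OF Y])
    show "(\<lambda>n. sqrt_it X (Suc n)) \<longlonglongrightarrow> (1/2) *\<^sub>R (X + (Y o\<^sub>L Y))"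
      unfolding sqrt_it.simps by (intro tendsto_intros compose_tendsto Y)
  qed
  let ?R = "id_blinfun - Y"
  have "positive_op ?R"
    unfolding positive_op_def
  proof (intro conjI allI clinear_diff clinear_id Yc)
    fix x
    have "Im (cinner (Y x) x) = 0"
      using arg_cong[OF cinner_commute[of x "Y x"], of Im] Ysa[of x x] by simp
    moreover have "Re (cinner (Y x) x) \<le> (norm x)\<^sup>2"
    proof -
      have "norm (Y x) \<le> norm x"
        using norm_blinfun[of Y x] mult_right_mono[OF Yn norm_ge_zero[of x]] by simp
      then have "norm (Y x) * norm x \<le> (norm x)\<^sup>2"
        by (simp add: power2_eq_square mult_right_mono)
      then show ?thesis
        using complex_Re_le_cmod[of "cinner (Y x) x"] cinner_Cauchy_Schwarz[of "Y x" x] by linarith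
    qed
    ultimately show "cinner (?R x) x \<in> \<real>\<^sub>\<ge>\<^sub>0"
      by (simp add: blinfun.bilinear_simps cinner_diff_left cinner_self complex_nonneg_Reals_iff
          del: of_real_power)
  qed
  moreover have "?R o\<^sub>L ?R = id_blinfun - X"
  proof -
    have "2 *\<^sub>R Y = X + (Y o\<^sub>L Y)"
      using arg_cong[OF Yeq, of "\<lambda>Z. 2 *\<^sub>R Z"] by simp
    then have "Y + Y = X + (Y o\<^sub>L Y)" by (simp add: scaleR_2)
    then have "(Y + Y) x = (X + (Y o\<^sub>L Y)) x" for x by simp
    then show ?thesis
      by (intro blinfun_eqI) (simp add: blinfun.bilinear_simps algebra_simps)
  qed
  moreover have "S o\<^sub>L ?R = ?R o\<^sub>L S" if "S o\<^sub>L X = X o\<^sub>L S" for S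
  proof -
    have "S o\<^sub>L Y = Y o\<^sub>L S"
    proof (rule LIMSEQ_unique)
      show "(\<lambda>n. (S o\<^sub>L sqrt_it X n)) \<longlonglongrightarrow> (S o\<^sub>L Y)" by (intro compose_tendsto tendsto_const Y)
      show "(\<lambda>n. (S o\<^sub>L sqrt_it X n)) \<longlonglongrightarrow> (Y o\<^sub>L S)"
        unfolding commute_sqrt_it[OF that] by (intro compose_tendsto tendsto_const Y)
    qed
    then have "S (Y x) = Y (S x)" for x by (metis blinfun_apply_blinfun_compose)
    then show ?thesis by (intro blinfun_eqI) (simp add: blinfun.bilinear_simps)
  qed
  ultimately show ?thesis by blast
qed

text \<open>With T = R - S, commutation and equal squares give (R + S) T = 0. The two nonnegative
  forms of R and S at T x then sum to zero, so both vanish, and so does the form of T at T x.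
  Polarisation yields T (T x) = 0, hence T x = 0 by self-adjointness.\<close>

lemma positive_sqrt_unique:
  assumes R: "positive_op R" and S: "positive_op S" and sq: "S o\<^sub>L S = R o\<^sub>L R"
    and comm: "S o\<^sub>L R = R o\<^sub>L S"
  shows "S = R"
proof -
  define T where "T = R - S"
  have sq': "S (S x) = R (R x)" and comm': "S (R x) = R (S x)" for x
    using arg_cong[OF sq, of "\<lambda>Z. Z x"] arg_cong[OF comm, of "\<lambda>Z. Z x"] by auto
  have T_sa: "cinner (T x) y = cinner x (T y)" for x y
    unfolding T_def
    by (simp add: blinfun.bilinear_simps cinner_diff_left cinner_diff_right
        self_adjoint_positive[OF R] self_adjoint_positive[OF S])
  have zero: "R (T x) + S (T x) = 0" for x
    by (simp add: T_def blinfun.bilinear_simps sq' comm')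
  have "Re (cinner (R (T x)) (T x)) = 0 \<and> Re (cinner (S (T x)) (T x)) = 0" for x
  proof -
    have "Re (cinner (R (T x)) (T x)) + Re (cinner (S (T x)) (T x)) = Re (cinner (R (T x) + S (T x)) (T x))"
      by (simp add: cinner_add_left)
    also have "\<dots> = 0" by (simp add: zero)
    finally show ?thesis
      using R S by (auto simp: positive_op_def complex_nonneg_Reals_iff add_nonneg_eq_0_iff)
  qed
  note RS = this
  have "Re (cinner (T (T x)) (T x)) = 0" for x
  proof -
    have "T (T x) = R (T x) - S (T x)"
      by (subst (1) T_def) (simp add: blinfun.bilinear_simps)
    then show ?thesis by (simp add: cinner_diff_left RS)
  qed
  then have q: "cinner (T (T x)) (T x) = 0" for x
    using arg_cong[OF cinner_commute[of "T (T x)" "T x"], of Im] T_sa[of "T x" "T x"]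
    by (simp add: complex_eq_iff)
  have Tc: "clinear T" unfolding T_def using R S by (auto simp: positive_op_def)
  have "cinner (T (T x)) (T y) = 0" for x y
  proof -
    have *: "cinner (T (T x)) (T y) + cinner (T (T y)) (T x) = 0" for x y
      using q[of "x + y"] q[of x] q[of y]
      by (simp add: blinfun.bilinear_simps cinner_add_left cinner_add_right add.commute)
    from *[of x y] *[of x "\<i> *\<^sub>C y"] show ?thesis
      by (simp add: clinearD[OF Tc] cinner_scaleC_left cinner_scaleC_right complex_eq_iff)
  qed
  from this[of _ "T _"] have "T (T x) = 0" for x
    by (metis cinner_self norm_eq_zero of_real_eq_0_iff power_eq_0_iff zero_neq_numeral)
  then have "cinner (T x) (T x) = 0" for x by (simp add: T_sa)
  then have "T x = 0" for x
    by (metis cinner_self norm_eq_zero of_real_eq_0_iff power_eq_0_iff zero_neq_numeral)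
  then show ?thesis by (intro blinfun_eqI) (simp add: T_def blinfun.bilinear_simps)
qed

lemma norm_blinfun_le: "norm A \<le> 1 \<Longrightarrow> norm (A x) \<le> norm x"
  for A :: "'a::real_normed_vector \<Rightarrow>\<^sub>L 'b::real_normed_vector"
  using norm_blinfun[of A x] mult_right_mono[of "norm A" 1 "norm x"] by simp

text \<open>This makes the definite description in \<open>sqrt_op\<close> meaningful: any other
  positive root commutes with its own square, hence with \<open>adj C o\<^sub>L C\<close>, hence
  with the root built by iteration, and commuting positive roots agree.\<close>

lemma
  fixes C :: "'a::chilbert_space \<Rightarrow>\<^sub>L 'b::chilbert_space"
  assumes C: "clinear C" "norm C \<le> 1"
  shows positive_defect_op: "positive_op (defect_op C)"
    and defect_op_sq: "defect_op C o\<^sub>L defect_op C = id_blinfun - (adj C o\<^sub>L C)"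
proof -
  let ?X = "adj C o\<^sub>L C"
  have X: "norm ?X \<le> 1"
  proof -
    have "norm (adj C) * norm C \<le> 1 * 1"
      using C by (intro mult_mono) (auto simp: norm_adj)
    then show ?thesis using norm_blinfun_compose[of "adj C" C] by simp
  qed
  have "cinner (?X x) y = cinner x (?X y)" for x y
    by (simp add: cinner_adj_left cinner_adj_right C)
  then obtain R where R: "positive_op R" "R o\<^sub>L R = id_blinfun - ?X"
    "\<And>S. S o\<^sub>L ?X = ?X o\<^sub>L S \<Longrightarrow> S o\<^sub>L R = R o\<^sub>L S"
    using sqrt_exists[OF X] C clinear_adj by blast
  have eq: "defect_op C = R"
    unfolding defect_op_def sqrt_op_def
  proof (rule the_equality)
    fix S assume S: "positive_op S \<and> S o\<^sub>L S = id_blinfun - ?X"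
    have "S o\<^sub>L (id_blinfun - ?X) = (id_blinfun - ?X) o\<^sub>L S"
      using S by (metis compose_assoc)
    then have "(S o\<^sub>L (id_blinfun - ?X)) x = ((id_blinfun - ?X) o\<^sub>L S) x" for x by simp
    then have comm: "S o\<^sub>L ?X = ?X o\<^sub>L S"
      by (intro blinfun_eqI) (simp add: blinfun.bilinear_simps)
    show "S = R"
      by (rule positive_sqrt_unique[OF R(1) conjunct1[OF S] _ R(3)[OF comm]])
        (simp only: R(2) conjunct2[OF S])
  qed (intro conjI R)
  show "positive_op (defect_op C)" "defect_op C o\<^sub>L defect_op C = id_blinfun - ?X"
    unfolding eq by (rule R)+
qed

text \<open>The semi-norm of \<open>defect_op A x\<close> for a contraction, written without the
  operator square root so that norm identities apply to it directly.\<close>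

definition defect_norm :: "('a::real_normed_vector \<Rightarrow>\<^sub>L 'b::real_normed_vector) \<Rightarrow> 'a \<Rightarrow> real"
  where "defect_norm A x = sqrt ((norm x)\<^sup>2 - (norm (A x))\<^sup>2)"

lemma defect_norm_nonneg: "norm A \<le> 1 \<Longrightarrow> 0 \<le> defect_norm A x"
  unfolding defect_norm_def by (simp add: norm_blinfun_le power_mono)

lemma defect_norm_sq: "norm A \<le> 1 \<Longrightarrow> (defect_norm A x)\<^sup>2 = (norm x)\<^sup>2 - (norm (A x))\<^sup>2"
  unfolding defect_norm_def by (intro real_sqrt_pow2) (simp add: norm_blinfun_le power_mono)

lemma defect_norm_le: "norm A \<le> 1 \<Longrightarrow> defect_norm A x \<le> norm x"
  by (rule power2_le_imp_le) (simp_all add: defect_norm_sq)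

lemma norm_defect_op:
  assumes C: "clinear C" "norm C \<le> 1"
  shows "norm (defect_op C x) = defect_norm C x"
proof -
  have "cinner (defect_op C x) (defect_op C x) = cinner ((defect_op C o\<^sub>L defect_op C) x) x"
    by (simp add: self_adjoint_positive[OF positive_defect_op[OF C]])
  also have "\<dots> = cinner x x - cinner (C x) (C x)"
    by (simp add: defect_op_sq[OF C] blinfun.bilinear_simps cinner_diff_left cinner_adj_left C)
  finally have "(norm (defect_op C x))\<^sup>2 = (norm x)\<^sup>2 - (norm (C x))\<^sup>2"
    unfolding cinner_self of_real_diff[symmetric] of_real_eq_iff .
  then show ?thesis unfolding defect_norm_def by (metis norm_ge_zero real_sqrt_unique)
qed

text \<open>For the converse \<open>form_rep\<close> is used twice. Over the range of
  \<open>defect_op B\<close> it gives \<open>W\<close> with \<open>W y\<close> bounded by the defect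
  of the adjoint at \<open>y\<close>; over the range of \<open>defect_op (adj B)\<close> it then
  factors \<open>W\<close>, and the resulting \<open>R\<close> takes values in the required defect
  space.\<close>

lemma op_prec_iff:
  fixes A B :: "'a::chilbert_space \<Rightarrow>\<^sub>L 'b::chilbert_space"
  assumes A: "clinear A" and B: "clinear B" "norm B \<le> 1"
  shows "A \<prec> B \<longleftrightarrow>
    (\<exists>c\<ge>0. \<forall>x y. cmod (cinner ((A - B) x) y) \<le> c * defect_norm B x * defect_norm (adj B) y)"
proof
  have B': "clinear (adj B)" "norm (adj B) \<le> 1" using B by (auto simp: clinear_adj norm_adj)
  note pos = positive_defect_op[OF B'] positive_defect_op[OF B]
  have cl: "clinear (defect_op (adj B))" "clinear (defect_op B)"
    using pos by (auto simp: positive_op_def)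
  {
    assume "A \<prec> B"
    then obtain X where X: "bounded_operator_between (defect_space B) (defect_space (adj B)) X"
      "\<And>x. (A - B) x = defect_op (adj B) (X (defect_op B x))" unfolding op_prec_def by blast
    then have "\<exists>M. \<forall>x\<in>defect_space B. norm (X x) \<le> M * norm x"
      unfolding bounded_operator_between_def by (elim conjE)
    then obtain M where M: "\<And>x. x \<in> defect_space B \<Longrightarrow> norm (X x) \<le> M * norm x"
      by auto
    \<comment> \<open>The bound \<open>M\<close> from the definition may be negative, when the
      defect space is zero; its absolute value serves as constant.\<close>
    have "cmod (cinner ((A - B) x) y) \<le> \<bar>M\<bar> * defect_norm B x * defect_norm (adj B) y" for x y
    proof -
      have "defect_op B x \<in> defect_space B"
        unfolding defect_space_def by (rule subsetD[OF closure_subset]) simp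
      then have "norm (X (defect_op B x)) \<le> \<bar>M\<bar> * norm (defect_op B x)"
        by (meson M abs_ge_self mult_right_mono norm_ge_zero order_trans)
      then have "norm (X (defect_op B x)) * norm (defect_op (adj B) y)
          \<le> \<bar>M\<bar> * norm (defect_op B x) * norm (defect_op (adj B) y)"
        by (rule mult_right_mono) simp
      then show ?thesis
        using cinner_Cauchy_Schwarz[of "X (defect_op B x)" "defect_op (adj B) y"]
        by (simp add: X(2) self_adjoint_positive[OF pos(1)] norm_defect_op B B')
    qed
    then show "\<exists>c\<ge>0. \<forall>x y. cmod (cinner ((A - B) x) y) \<le> c * defect_norm B x * defect_norm (adj B) y"
      by (intro exI[of _ "\<bar>M\<bar>"]) simp
  }
  {
    assume "\<exists>c\<ge>0. \<forall>x y. cmod (cinner ((A - B) x) y) \<le> c * defect_norm B x * defect_norm (adj B) y"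
    then obtain c where c: "c \<ge> 0"
      "\<And>x y. cmod (cinner ((A - B) x) y) \<le> c * defect_norm B x * defect_norm (adj B) y" by blast
    let ?D = "defect_op B" and ?E = "defect_op (adj B)"
    have T: "clinear (A - B)" using A B by auto
    obtain W :: "'b \<Rightarrow>\<^sub>L 'a" where W: "clinear W"
      "\<And>x y. cinner ((A - B) x) y = cinner (?D x) (W y)" "\<And>y. norm (W y) \<le> c * norm (?E y)"
    proof (rule form_rep[where D = ?D and b = "\<lambda>x y. cinner ((A - B) x) y"
          and N = "\<lambda>y. c * norm (?E y)" and M = c])
      show "cmod (cinner ((A - B) x) y) \<le> c * norm (?E y) * norm (?D x)" for x y
        using c(2)[of x y] by (simp add: norm_defect_op B B' ac_simps)
      show "c * norm (?E y) \<le> c * norm y" for y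
        using c(1) by (intro mult_left_mono) (simp_all add: norm_defect_op B' defect_norm_le)
    qed (use c in \<open>simp_all add: cl cinner_add_left cinner_add_right
        cinner_scaleC_left cinner_scaleC_right blinfun.add_right clinearD[OF T]\<close>)
    obtain R :: "'a \<Rightarrow>\<^sub>L 'b" where R: "clinear R" "\<And>x. R x \<in> closure (range ?E)"
      "\<And>y x. cinner (W y) x = cinner (?E y) (R x)"
    proof (rule form_rep[where D = ?E and b = "\<lambda>y x. cinner (W y) x"
          and N = "\<lambda>x. c * norm x" and M = c])
      show "cmod (cinner (W y) x) \<le> c * norm x * norm (?E y)" for y x
        using cinner_Cauchy_Schwarz[of "W y" x] mult_right_mono[OF W(3)[of y], of "norm x"]
        by (simp add: ac_simps)
    qed (use c in \<open>simp_all add: cl cinner_add_left cinner_add_right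
        cinner_scaleC_left cinner_scaleC_right blinfun.add_right clinearD[OF W(1)]\<close>)
    have "(A - B) x = ?E (R (?D x))" for x
    proof (rule cinner_eqI)
      fix y
      have "cinner ((A - B) x) y = cnj (cinner (W y) (?D x))"
        by (simp add: W(2) flip: cinner_commute)
      also have "\<dots> = cinner (R (?D x)) (?E y)" by (simp add: R(3) flip: cinner_commute)
      finally show "cinner ((A - B) x) y = cinner (?E (R (?D x))) y"
        by (simp add: self_adjoint_positive[OF pos(1)])
    qed
    moreover have "bounded_operator_between (defect_space B) (defect_space (adj B)) R"
      unfolding bounded_operator_between_def
    proof (intro conjI)
      show "\<exists>M. \<forall>x\<in>defect_space B. norm (R x) \<le> M * norm x"
        by (intro exI[of _ "norm R"] ballI norm_blinfun)
    qed (use R in \<open>auto simp: defect_space_def clinearD blinfun.add_right\<close>)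
    ultimately show "A \<prec> B" unfolding op_prec_def by (intro exI[of _ "blinfun_apply R"] conjI allI)
  }
qed

subsection \<open>The preorder in terms of forms\<close>

definition form_prec ::
    "('a::chilbert_space \<Rightarrow>\<^sub>L 'b::chilbert_space) \<Rightarrow> ('a \<Rightarrow>\<^sub>L 'b) \<Rightarrow> bool"
  where "form_prec A B \<longleftrightarrow>
    (\<exists>c\<ge>0. \<forall>x y. cmod (cinner ((A - B) x) y) \<le> c * defect_norm B x * defect_norm (adj B) y)"

lemma form_prec_adj:
  assumes A: "clinear A" and B: "clinear B" and "form_prec A B"
  shows "form_prec (adj A) (adj B)"
proof -
  obtain c where c: "c \<ge> 0"
    "\<And>x y. cmod (cinner ((A - B) x) y) \<le> c * defect_norm B x * defect_norm (adj B) y"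
    using assms(3) unfolding form_prec_def by auto
  have "cmod (cinner ((adj A - adj B) y) x) \<le> c * defect_norm (adj B) y * defect_norm B x" for x y
  proof -
    have "cinner ((adj A - adj B) y) x = cinner y ((A - B) x)"
      by (simp add: blinfun.diff_left cinner_diff_left cinner_diff_right cinner_adj_left A B)
    also have "cmod \<dots> = cmod (cinner ((A - B) x) y)"
      by (subst cinner_commute) simp
    finally show ?thesis using c(2)[of x y] by (simp add: ac_simps)
  qed
  then show ?thesis unfolding form_prec_def adj_adj[OF B] using c(1) by auto
qed

text \<open>The squares of the two sides differ by exactly the squared norm of
  \<open>x - adj A (A x)\<close>. This is the norm form of the intertwining of the two defect
  operators by \<open>A\<close>.\<close>

lemma defect_norm_adj_apply_le:
  assumes A: "clinear A" "norm A \<le> 1"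
  shows "defect_norm (adj A) (A x) \<le> defect_norm A x"
proof -
  have "(norm (x - adj A (A x)))\<^sup>2 = (norm x)\<^sup>2 - 2 * (norm (A x))\<^sup>2 + (norm (adj A (A x)))\<^sup>2"
    by (simp add: norm_sq_diff cinner_adj_right[OF A(1)] cinner_self del: of_real_power)
  then have "(norm (A x))\<^sup>2 - (norm (adj A (A x)))\<^sup>2 \<le> (norm x)\<^sup>2 - (norm (A x))\<^sup>2"
    using zero_le_power2[of "norm (x - adj A (A x))"] by linarith
  then show ?thesis unfolding defect_norm_def by simp
qed

text \<open>Expanding the squared norm of B x = A x + (B - A) x, the square of the second term has
  the favourable sign and is dropped. The cross term is the form tested with \<open>y = A x\<close>,
  whose adjoint defect is at most the defect of \<open>x\<close>; it contributes the summand 2 c of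
  the constant.\<close>

lemma form_prec_defect_norm_le:
  fixes A B :: "'a::chilbert_space \<Rightarrow>\<^sub>L 'b::chilbert_space"
  assumes A: "clinear A" "norm A \<le> 1" and B: "clinear B" "norm B \<le> 1" and "form_prec B A"
  shows "\<exists>C\<ge>0. \<forall>x. defect_norm B x \<le> C * defect_norm A x"
proof -
  obtain c where c: "c \<ge> 0"
    "\<And>x y. cmod (cinner ((B - A) x) y) \<le> c * defect_norm A x * defect_norm (adj A) y"
    using assms(5) unfolding form_prec_def by auto
  have "defect_norm B x \<le> sqrt (1 + 2 * c) * defect_norm A x" for x
  proof (rule power2_le_imp_le)
    note nn = defect_norm_nonneg[OF A(2), of x]
    have "cmod (cinner ((B - A) x) (A x)) \<le> c * defect_norm A x * defect_norm A x"
      using c(2)[of x "A x"] mult_left_mono[OF defect_norm_adj_apply_le[OF A, of x], of "c * defect_norm A x"]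
        c(1) nn by simp
    then have "- Re (cinner (A x) ((B - A) x)) \<le> c * (defect_norm A x)\<^sup>2"
      using abs_Re_le_cmod[of "cinner ((B - A) x) (A x)"] arg_cong[OF cinner_commute[of "A x" "(B - A) x"], of Re]
      by (simp add: power2_eq_square)
    moreover have "(norm (B x))\<^sup>2 = (norm (A x))\<^sup>2 + 2 * Re (cinner (A x) ((B - A) x)) + (norm ((B - A) x))\<^sup>2"
      using norm_sq_add[of "A x" "(B - A) x"] by (simp add: blinfun.diff_left)
    ultimately have "(defect_norm B x)\<^sup>2 \<le> (defect_norm A x)\<^sup>2 + 2 * (c * (defect_norm A x)\<^sup>2)"
      using zero_le_power2[of "norm ((B - A) x)"] unfolding defect_norm_sq[OF A(2)] defect_norm_sq[OF B(2)]
      by linarith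
    then show "(defect_norm B x)\<^sup>2 \<le> (sqrt (1 + 2 * c) * defect_norm A x)\<^sup>2"
      using c(1) by (simp add: power_mult_distrib algebra_simps)
    show "0 \<le> sqrt (1 + 2 * c) * defect_norm A x" using c(1) nn by simp
  qed
  then show ?thesis using c(1) by (intro exI[of _ "sqrt (1 + 2 * c)"]) simp
qed

section \<open>Resolvents, and Redheffer images under an abstract isometric colligation\<close>

lemma inverse_id_minus:
  fixes T :: "'a::{real_normed_vector, complete_space} \<Rightarrow>\<^sub>L 'a"
  assumes T: "norm T \<le> \<rho>" "\<rho> < 1"
  obtains S where "S o\<^sub>L (id_blinfun - T) = id_blinfun" "(id_blinfun - T) o\<^sub>L S = id_blinfun"
proof -
  \<comment> \<open>This estimate gives both uniqueness of the solution, from which linearity of the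
    inverse follows, and the norm bound of the inverse.\<close>
  have lower: "(1 - \<rho>) * norm x \<le> norm (x - T x)" for x
  proof -
    have "norm (T x) \<le> \<rho> * norm x"
      using norm_blinfun[of T x] mult_right_mono[OF T(1) norm_ge_zero[of x]] by simp
    then show ?thesis using norm_triangle_ineq2[of x "T x"] by (simp add: left_diff_distrib)
  qed
  \<comment> \<open>The solution is the fixed point of the contraction sending u to y + T u.\<close>
  have "\<exists>x. x - T x = y" for y
  proof -
    have "dist (y + T u) (y + T v) \<le> \<rho> * dist u v" for u v
      using norm_blinfun[of T "u - v"] mult_right_mono[OF T(1) norm_ge_zero[of "u - v"]]
      by (simp add: dist_norm blinfun.diff_right)
    moreover have "0 \<le> \<rho>" using T(1) norm_ge_zero order_trans by blast
    ultimately have "\<exists>!x\<in>UNIV. y + T x = x"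
      using T(2) by (intro Banach_fix[of UNIV \<rho>]) (auto simp: complete_UNIV)
    then obtain x where "y + T x = x" by blast
    then show ?thesis by (metis add_diff_cancel_right')
  qed
  then obtain S where S: "\<And>y. S y - T (S y) = y" by metis
  have uniq: "u = v" if "u - T u = v - T v" for u v
  proof -
    have "(u - v) - T (u - v) = 0" using that by (simp add: blinfun.diff_right algebra_simps)
    then have "(1 - \<rho>) * norm (u - v) \<le> 0" using lower[of "u - v"] by simp
    then show ?thesis using T(2) by (simp add: mult_le_0_iff)
  qed
  have lin: "bounded_linear S"
  proof (rule bounded_linear_intro[where K = "1 / (1 - \<rho>)"])
    show "S (x + y) = S x + S y" for x y
      by (rule uniq) (simp add: blinfun.add_right S add_diff_add)
    show "S (r *\<^sub>R x) = r *\<^sub>R S x" for r x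
      by (rule uniq) (simp add: blinfun.scaleR_right S flip: scaleR_diff_right)
    show "norm (S x) \<le> norm x * (1 / (1 - \<rho>))" for x
      using lower[of "S x"] T(2) by (simp add: S pos_le_divide_eq mult.commute)
  qed
  show thesis
  proof (rule that[of "Blinfun S"]; rule blinfun_eqI)
    show "((id_blinfun - T) o\<^sub>L Blinfun S) x = id_blinfun x" for x
      by (simp add: blinfun.diff_left bounded_linear_Blinfun_apply[OF lin] S)
    show "(Blinfun S o\<^sub>L (id_blinfun - T)) x = id_blinfun x" for x
      using uniq[OF S[of "x - T x"]] by (simp add: blinfun.diff_left bounded_linear_Blinfun_apply[OF lin])
  qed
qed

lemma inv_op_eqI: "B o\<^sub>L A = id_blinfun \<Longrightarrow> A o\<^sub>L B = id_blinfun \<Longrightarrow> inv_op A = B"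
  for A :: "'a::complex_normed_vector \<Rightarrow>\<^sub>L 'b::complex_normed_vector"
  unfolding inv_op_def
proof (rule the_equality)
  fix B' :: "'b \<Rightarrow>\<^sub>L 'a"
  assume B: "A o\<^sub>L B = id_blinfun" and B': "B' o\<^sub>L A = id_blinfun \<and> A o\<^sub>L B' = id_blinfun"
  have "B' (A x) = x" "A (B y) = y" for x y
    using arg_cong[OF conjunct1[OF B'], of "\<lambda>Z. Z x"] arg_cong[OF B, of "\<lambda>Z. Z y"] by simp_all
  then show "B' = B" by (intro blinfun_eqI) metis
qed simp

text \<open>
  \<open>RA\<close> is the Redheffer image of \<open>A\<close> under the isometry \<open>M = [M11, M12; M21, M22]\<close>. Since
  \<open>M (A x, u) = (x, RA u)\<close> for \<open>x = M11 A x + M12 u\<close> and \<open>M (w, v) = (A\<^sup>* w, y)\<close> for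
  \<open>A\<^sup>* w = M11 w + M12 v\<close>, everything follows from the preservation of inner products by \<open>M\<close>;
  \<open>u\<close>, \<open>v\<close>, \<open>y\<close> are \<open>feed A x\<close>, \<open>cofeed A w\<close>, \<open>response A w\<close>.
\<close>

locale isometric_colligation =
  fixes M11 :: "'p::chilbert_space \<Rightarrow>\<^sub>L 'q::chilbert_space" and M12 :: "'u::chilbert_space \<Rightarrow>\<^sub>L 'q"
    and M21 :: "'p \<Rightarrow>\<^sub>L 'y::chilbert_space" and M22 :: "'u \<Rightarrow>\<^sub>L 'y"
    and N :: "'q \<Rightarrow>\<^sub>L 'u" and \<rho> :: real
  assumes isometry: "(norm (M11 w + M12 v))\<^sup>2 + (norm (M21 w + M22 v))\<^sup>2 = (norm w)\<^sup>2 + (norm v)\<^sup>2"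
    and clinear_M: "clinear M11" "clinear M12" "clinear M21" "clinear M22"
    and norm_M11: "norm M11 \<le> \<rho>" "\<rho> < 1"
    and inverse_M12: "M12 (N x) = x" "N (M12 v) = v"
begin

text \<open>Polarisation on the direct sums: equal norms give equal real parts, and multiplying the
  first pair by i gives the imaginary parts.\<close>

lemma cinner_preserved:
  "cinner (M11 w + M12 v) (M11 w' + M12 v') + cinner (M21 w + M22 v) (M21 w' + M22 v')
    = cinner w w' + cinner v v'"
proof -
  define P where "P w v = (M11 w + M12 v, M21 w + M22 v)" for w v
  have P_add: "P w v + P w' v' = P (w + w') (v + v')" for w v w' v'
    by (simp add: P_def blinfun.add_right)
  have P_scale: "c *\<^sub>C P w v = P (c *\<^sub>C w) (c *\<^sub>C v)" for c w v
    by (simp add: P_def scaleC_prod_def clinear_M[THEN clinearD] scaleC_add_right)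
  have P_norm: "(norm (P w v))\<^sup>2 = (norm (w, v))\<^sup>2" for w v
    using isometry by (simp add: P_def norm_prod_def)
  have re: "Re (cinner (P w v) (P w' v')) = Re (cinner (w, v) (w', v'))" for w v w' v'
    using norm_sq_add[of "P w v" "P w' v'"] norm_sq_add[of "(w, v)" "(w', v')"]
    by (simp add: P_add P_norm)
  have "cinner (P w v) (P w' v') = cinner (w, v) (w', v')" for w v w' v'
    using re[of w v w' v'] re[of "\<i> *\<^sub>C w" "\<i> *\<^sub>C v" w' v'] P_scale[of \<i> w v]
      cinner_scaleC_left[of \<i> "(w, v)" "(w', v')"] cinner_scaleC_left[of \<i> "P w v" "P w' v'"]
    by (simp add: scaleC_prod_def complex_eq_iff)
  from this[of w v w' v'] show ?thesis by (simp add: P_def cinner_prod_def)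
qed

text \<open>A relation instead of a resolvent formula: the state equation is all that the argument
  uses, and by \<open>feed_surj\<close> it determines \<open>RA\<close> from
  \<open>A\<close>.\<close>

definition is_image :: "('q \<Rightarrow>\<^sub>L 'p) \<Rightarrow> ('u \<Rightarrow>\<^sub>L 'y) \<Rightarrow> bool"
  where "is_image A RA \<longleftrightarrow> clinear A \<and> norm A \<le> 1 \<and> clinear RA \<and> norm RA \<le> 1 \<and>
    (\<forall>u x. x = M11 (A x) + M12 u \<longrightarrow> RA u = M21 (A x) + M22 u)"

text \<open>Reads the state equation backwards: the state \<open>x\<close> is free, and the input
  producing it is computed from it. This is where the inverse of \<open>M12\<close> enters.\<close>

definition feed :: "('q \<Rightarrow>\<^sub>L 'p) \<Rightarrow> 'q \<Rightarrow> 'u"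
  where "feed A x = N (x - M11 (A x))"

lemma feed_eq: "M11 (A x) + M12 (feed A x) = x" for A :: "'q \<Rightarrow>\<^sub>L 'p"
  by (simp add: feed_def inverse_M12)

text \<open>The second clause is an a posteriori estimate: the residual of any trial state
  \<open>z\<close> controls its distance to the true state for the input \<open>u\<close>. It is
  what later compares the states of two operators driven by one input.\<close>

lemma feed_surj:
  fixes A :: "'q \<Rightarrow>\<^sub>L 'p"
  assumes "norm A \<le> 1"
  obtains x where "feed A x = u" "\<And>z. (1 - \<rho>) * norm (x - z) \<le> norm (M12 u - (z - M11 (A z)))"
proof -
  have \<rho>: "0 \<le> \<rho>" using norm_M11(1) norm_ge_zero order_trans by blast
  have le: "norm (M11 o\<^sub>L A) \<le> \<rho>"
    using norm_blinfun_compose[of M11 A] mult_mono[OF norm_M11(1) assms] \<rho> by simp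
  obtain S where S: "(id_blinfun - (M11 o\<^sub>L A)) o\<^sub>L S = id_blinfun"
    using inverse_id_minus[OF le norm_M11(2)] by metis
  define x where "x = S (M12 u)"
  have x: "x - M11 (A x) = M12 u"
    using arg_cong[OF S, of "\<lambda>Z. Z (M12 u)"] by (simp add: x_def blinfun.diff_left)
  show thesis
  proof (rule that[of x])
    show "feed A x = u" by (simp add: feed_def x inverse_M12)
    fix z
    have "norm ((M11 o\<^sub>L A) (x - z)) \<le> \<rho> * norm (x - z)"
      using norm_blinfun[of "M11 o\<^sub>L A" "x - z"] mult_right_mono[OF le norm_ge_zero[of "x - z"]] by simp
    moreover have eq: "M12 u - (z - M11 (A z)) = (x - z) - (M11 o\<^sub>L A) (x - z)"
      unfolding x[symmetric] by (simp add: blinfun.diff_right)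
    ultimately show "(1 - \<rho>) * norm (x - z) \<le> norm (M12 u - (z - M11 (A z)))"
      using norm_triangle_ineq2[of "x - z" "(M11 o\<^sub>L A) (x - z)"]
      unfolding eq left_diff_distrib mult_1 by linarith
  qed
qed

lemma image_feed: "is_image A RA \<Longrightarrow> RA (feed A x) = M21 (A x) + M22 (feed A x)"
  unfolding is_image_def using feed_eq[of A x] by metis

lemma defect_norm_image:
  assumes "is_image A RA" shows "defect_norm RA (feed A x) = defect_norm A x"
  using isometry[of "A x" "feed A x"]
  by (simp add: defect_norm_def feed_eq image_feed[OF assms] algebra_simps)

definition cofeed :: "('q \<Rightarrow>\<^sub>L 'p) \<Rightarrow> 'p \<Rightarrow> 'u"
  where "cofeed A w = N (adj A w - M11 w)"

definition response :: "('q \<Rightarrow>\<^sub>L 'p) \<Rightarrow> 'p \<Rightarrow> 'y"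
  where "response A w = M21 w + M22 (cofeed A w)"

lemma cofeed_eq: "M11 w + M12 (cofeed A w) = adj A w" for A :: "'q \<Rightarrow>\<^sub>L 'p"
  by (simp add: cofeed_def inverse_M12)

text \<open>Preservation of inner products for \<open>(B x, feed B x)\<close> and
  \<open>(w, cofeed A w)\<close>, whose images under the colligation have first components
  \<open>x\<close> and \<open>adj A w\<close>. The two operators are kept distinct on purpose: equal
  ones identify the adjoint of an image, distinct ones yield the difference formula.\<close>

lemma cinner_image_response:
  assumes B: "is_image B RB" and A: "clinear A"
  shows "cinner (RB (feed B x)) (response A w)
    = cinner (B x) w + cinner (feed B x) (cofeed A w) - cinner (A x) w"
  using cinner_preserved[of "B x" "feed B x" w "cofeed A w"]
  by (simp add: feed_eq cofeed_eq image_feed[OF B] flip: response_def)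
    (simp add: cinner_adj_right[OF A] algebra_simps)

text \<open>For \<open>B = A\<close> the outer terms of \<open>cinner_image_response\<close> cancel,
  and inputs of the form \<open>feed A x\<close> exhaust the space.\<close>

lemma adj_image_response:
  assumes A: "is_image A RA" shows "adj RA (response A w) = cofeed A w"
proof -
  have cl: "clinear A" "norm A \<le> 1" "clinear RA" using A unfolding is_image_def by auto
  have "cinner (cofeed A w) u = cinner (adj RA (response A w)) u" for u
  proof -
    obtain x where x: "feed A x = u" using feed_surj[OF cl(2)] by metis
    have "cinner u (adj RA (response A w)) = cinner u (cofeed A w)"
      using cinner_image_response[OF A cl(1), of x w] by (simp add: x cinner_adj_right[OF cl(3)])
    then show ?thesis by (metis cinner_commute)
  qed
  then show ?thesis by (intro cinner_eqI) simp
qed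

lemma defect_norm_adj_image:
  assumes A: "is_image A RA" shows "defect_norm (adj RA) (response A w) = defect_norm (adj A) w"
  using isometry[of w "cofeed A w"]
  by (simp add: defect_norm_def cofeed_eq adj_image_response[OF A] algebra_simps flip: response_def)

lemma cinner_image_diff:
  assumes A: "is_image A RA" and B: "is_image B RB"
  shows "cinner ((RA - RB) (feed B x)) (response A w) = cinner ((A - B) x) w"
proof -
  have cl: "clinear A" "clinear RA" using A unfolding is_image_def by auto
  have "cinner (RA (feed B x)) (response A w) = cinner (feed B x) (cofeed A w)"
    using cinner_adj_right[OF cl(2)] adj_image_response[OF A] by metis
  with cinner_image_response[OF B cl(1), of x w] show ?thesis
    by (simp add: blinfun.diff_left cinner_diff_left)
qed

text \<open>The hypothesis on the images produces the defect of \<open>adj RB\<close> at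
  \<open>response A w\<close>, while only that of \<open>adj RA\<close> can be computed there. The
  reverse relation, passed to adjoints, exchanges one for the other at the cost of
  \<open>d\<close>.\<close>

lemma mixed_bound:
  assumes A: "is_image A RA" and B: "is_image B RB"
    and prec: "form_prec RA RB" "form_prec RB RA"
  shows "\<exists>C\<ge>0. \<forall>x w. cmod (cinner ((A - B) x) w) \<le> C * defect_norm B x * defect_norm (adj A) w"
proof -
  have cl: "clinear RA" "norm RA \<le> 1" "clinear RB" "norm RB \<le> 1" "norm B \<le> 1"
    using A B unfolding is_image_def by auto
  obtain c where c: "c \<ge> 0"
    "\<And>x y. cmod (cinner ((RA - RB) x) y) \<le> c * defect_norm RB x * defect_norm (adj RB) y"
    using prec(1) unfolding form_prec_def by auto
  obtain d where d: "d \<ge> 0" "\<And>y. defect_norm (adj RB) y \<le> d * defect_norm (adj RA) y"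
    using form_prec_defect_norm_le[of "adj RA" "adj RB"] form_prec_adj[OF _ _ prec(2)] cl
    by (auto simp: clinear_adj norm_adj)
  have "cmod (cinner ((A - B) x) w) \<le> c * d * defect_norm B x * defect_norm (adj A) w" for x w
  proof -
    have nn: "0 \<le> c * defect_norm B x" using c(1) defect_norm_nonneg[OF cl(5)] by simp
    have "cmod (cinner ((A - B) x) w) \<le> c * defect_norm B x * defect_norm (adj RB) (response A w)"
      using c(2)[of "feed B x" "response A w"]
      by (simp add: cinner_image_diff[OF A B] defect_norm_image[OF B])
    also have "\<dots> \<le> c * defect_norm B x * (d * defect_norm (adj A) w)"
      using d(2)[of "response A w"] nn by (intro mult_left_mono) (simp_all add: defect_norm_adj_image[OF A])
    finally show ?thesis by (simp add: ac_simps)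
  qed
  then show ?thesis using c(1) d(1) by (intro exI[of _ "c * d"]) simp
qed

text \<open>The mixed bound for B - A already has the right defect in \<open>w\<close>, so only the
  defect of \<open>A\<close> in \<open>x\<close> must be replaced by that of \<open>B\<close>. The
  defects of \<open>RA\<close> and \<open>RB\<close> are comparable at a common input, but that
  input belongs to different states of \<open>A\<close> and \<open>B\<close>; the other mixed bound
  controls their distance.\<close>

lemma form_prec_image_cancel:
  assumes A: "is_image A RA" and B: "is_image B RB"
    and prec: "form_prec RA RB" "form_prec RB RA"
  shows "form_prec A B"
proof -
  have cl: "clinear RA" "norm RA \<le> 1" "clinear RB" "norm RB \<le> 1" "norm A \<le> 1" "norm B \<le> 1"
    "clinear A" "clinear B"
    using A B unfolding is_image_def by auto
  have cl': "norm (adj A) \<le> 1" "norm (adj B) \<le> 1" using cl by (auto simp: norm_adj)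
  obtain C where C: "C \<ge> 0"
    "\<And>x w. cmod (cinner ((B - A) x) w) \<le> C * defect_norm A x * defect_norm (adj B) w"
    using mixed_bound[OF B A prec(2) prec(1)] by auto
  obtain C' where C': "C' \<ge> 0"
    "\<And>x w. cmod (cinner ((A - B) x) w) \<le> C' * defect_norm B x * defect_norm (adj A) w"
    using mixed_bound[OF A B prec] by auto
  obtain d where d: "d \<ge> 0" "\<And>u. defect_norm RA u \<le> d * defect_norm RB u"
    using form_prec_defect_norm_le[OF cl(3,4,1,2) prec(1)] by auto
  have "norm ((A - B) x) \<le> C' * defect_norm B x" for x
  proof (rule norm_le_by_cinner)
    show "cmod (cinner ((A - B) x) w) \<le> C' * defect_norm B x * norm w" for w
      using C'(2)[of x w] mult_left_mono[OF defect_norm_le[OF cl'(1), of w], of "C' * defect_norm B x"]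
        C'(1) defect_norm_nonneg[OF cl(6)] by (meson mult_nonneg_nonneg order_trans)
    show "0 \<le> C' * defect_norm B x" using C'(1) defect_norm_nonneg[OF cl(6)] by simp
  qed
  note diff_le = this
  \<comment> \<open>The factor \<open>d\<close> compares the images at a common input; the bracket
    accounts for the change of state, with 1 - \<rho> coming from the resolvent.\<close>
  define e where "e = d * (1 + C' / (1 - \<rho>))"
  have \<rho>: "0 \<le> \<rho>" using norm_M11(1) norm_ge_zero order_trans by blast
  have e: "e \<ge> 0" using d(1) C'(1) norm_M11(2) by (simp add: e_def)
  have "defect_norm A x \<le> e * defect_norm B x" for x
  proof -
    obtain x' where x': "feed B x' = feed A x"
      "\<And>z. (1 - \<rho>) * norm (x' - z) \<le> norm (M12 (feed A x) - (z - M11 (B z)))"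
      using feed_surj[OF cl(6)] by metis
    \<comment> \<open>The residual of \<open>x\<close> when it is taken as trial state of
      \<open>B\<close> for the input of \<open>A\<close>.\<close>
    have "M12 (feed A x) - (x - M11 (B x)) = - M11 ((A - B) x)"
      by (simp add: feed_def inverse_M12 blinfun.diff_left blinfun.diff_right)
    then have "(1 - \<rho>) * norm (x' - x) \<le> norm (M11 ((A - B) x))"
      using x'(2)[of x] by simp
    also have "\<dots> \<le> norm ((A - B) x)"
      using norm_M11 by (intro norm_blinfun_le) simp
    also have "\<dots> \<le> C' * defect_norm B x" by (rule diff_le)
    finally have dx: "norm (x' - x) \<le> C' / (1 - \<rho>) * defect_norm B x"
      using norm_M11(2) by (simp add: pos_le_divide_eq mult.commute)
    \<comment> \<open>Subadditivity is not visible from the square root formula; it comes from the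
      realisation as the norm of \<open>defect_op B\<close>.\<close>
    have "defect_norm B x' \<le> defect_norm B x + norm (x' - x)"
    proof -
      have D: "defect_norm B z = norm (defect_op B z)" for z
        using norm_defect_op[OF cl(8,6)] by simp
      have "norm (defect_op B (x' - x)) \<le> norm (x' - x)"
        using defect_norm_le[OF cl(6), of "x' - x"] by (simp add: D)
      then show ?thesis
        using norm_triangle_ineq[of "defect_op B x" "defect_op B (x' - x)"]
        by (simp add: D blinfun.diff_right)
    qed
    also have "\<dots> \<le> (1 + C' / (1 - \<rho>)) * defect_norm B x"
      using dx by (simp add: distrib_right)
    finally have *: "defect_norm B x' \<le> (1 + C' / (1 - \<rho>)) * defect_norm B x" .
    have "defect_norm A x = defect_norm RA (feed B x')"
      by (simp add: x'(1) defect_norm_image[OF A])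
    also have "\<dots> \<le> d * defect_norm B x'"
      using d(2)[of "feed B x'"] by (simp add: defect_norm_image[OF B])
    also have "\<dots> \<le> e * defect_norm B x"
      using mult_left_mono[OF * d(1)] by (simp add: e_def mult.assoc)
    finally show ?thesis .
  qed
  note le = this
  have "cmod (cinner ((A - B) x) w) \<le> C * e * defect_norm B x * defect_norm (adj B) w" for x w
  proof -
    have "cmod (cinner ((A - B) x) w) = cmod (cinner ((B - A) x) w)"
      by (simp add: blinfun.diff_left cinner_diff_left norm_minus_commute)
    also have "\<dots> \<le> C * defect_norm A x * defect_norm (adj B) w" by (rule C(2))
    also have "\<dots> \<le> C * (e * defect_norm B x) * defect_norm (adj B) w"
      using le[of x] C(1) defect_norm_nonneg[OF cl'(2), of w]
      by (intro mult_right_mono mult_left_mono) auto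
    finally show ?thesis by (simp add: mult.assoc)
  qed
  then show ?thesis
    unfolding form_prec_def using C(1) e by (intro exI[of _ "C * e"]) simp
qed

end

section \<open>Multiplication operators on the Hardy space\<close>

lemma Hinf_bound:
  assumes "F \<in> Hinf"
  shows "\<exists>M\<ge>0. \<forall>z\<in>\<bbbD>. norm (F z) \<le> M"
proof -
  have "\<exists>M. \<forall>z\<in>\<bbbD>. norm (F z) \<le> M" using assms unfolding Hinf_def by simp
  then obtain M where M: "\<forall>z\<in>\<bbbD>. norm (F z) \<le> M" ..
  then have "norm (F 0) \<le> M" by simp
  then have "0 \<le> M" using norm_ge_zero order_trans by blast
  with M show ?thesis by blast
qed

lemma Hinf_clinear: "F \<in> Hinf \<Longrightarrow> z \<in> \<bbbD> \<Longrightarrow> clinear (F z)"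
  by (simp add: Hinf_def)

lemma schur_imp_Hinf: "F \<in> schur \<Longrightarrow> F \<in> Hinf"
  by (auto simp: schur_def Hinf_def)

lemma schur_norm: "F \<in> schur \<Longrightarrow> z \<in> \<bbbD> \<Longrightarrow> norm (F z) \<le> 1"
  by (simp add: schur_def)

lemma holomorphic_on_cinner:
  assumes "F \<in> Hinf"
  shows "(\<lambda>z. cinner (F z x) y) holomorphic_on \<bbbD>"
proof (rule holomorphic_onI)
  fix z assume "z \<in> \<bbbD>"
  then obtain D where D: "(F has_derivative (\<lambda>h. h *\<^sub>C D)) (at z)"
    using assms unfolding Hinf_def analytic_on_disc_def by blast
  have bl: "bounded_linear (\<lambda>A. cinner (blinfun_apply A x) y)"
    using bounded_linear_compose[OF bounded_linear_cinner_left blinfun.bounded_linear_left] .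
  have "((\<lambda>z. cinner (F z x) y) has_derivative (\<lambda>h. cinner ((h *\<^sub>C D) x) y)) (at z)"
    by (rule bounded_linear.has_derivative[OF bl D])
  then have "((\<lambda>z. cinner (F z x) y) has_field_derivative cinner (D x) y) (at z)"
    unfolding has_field_derivative_def
    by (simp add: scaleC_blinfun.rep_eq cinner_scaleC_left mult.commute[of _ "cinner (D x) y"])
  then show "(\<lambda>z. cinner (F z x) y) field_differentiable (at z within \<bbbD>)"
    using field_differentiable_at_within field_differentiable_def by blast
qed

text \<open>Norm convergence is supplied separately; weak convergence only identifies the
  limit.\<close>

lemma weak_sums:
  fixes a :: "nat \<Rightarrow> 'a::complex_inner"
  assumes "summable a" and "\<And>y. (\<lambda>n. cinner (a n) y) sums cinner s y"
  shows "a sums s"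
proof -
  have "cinner (suminf a) y = cinner s y" for y
    using bounded_linear.sums[OF bounded_linear_cinner_left summable_sums[OF assms(1)]] assms(2)
    by (metis sums_unique2)
  then have "suminf a = s" by (rule cinner_eqI)
  then show ?thesis using summable_sums[OF assms(1)] by simp
qed

text \<open>Cauchy's estimate on circles of radius r below 1, followed by r tending to 1, so that
  the constant \<open>B\<close> is not worsened.\<close>

lemma higher_deriv_bound:
  assumes hol: "f holomorphic_on \<bbbD>" and B: "\<And>z. z \<in> \<bbbD> \<Longrightarrow> cmod (f z) \<le> B"
  shows "cmod ((deriv ^^ n) f 0 / fact n) \<le> B"
proof -
  have le: "cmod ((deriv ^^ n) f 0 / fact n) * r ^ n \<le> B" if r: "0 < r" "r < 1" for r
  proof -
    have "cmod ((deriv ^^ n) f 0) \<le> fact n * B / r ^ n"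
    proof (rule Cauchy_inequality)
      show "f holomorphic_on ball 0 r" using r by (intro holomorphic_on_subset[OF hol]) auto
      show "continuous_on (cball 0 r) f"
        using r by (intro holomorphic_on_imp_continuous_on holomorphic_on_subset[OF hol]) auto
    qed (use r B in auto)
    then show ?thesis using r by (simp add: norm_divide pos_le_divide_eq pos_divide_le_eq mult.commute)
  qed
  have "((\<lambda>r. cmod ((deriv ^^ n) f 0 / fact n) * r ^ n) \<longlongrightarrow> cmod ((deriv ^^ n) f 0 / fact n) * 1 ^ n) (at_left 1)"
    by (intro tendsto_intros)
  then have "cmod ((deriv ^^ n) f 0 / fact n) * 1 ^ n \<le> B"
  proof (rule tendsto_upperbound)
    show "\<forall>\<^sub>F r in at_left 1. cmod ((deriv ^^ n) f 0 / fact n) * r ^ n \<le> B"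
      by (rule eventually_at_leftI[of 0]) (simp_all only: le greaterThanLessThan_iff zero_less_one)
  qed simp
  then show ?thesis by simp
qed

definition disc_coeffs ::
    "(complex \<Rightarrow> 'u::chilbert_space \<Rightarrow>\<^sub>L 'y::chilbert_space) \<Rightarrow> (nat \<Rightarrow> 'u \<Rightarrow>\<^sub>L 'y) \<Rightarrow> bool"
  where "disc_coeffs F P \<longleftrightarrow> (\<forall>n. clinear (P n)) \<and> (\<exists>M. \<forall>n. norm (P n) \<le> M) \<and>
    (\<forall>z\<in>\<bbbD>. \<forall>x. (\<lambda>n. z ^ n *\<^sub>C P n x) sums F z x)"

lemma summable_disc:
  fixes a :: "nat \<Rightarrow> 'a::{complex_normed_vector, banach}"
  assumes "z \<in> \<bbbD>" "\<And>n. norm (a n) \<le> M"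
  shows "summable (\<lambda>n. z ^ n *\<^sub>C a n)"
proof (rule summable_comparison_test')
  show "summable (\<lambda>n. cmod z ^ n * M)"
    using assms(1) by (intro summable_mult2 summable_geometric) simp
  show "norm (z ^ n *\<^sub>C a n) \<le> cmod z ^ n * M" for n
    by (simp add: norm_scaleC norm_power mult_left_mono assms(2))
qed

text \<open>The scalar coefficients of the functions z -> <F(z) x, y> form, for each
  \<open>n\<close>, a sesquilinear form bounded by Cauchy's estimate; Riesz representation turns it
  into an operator.\<close>

lemma Hinf_disc_coeffs:
  fixes F :: "complex \<Rightarrow> 'u::chilbert_space \<Rightarrow>\<^sub>L 'y::chilbert_space"
  assumes F: "F \<in> Hinf"
  obtains P where "disc_coeffs F P"
proof -
  obtain M where M: "0 \<le> M" "\<And>z. z \<in> \<bbbD> \<Longrightarrow> norm (F z) \<le> M" using Hinf_bound[OF F] by auto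
  define f where "f x y = (\<lambda>z. cinner (F z x) y)" for x y
  define c where "c n x y = (deriv ^^ n) (f x y) 0 / fact n" for n x y
  note hol = holomorphic_on_cinner[OF F, folded f_def]
  have f_add: "f (x + x') y = (\<lambda>z. f x y z + f x' y z)" "f x (y + y') = (\<lambda>z. f x y z + f x y' z)"
    "f x (k *\<^sub>C y) = (\<lambda>z. cnj k * f x y z)" for x x' y y' k
    by (simp_all add: f_def blinfun.add_right cinner_add_left cinner_add_right cinner_scaleC_right)
  \<comment> \<open>Complex linearity of \<open>F z\<close> is known only on the disc, so here the
    two functions agree only locally and derivatives are compared on an open set.\<close>
  have f_scale: "(deriv ^^ n) (f (k *\<^sub>C x) y) 0 = (deriv ^^ n) (\<lambda>z. k * f x y z) 0" for k x y n
    by (rule higher_deriv_transform_within_open[of _ \<bbbD>])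
      (use hol in \<open>auto intro!: holomorphic_on_mult simp: f_def clinearD[OF Hinf_clinear[OF F]] cinner_scaleC_left\<close>)
  have f_bound: "cmod (f x y z) \<le> M * norm y * norm x" if "z \<in> \<bbbD>" for x y z
  proof -
    have "cmod (f x y z) \<le> norm (F z) * norm x * norm y"
      unfolding f_def
      using cinner_Cauchy_Schwarz[of "F z x" y] mult_right_mono[OF norm_blinfun[of "F z" x], of "norm y"] by simp
    also have "\<dots> \<le> M * norm x * norm y" using M(2)[OF that] by (intro mult_right_mono) auto
    finally show ?thesis by (simp add: ac_simps)
  qed
  have "\<exists>P. clinear P \<and> norm P \<le> M \<and> (\<forall>x y. cinner (P x) y = c n x y)" for n
  proof -
    obtain W :: "'y \<Rightarrow>\<^sub>L 'u" where W: "clinear W"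
      "\<And>x y. c n x y = cinner ((id_blinfun :: 'u \<Rightarrow>\<^sub>L 'u) x) (W y)" "\<And>y. norm (W y) \<le> M * norm y"
    proof (rule form_rep[where D = "id_blinfun :: 'u \<Rightarrow>\<^sub>L 'u" and b = "c n"
          and N = "\<lambda>y. M * norm y" and M = M])
      show "c n (x + x') y = c n x y + c n x' y" for x x' y
        unfolding c_def f_add by (subst higher_deriv_add[of _ \<bbbD>]) (auto intro!: hol simp: add_divide_distrib)
      show "c n x (y + y') = c n x y + c n x y'" for x y y'
        unfolding c_def f_add by (subst higher_deriv_add[of _ \<bbbD>]) (auto intro!: hol simp: add_divide_distrib)
      show "c n (k *\<^sub>C x) y = k * c n x y" for k x y
        unfolding c_def f_scale by (subst higher_deriv_cmult[of _ \<bbbD>]) (auto intro!: hol)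
      show "c n x (k *\<^sub>C y) = cnj k * c n x y" for k x y
        unfolding c_def f_add by (subst higher_deriv_cmult[of _ \<bbbD>]) (auto intro!: hol)
      show "cmod (c n x y) \<le> M * norm y * norm ((id_blinfun :: 'u \<Rightarrow>\<^sub>L 'u) x)" for x y
        unfolding c_def using higher_deriv_bound[OF hol f_bound] by simp
    qed (use M in auto)
    have "norm W \<le> M" using M(1) W(3) by (rule norm_blinfun_bound)
    \<comment> \<open>\<open>W\<close> acts on the second argument of the form, so the coefficient
      is its adjoint.\<close>
    then show ?thesis
      using W by (intro exI[of _ "adj W"]) (simp add: clinear_adj norm_adj cinner_adj_left)
  qed
  then obtain P where P: "\<And>n. clinear (P n)" "\<And>n. norm (P n) \<le> M" "\<And>n x y. cinner (P n x) y = c n x y"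
    by metis
  have "(\<lambda>n. z ^ n *\<^sub>C P n x) sums F z x" if z: "z \<in> \<bbbD>" for z x
  proof (rule weak_sums)
    have "norm (P n x) \<le> M * norm x" for n
      using norm_blinfun[of "P n" x] mult_right_mono[OF P(2)[of n] norm_ge_zero[of x]] by simp
    then show "summable (\<lambda>n. z ^ n *\<^sub>C P n x)" by (rule summable_disc[OF z])
    show "(\<lambda>n. cinner (z ^ n *\<^sub>C P n x) y) sums cinner (F z x) y" for y
      using holomorphic_power_series[OF hol z, of x y]
      by (simp add: cinner_scaleC_left P(3) c_def f_def mult.commute)
  qed
  then have "disc_coeffs F P" unfolding disc_coeffs_def using P by auto
  then show thesis by (rule that)
qed

subsection \<open>Parseval's identity on circles\<close>

lemma integral_cis:
  assumes "k \<noteq> (0::int)"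
  shows "integral\<^sup>L (lebesgue_on {0..2*pi}) (\<lambda>t. cis (of_int k * t)) = 0"
proof -
  have "((\<lambda>t. cis (of_int k * t)) has_integral
      (cis (of_int k * (2*pi)) / (\<i> * of_int k) - cis (of_int k * 0) / (\<i> * of_int k))) {0..2*pi}"
  proof (rule fundamental_theorem_of_calculus)
    fix t :: real
    have "((\<lambda>z. exp (\<i> * of_int k * z) / (\<i> * of_int k)) has_field_derivative exp (\<i> * of_int k * of_real t))
        (at (of_real t))"
      using assms by (auto intro!: derivative_eq_intros)
    from has_vector_derivative_real_field[OF this]
    show "((\<lambda>t. cis (of_int k * t) / (\<i> * of_int k)) has_vector_derivative cis (of_int k * t))
        (at t within {0..2*pi})"
      by (simp add: cis_conv_exp mult.assoc)
  qed simp
  moreover have "cis (of_int k * (2*pi)) = 1"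
    using cis_multiple_2pi[of "of_int k"] by (simp add: mult.commute mult.left_commute)
  ultimately have "integral {0..2*pi} (\<lambda>t. cis (of_int k * t)) = 0"
    by (simp add: integral_unique)
  then show ?thesis
    by (subst lebesgue_integral_eq_integral) (auto intro!: continuous_imp_integrable_real continuous_intros)
qed

text \<open>The orientation \<open>s = \<plusminus>1\<close> of the circle accommodates both a function and its reflection \<open>z \<mapsto> F(cnj z)\<^sup>*\<close>.\<close>

abbreviation circ :: "int \<Rightarrow> real \<Rightarrow> real \<Rightarrow> complex"
  where "circ s r t \<equiv> of_real r * cis (of_int s * t)"

lemma continuous_on_scaleC_left:
  fixes x :: "'a::complex_normed_vector"
  shows "continuous_on A f \<Longrightarrow> continuous_on A (\<lambda>t. f t *\<^sub>C x)"
proof -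
  have "bounded_linear (\<lambda>c. c *\<^sub>C x)"
    by (rule bounded_linear_intro[where K = "norm x"])
      (simp_all add: scaleC_add_left norm_scaleC scaleR_conv_of_real flip: scaleC_scaleC scaleC_of_real)
  from bounded_linear.continuous_on[OF this] show "continuous_on A f \<Longrightarrow> continuous_on A (\<lambda>t. f t *\<^sub>C x)" .
qed

lemma continuous_circ_sum:
  fixes a :: "nat \<Rightarrow> 'a::complex_normed_vector"
  shows "continuous_on A (\<lambda>t. (norm (\<Sum>n<N. circ s r t ^ n *\<^sub>C a n))\<^sup>2)"
  by (intro continuous_intros continuous_on_scaleC_left)

lemma parseval_sum:
  fixes a :: "nat \<Rightarrow> 'a::complex_inner"
  assumes s: "s \<noteq> 0"
  shows "integral\<^sup>L (lebesgue_on {0..2*pi}) (\<lambda>t. (norm (\<Sum>n<N. circ s r t ^ n *\<^sub>C a n))\<^sup>2)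
    = 2 * pi * (\<Sum>n<N. (r ^ n * norm (a n))\<^sup>2)"
proof -
  let ?M = "lebesgue_on {0..2*pi}"
  have expand: "complex_of_real ((norm (\<Sum>n<N. circ s r t ^ n *\<^sub>C a n))\<^sup>2)
      = (\<Sum>m<N. \<Sum>n<N. cis (of_int (s * (int m - int n)) * t) * (of_real (r ^ m * r ^ n) * cinner (a m) (a n)))" for t
  proof -
    have pw: "circ s r t ^ m * cnj (circ s r t ^ n) = cis (of_int (s * (int m - int n)) * t) * of_real (r ^ m * r ^ n)" for m n
      by (simp add: power_mult_distrib Complex.DeMoivre cis_cnj cis_mult algebra_simps)
    have "complex_of_real ((norm (\<Sum>n<N. circ s r t ^ n *\<^sub>C a n))\<^sup>2)
      = (\<Sum>m<N. \<Sum>n<N. (circ s r t ^ m * cnj (circ s r t ^ n)) * cinner (a m) (a n))"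
      unfolding cinner_self[symmetric] cinner_sum_left cinner_sum_right cinner_scaleC_left cinner_scaleC_right
      by (subst sum.swap) (simp only: sum_distrib_left ac_simps)
    then show ?thesis unfolding pw by (simp only: mult.assoc)
  qed
  have cint: "integrable ?M (\<lambda>t. cis (of_int k * t) * c)" for k c
    by (intro continuous_imp_integrable_real continuous_intros)
  have "complex_of_real (integral\<^sup>L ?M (\<lambda>t. (norm (\<Sum>n<N. circ s r t ^ n *\<^sub>C a n))\<^sup>2))
      = integral\<^sup>L ?M (\<lambda>t. complex_of_real ((norm (\<Sum>n<N. circ s r t ^ n *\<^sub>C a n))\<^sup>2))"
    by (rule integral_complex_of_real[symmetric])
  also have "\<dots> = (\<Sum>m<N. \<Sum>n<N. integral\<^sup>L ?M (\<lambda>t. cis (of_int (s * (int m - int n)) * t)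
      * (of_real (r ^ m * r ^ n) * cinner (a m) (a n))))"
    unfolding expand by (subst Bochner_Integration.integral_sum | intro Bochner_Integration.integrable_sum cint sum.cong refl)+
  also have "\<dots> = (\<Sum>m<N. \<Sum>n<N. if n = m then 2 * pi * of_real (r ^ m * r ^ m) * cinner (a m) (a m) else 0)"
  proof (intro sum.cong refl)
    fix m n
    show "integral\<^sup>L ?M (\<lambda>t. cis (of_int (s * (int m - int n)) * t) * (of_real (r ^ m * r ^ n) * cinner (a m) (a n)))
        = (if n = m then 2 * pi * of_real (r ^ m * r ^ m) * cinner (a m) (a m) else 0)"
    proof (cases "n = m")
      case True
      then show ?thesis by (simp add: measure_restrict_space mult.assoc scaleR_conv_of_real)
    next
      case False
      then have "s * (int m - int n) \<noteq> 0" using s by simp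
      from integral_cis[OF this] False show ?thesis by (simp del: of_int_mult of_int_diff)
    qed
  qed
  also have "\<dots> = (\<Sum>m<N. 2 * pi * of_real (r ^ m * r ^ m) * cinner (a m) (a m))"
    by (simp add: sum.delta)
  also have "\<dots> = complex_of_real (2 * pi * (\<Sum>n<N. (r ^ n * norm (a n))\<^sup>2))"
    by (simp add: cinner_self sum_distrib_left power2_eq_square ac_simps)
  finally show ?thesis unfolding of_real_eq_iff .
qed

text \<open>Summability of the weighted norms bounds all partial sums uniformly in \<open>t\<close>,
  so dominated convergence lifts both claims from finite sums.\<close>

lemma
  fixes a :: "nat \<Rightarrow> 'a::{complex_inner, banach}" and s :: int
  assumes s: "s \<noteq> 0" and r: "0 \<le> r" and sm: "summable (\<lambda>n. r ^ n * norm (a n))"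
  shows integrable_parseval:
      "integrable (lebesgue_on {0..2*pi}) (\<lambda>t. (norm (\<Sum>n. circ s r t ^ n *\<^sub>C a n))\<^sup>2)" (is ?I)
    and parseval: "(\<lambda>n. 2 * pi * (r ^ n * norm (a n))\<^sup>2) sums
      integral\<^sup>L (lebesgue_on {0..2*pi}) (\<lambda>t. (norm (\<Sum>n. circ s r t ^ n *\<^sub>C a n))\<^sup>2)" (is ?P)
proof -
  let ?M = "lebesgue_on {0..2*pi}"
  have nrm: "norm (circ s r t ^ n *\<^sub>C a n) = r ^ n * norm (a n)" for t n
    using r by (simp add: norm_scaleC norm_power norm_mult)
  have summ: "summable (\<lambda>n. circ s r t ^ n *\<^sub>C a n)" for t
    by (rule summable_norm_cancel) (simp only: nrm sm)
  have lim: "(\<lambda>N. (norm (\<Sum>n<N. circ s r t ^ n *\<^sub>C a n))\<^sup>2) \<longlonglongrightarrow> (norm (\<Sum>n. circ s r t ^ n *\<^sub>C a n))\<^sup>2" for t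
    by (intro tendsto_intros summable_LIMSEQ summ)
  have meas: "(\<lambda>t. (norm (\<Sum>n<N. circ s r t ^ n *\<^sub>C a n))\<^sup>2) \<in> borel_measurable ?M" for N
    by (intro continuous_imp_measurable_on_sets_lebesgue continuous_circ_sum) simp
  have meas': "(\<lambda>t. (norm (\<Sum>n. circ s r t ^ n *\<^sub>C a n))\<^sup>2) \<in> borel_measurable ?M"
    by (rule borel_measurable_LIMSEQ_real[OF lim meas])
  have bound: "norm ((norm (\<Sum>n<N. circ s r t ^ n *\<^sub>C a n))\<^sup>2) \<le> (\<Sum>n. r ^ n * norm (a n))\<^sup>2" for t N
  proof -
    have "norm (\<Sum>n<N. circ s r t ^ n *\<^sub>C a n) \<le> (\<Sum>n<N. r ^ n * norm (a n))"
      using norm_sum[of "\<lambda>n. circ s r t ^ n *\<^sub>C a n" "{..<N}"] by (simp only: nrm)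
    also have "\<dots> \<le> (\<Sum>n. r ^ n * norm (a n))"
      using r by (intro sum_le_suminf sm) auto
    finally show ?thesis by (simp add: power_mono)
  qed
  have const: "integrable ?M (\<lambda>t. (\<Sum>n. r ^ n * norm (a n))\<^sup>2)"
    by (intro continuous_imp_integrable_real continuous_intros)
  show ?I
    by (rule integrable_dominated_convergence[OF meas' meas const]; rule AE_I2; rule lim bound)
  have "(\<lambda>N. integral\<^sup>L ?M (\<lambda>t. (norm (\<Sum>n<N. circ s r t ^ n *\<^sub>C a n))\<^sup>2))
      \<longlonglongrightarrow> integral\<^sup>L ?M (\<lambda>t. (norm (\<Sum>n. circ s r t ^ n *\<^sub>C a n))\<^sup>2)"
    by (rule integral_dominated_convergence[OF meas' meas const]; rule AE_I2; rule lim bound)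
  then show ?P unfolding parseval_sum[OF s] sums_def sum_distrib_left .
qed

subsection \<open>Multiplication operators\<close>

text \<open>Summation by columns; column \<open>i\<close> of the triangle keeps \<open>N - i\<close>
  entries. For products of power series, coefficient \<open>i\<close> of one factor thus meets a
  truncation of the other.\<close>

lemma sum_triangle:
  fixes g :: "nat \<Rightarrow> nat \<Rightarrow> 'a::ab_group_add"
  shows "(\<Sum>n<N. \<Sum>j\<le>n. g j (n - j)) = (\<Sum>i<N. \<Sum>j<N - i. g j i)"
proof (induction N)
  case (Suc N)
  have "(\<Sum>i<Suc N. \<Sum>j<Suc N - i. g j i) = (\<Sum>i<Suc N. (\<Sum>j<N - i. g j i) + g (N - i) i)"
    by (intro sum.cong refl) (simp add: Suc_diff_le)
  also have "\<dots> = (\<Sum>i<N. \<Sum>j<N - i. g j i) + (\<Sum>i<Suc N. g (N - i) i)"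
    by (simp add: sum.distrib)
  also have "(\<Sum>i<Suc N. g (N - i) i) = (\<Sum>j<Suc N. g j (N - j))"
    using sum.nat_diff_reindex[of "\<lambda>j. g j (N - j)" "Suc N"] by (simp del: sum.lessThan_Suc)
  finally show ?case using Suc by (simp add: lessThan_Suc_atMost del: sum.lessThan_Suc)
      (simp add: lessThan_Suc_atMost[symmetric])
qed simp

text \<open>By \<open>sum_triangle\<close> the partial sum of order \<open>N\<close> applies to
  \<open>c i\<close> the truncation \<open>S (N - i)\<close> of \<open>F z\<close>. For fixed
  \<open>i\<close> the error tends to zero, and it is dominated by a multiple of
  \<open>norm (c i)\<close>, so Tannery's theorem applies.\<close>

lemma cauchy_product_sums:
  fixes F :: "complex \<Rightarrow> 'u::chilbert_space \<Rightarrow>\<^sub>L 'y::chilbert_space"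
  assumes P: "disc_coeffs F P" and z: "z \<in> \<bbbD>" and b: "l2seq b"
  shows "(\<lambda>n. z ^ n *\<^sub>C (\<Sum>j\<le>n. P j (b (n - j)))) sums F z (hardy_series b z)"
proof -
  obtain L where L: "\<And>n. norm (P n) \<le> L" using P unfolding disc_coeffs_def by auto
  have L0: "0 \<le> L" using order_trans[OF norm_ge_zero L[of 0]] .
  obtain B where B: "\<And>n. norm (b n) \<le> B" using l2seq_bounded[OF b] by auto
  have Fs: "(\<lambda>j. z ^ j *\<^sub>C P j x) sums F z x" for x using P z unfolding disc_coeffs_def by auto
  have P_lin: "P j (c *\<^sub>C x) = c *\<^sub>C P j x" for j c x
    using P unfolding disc_coeffs_def by (auto intro: clinearD)
  have z1: "cmod z < 1" using z by simp
  define c where "c i = z ^ i *\<^sub>C b i" for i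
  have c_norm: "summable (\<lambda>i. norm (c i))"
  proof (rule summable_comparison_test')
    show "summable (\<lambda>n. cmod z ^ n * B)" using z1 by (intro summable_mult2 summable_geometric) simp
    show "norm (norm (c n)) \<le> cmod z ^ n * B" for n
      by (simp add: c_def norm_scaleC norm_power mult_left_mono B)
  qed
  define S where "S N x = (\<Sum>j<N. z ^ j *\<^sub>C P j x)" for N x
  define K where "K = L / (1 - cmod z)"
  have S_bound: "norm (S N x) \<le> K * norm x" for N x
  proof -
    have "norm (S N x) \<le> (\<Sum>j<N. cmod z ^ j * (L * norm x))"
      unfolding S_def
    proof (rule sum_norm_le)
      show "norm (z ^ j *\<^sub>C P j x) \<le> cmod z ^ j * (L * norm x)" for j
        using norm_blinfun[of "P j" x] mult_right_mono[OF L[of j] norm_ge_zero[of x]]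
        by (simp add: norm_scaleC norm_power mult_left_mono)
    qed
    also have "\<dots> = (\<Sum>j<N. cmod z ^ j) * (L * norm x)" by (simp add: sum_distrib_right)
    also have "\<dots> \<le> (1 / (1 - cmod z)) * (L * norm x)"
    proof (rule mult_right_mono)
      show "(\<Sum>j<N. cmod z ^ j) \<le> 1 / (1 - cmod z)"
        using sum_le_suminf[OF summable_geometric, of "cmod z" "{..<N}"] suminf_geometric[of "cmod z"] z1 by simp
    qed (use L0 in simp)
    finally show ?thesis by (simp add: K_def)
  qed
  \<comment> \<open>For i \<ge> N the subtraction gives 0 and \<open>S 0\<close> vanishes, so
    \<open>e N i\<close> is then the whole tail term \<open>F z (c i)\<close>.\<close>
  define e where "e N i = F z (c i) - S (N - i) (c i)" for N i
  have e_norm: "norm (e N i) \<le> (norm (F z) + K) * norm (c i)" for N i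
    unfolding e_def using norm_triangle_ineq4[of "F z (c i)" "S (N - i) (c i)"]
      norm_blinfun[of "F z" "c i"] S_bound[of "N - i" "c i"] by (simp add: distrib_right)
  have maj: "summable (\<lambda>i. (norm (F z) + K) * norm (c i))" by (intro summable_mult c_norm)
  have e_summable: "summable (\<lambda>i. norm (e N i))" for N
    by (rule summable_comparison_test'[OF maj]) (simp add: e_norm)
  have "(\<lambda>N. e N i) \<longlonglongrightarrow> 0" for i
  proof -
    have "(\<lambda>N. S N (c i)) \<longlonglongrightarrow> F z (c i)" using Fs unfolding sums_def S_def .
    then have "(\<lambda>N. S (N - i) (c i)) \<longlonglongrightarrow> F z (c i)"
      by (rule filterlim_compose) (rule filterlim_minus_const_nat_at_top)
    then show ?thesis unfolding e_def
      using tendsto_diff[OF tendsto_const[of "F z (c i)"]] by fastforce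
  qed
  then have e_lim: "(\<lambda>N. norm (e N i)) \<longlonglongrightarrow> 0" for i
    by (rule tendsto_norm_zero)
  have "(\<lambda>N. \<Sum>i. norm (e N i)) \<longlonglongrightarrow> (\<Sum>i. 0)"
  proof (rule conjunct2[OF conjunct2[OF tannerys_theorem[OF e_lim _ maj]]])
    show "\<forall>\<^sub>F (i, N) in sequentially \<times>\<^sub>F sequentially. norm (norm (e N i)) \<le> (norm (F z) + K) * norm (c i)"
      by (rule always_eventually) (simp add: e_norm split: prod.split)
  qed simp
  then have lim: "(\<lambda>N. \<Sum>i. norm (e N i)) \<longlonglongrightarrow> 0" by simp
  have Fc: "(\<lambda>i. F z (c i)) sums F z (hardy_series b z)"
    using bounded_linear.sums[OF blinfun.bounded_linear_right summable_sums[OF summable_hardy_series[OF b z]]] z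
    by (simp add: c_def hardy_series_def)
  have diff: "F z (hardy_series b z) - (\<Sum>n<N. z ^ n *\<^sub>C (\<Sum>j\<le>n. P j (b (n - j)))) = (\<Sum>i. e N i)" for N
  proof -
    have "(\<Sum>n<N. z ^ n *\<^sub>C (\<Sum>j\<le>n. P j (b (n - j)))) = (\<Sum>n<N. \<Sum>j\<le>n. z ^ j *\<^sub>C P j (c (n - j)))"
      by (intro sum.cong refl) (simp add: scaleC_sum_right c_def P_lin scaleC_scaleC flip: power_add)
    also have "\<dots> = (\<Sum>i<N. S (N - i) (c i))" unfolding S_def by (rule sum_triangle)
    finally have eq: "(\<Sum>n<N. z ^ n *\<^sub>C (\<Sum>j\<le>n. P j (b (n - j)))) = (\<Sum>i<N. S (N - i) (c i))" .
    have "(\<lambda>i. S (N - i) (c i)) sums (\<Sum>i<N. S (N - i) (c i))"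
      by (rule sums_finite) (auto simp: S_def)
    from sums_diff[OF Fc this] show ?thesis unfolding e_def eq by (rule sums_unique)
  qed
  have "(\<lambda>N. F z (hardy_series b z) - (\<Sum>n<N. z ^ n *\<^sub>C (\<Sum>j\<le>n. P j (b (n - j))))) \<longlonglongrightarrow> 0"
  proof (rule Lim_null_comparison[OF _ lim], intro always_eventually allI)
    show "norm (F z (hardy_series b z) - (\<Sum>n<N. z ^ n *\<^sub>C (\<Sum>j\<le>n. P j (b (n - j))))) \<le> (\<Sum>i. norm (e N i))" for N
      unfolding diff by (rule summable_norm[OF e_summable])
  qed
  from tendsto_diff[OF tendsto_const[of "F z (hardy_series b z)"] this]
  show ?thesis unfolding sums_def by simp
qed

lemma hardy_apply_off_disc: "z \<notin> \<bbbD> \<Longrightarrow> hardy_apply h z = 0"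
  by (metis hardy_coeff(2) hardy_series_def)

lemma hardy2_apply_eqI: "(\<And>z. z \<in> \<bbbD> \<Longrightarrow> hardy_apply f z = hardy_apply g z) \<Longrightarrow> f = g"
  by (metis ext hardy_apply_inject hardy_apply_off_disc)

lemma hardy_apply_sums: "z \<in> \<bbbD> \<Longrightarrow> (\<lambda>n. z ^ n *\<^sub>C hardy_coeff h n) sums hardy_apply h z"
  using summable_sums[OF summable_hardy_series[OF hardy_coeff(1)]] hardy_coeff(2)[of h]
  by (metis hardy_series_def)

lemma norm_hardy2_sums: "(\<lambda>n. (norm (hardy_coeff h n))\<^sup>2) sums (norm h)\<^sup>2"
  unfolding norm_hardy2_def hardy_norm_sq by (rule summable_sums[OF summable_norm_hardy_coeff])

lemma summable_circ:
  assumes "0 \<le> r" "r < 1" and "\<And>n. norm (a n) \<le> real (Suc n) * B"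
  shows "summable (\<lambda>n. r ^ n * norm (a n))"
proof (rule summable_comparison_test')
  have "summable (\<lambda>n. of_nat (Suc n) * r ^ n)"
    using assms by (intro sums_summable[OF geometric_deriv_sums]) simp
  from summable_mult2[OF this] show "summable (\<lambda>n. (real (Suc n) * r ^ n) * B)" .
  show "norm (r ^ n * norm (a n)) \<le> (real (Suc n) * r ^ n) * B" for n
    using mult_left_mono[OF assms(3)[of n], of "r ^ n"] assms(1) by (simp add: ac_simps)
qed

lemma circ_in_disc: "0 \<le> r \<Longrightarrow> r < 1 \<Longrightarrow> circ s r t \<in> \<bbbD>"
  by (simp add: norm_mult)

text \<open>Pointwise domination of the product is integrated over circles of radius r below 1, and
  then r tends to 1. The crude linear bound on coefficients only serves to make Parseval applicable
  there. Everything is phrased in coefficients because the product is not yet known to lie in the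
  Hardy space.\<close>

lemma convolution_bound:
  fixes F :: "complex \<Rightarrow> 'u::chilbert_space \<Rightarrow>\<^sub>L 'y::chilbert_space"
  assumes P: "disc_coeffs F P" and M: "0 \<le> M" "\<And>z. z \<in> \<bbbD> \<Longrightarrow> norm (F z) \<le> M"
  defines "a \<equiv> \<lambda>h n. \<Sum>j\<le>n. P j (hardy_coeff h (n - j))"
  shows "\<exists>B. \<forall>n. norm (a h n) \<le> real (Suc n) * B"
    and "(\<Sum>n<m. (norm (a h n))\<^sup>2) \<le> (M * norm h)\<^sup>2"
proof -
  let ?b = "hardy_coeff h"
  obtain L where L: "\<And>n. norm (P n) \<le> L" using P unfolding disc_coeffs_def by auto
  obtain B where B: "\<And>n. norm (?b n) \<le> B" "0 \<le> B" using l2seq_bounded[OF hardy_coeff(1)] by blast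
  have "norm (a h n) \<le> real (Suc n) * (L * B)" for n
  proof -
    have "norm (a h n) \<le> (\<Sum>j\<le>n. L * B)" unfolding a_def
    proof (rule sum_norm_le)
      show "norm (P j (?b (n - j))) \<le> L * B" for j
        using norm_blinfun[of "P j" "?b (n - j)"] mult_mono[OF L[of j] B(1)[of "n - j"]]
          order_trans[OF norm_ge_zero L[of 0]] by simp
    qed
    then show ?thesis by simp
  qed
  note lin = this
  then show "\<exists>B. \<forall>n. norm (a h n) \<le> real (Suc n) * B" by blast
  have le: "(\<Sum>n<m. (r ^ n * norm (a h n))\<^sup>2) \<le> (M * norm h)\<^sup>2" if r: "0 \<le> r" "r < 1" for r
  proof -
    let ?I = "integral\<^sup>L (lebesgue_on {0..2*pi})"
    let ?A = "\<lambda>t. (norm (\<Sum>n. circ 1 r t ^ n *\<^sub>C a h n))\<^sup>2"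
    let ?B = "\<lambda>t. (norm (\<Sum>n. circ 1 r t ^ n *\<^sub>C ?b n))\<^sup>2"
    have sa: "summable (\<lambda>n. r ^ n * norm (a h n))" by (rule summable_circ[OF r lin])
    have "norm (?b n) \<le> real (Suc n) * B" for n
      using B(1)[of n] mult_right_mono[of 1 "real (Suc n)" B] B(2) by simp
    then have sb: "summable (\<lambda>n. r ^ n * norm (?b n))" by (rule summable_circ[OF r])
    have pw: "?A t \<le> M\<^sup>2 * ?B t" for t
    proof -
      note D = circ_in_disc[OF r, of 1 t]
      have sms: "(\<lambda>n. circ 1 r t ^ n *\<^sub>C a h n) sums F (circ 1 r t) (hardy_series ?b (circ 1 r t))"
        unfolding a_def by (rule cauchy_product_sums[OF P D hardy_coeff(1)])
      have hs: "hardy_series ?b (circ 1 r t) = (\<Sum>n. circ 1 r t ^ n *\<^sub>C ?b n)"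
        by (simp only: hardy_series_def D if_True)
      have "norm (F (circ 1 r t) x) \<le> M * norm x" for x
        using norm_blinfun[of "F (circ 1 r t)" x] mult_right_mono[OF M(2)[OF D] norm_ge_zero[of x]]
        by (rule order_trans)
      from power_mono[OF this norm_ge_zero, of _ 2] show ?thesis
        unfolding sums_unique[OF sms, symmetric] hs by (simp only: power_mult_distrib[of M])
    qed
    have "(\<Sum>n<m. 2 * pi * (r ^ n * norm (a h n))\<^sup>2) \<le> ?I ?A"
      using sum_le_suminf[OF sums_summable[OF parseval[OF _ r(1) sa, of 1]], of "{..<m}"]
        sums_unique[OF parseval[OF _ r(1) sa, of 1]] by simp
    also have "\<dots> \<le> ?I (\<lambda>t. M\<^sup>2 * ?B t)"
      using integrable_parseval[OF _ r(1) sa, of 1] integrable_parseval[OF _ r(1) sb, of 1] pw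
      by (intro integral_mono) auto
    also have "\<dots> = M\<^sup>2 * ?I ?B" by simp
    also have "?I ?B \<le> 2 * pi * (norm h)\<^sup>2"
    proof (rule sums_le)
      show "(\<lambda>n. 2 * pi * (r ^ n * norm (?b n))\<^sup>2) sums ?I ?B" by (rule parseval[OF _ r(1) sb]) simp
      show "(\<lambda>n. 2 * pi * (norm (?b n))\<^sup>2) sums (2 * pi * (norm h)\<^sup>2)"
        by (rule sums_mult[OF norm_hardy2_sums])
      show "2 * pi * (r ^ n * norm (?b n))\<^sup>2 \<le> 2 * pi * (norm (?b n))\<^sup>2" for n
        using r by (intro mult_left_mono power_mono mult_left_le_one_le) (auto intro: power_le_one)
    qed
    then have "M\<^sup>2 * ?I ?B \<le> M\<^sup>2 * (2 * pi * (norm h)\<^sup>2)" by (rule mult_left_mono) simp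
    finally have "2 * pi * (\<Sum>n<m. (r ^ n * norm (a h n))\<^sup>2) \<le> 2 * pi * (M * norm h)\<^sup>2"
      by (simp add: sum_distrib_left power_mult_distrib ac_simps)
    then show ?thesis by simp
  qed
  have "((\<lambda>r. \<Sum>n<m. (r ^ n * norm (a h n))\<^sup>2) \<longlongrightarrow> (\<Sum>n<m. (1 ^ n * norm (a h n))\<^sup>2)) (at_left 1)"
    by (intro tendsto_intros)
  then have "(\<Sum>n<m. (1 ^ n * norm (a h n))\<^sup>2) \<le> (M * norm h)\<^sup>2"
  proof (rule tendsto_upperbound)
    show "\<forall>\<^sub>F r in at_left 1. (\<Sum>n<m. (r ^ n * norm (a h n))\<^sup>2) \<le> (M * norm h)\<^sup>2"
      by (rule eventually_at_leftI[of 0]) (auto intro: le)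
  qed simp
  then show "(\<Sum>n<m. (norm (a h n))\<^sup>2) \<le> (M * norm h)\<^sup>2" by simp
qed

text \<open>
  Describing symbols by their Taylor coefficients instead of differentiability makes it immediate that
  Redheffer images and the reflections \<open>z \<mapsto> F(cnj z)\<^sup>*\<close> are again symbols.
\<close>

definition multiplier :: "(complex \<Rightarrow> 'u::chilbert_space \<Rightarrow>\<^sub>L 'y::chilbert_space) \<Rightarrow> bool"
  where "multiplier F \<longleftrightarrow> (\<exists>P. disc_coeffs F P) \<and> (\<exists>M\<ge>0. \<forall>z\<in>\<bbbD>. norm (F z) \<le> M)"

lemma Hinf_multiplier: "F \<in> Hinf \<Longrightarrow> multiplier F"
  unfolding multiplier_def using Hinf_disc_coeffs Hinf_bound by blast

text \<open>The coefficient bound puts the product into the domain of \<open>Hardy\<close> and makes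
  the map bounded linear. Only then do \<open>Hardy\<close> and \<open>Blinfun\<close> in
  \<open>mult_op\<close> return what they were given.\<close>

lemma
  fixes F :: "complex \<Rightarrow> 'u::chilbert_space \<Rightarrow>\<^sub>L 'y::chilbert_space"
  assumes F: "multiplier F"
  shows hardy_apply_mult_op: "z \<in> \<bbbD> \<Longrightarrow> hardy_apply (mult_op F h) z = F z (hardy_apply h z)"
    and hardy_coeff_mult_op:
      "disc_coeffs F P \<Longrightarrow> hardy_coeff (mult_op F h) n = (\<Sum>j\<le>n. P j (hardy_coeff h (n - j)))"
    and norm_mult_op_le: "0 \<le> M \<Longrightarrow> (\<And>z. z \<in> \<bbbD> \<Longrightarrow> norm (F z) \<le> M) \<Longrightarrow> norm (mult_op F) \<le> M"
    and clinear_mult_op: "clinear (mult_op F)"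
proof -
  define u where "u h = Hardy (\<lambda>z. if z \<in> \<bbbD> then F z (hardy_apply h z) else 0)" for h
  define a where "a P h n = (\<Sum>j\<le>n. P j (hardy_coeff h (n - j)))"
    for P :: "nat \<Rightarrow> 'u \<Rightarrow>\<^sub>L 'y" and h n
  have coeff: "hardy_coeff (u h) = a P h \<and> norm (u h) \<le> M * norm h"
    if P: "disc_coeffs F P" and M: "0 \<le> M" "\<And>z. z \<in> \<bbbD> \<Longrightarrow> norm (F z) \<le> M" for P M h
  proof -
    have bound: "(\<Sum>n<m. (norm (a P h n))\<^sup>2) \<le> (M * norm h)\<^sup>2" for m
      unfolding a_def by (rule convolution_bound(2)[OF P M(1)]) (rule M(2))
    have l2: "l2seq (a P h)" unfolding l2seq_def
      by (rule summableI_nonneg_bounded[OF _ bound]) simp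
    have "hardy_series (a P h) z = F z (hardy_apply h z)" if "z \<in> \<bbbD>" for z
      using sums_unique[OF cauchy_product_sums[OF P that hardy_coeff(1)[of h]]] that
      unfolding hardy_series_def[of "a P h"] a_def hardy_coeff(2) by simp
    then have "u h = Hardy (hardy_series (a P h))"
      unfolding u_def by (intro arg_cong[of _ _ Hardy] ext) (auto simp: hardy_series_def)
    then have c: "hardy_coeff (u h) = a P h" by (simp add: hardy_coeff_Hardy l2)
    have "(norm (u h))\<^sup>2 \<le> (M * norm h)\<^sup>2"
      using norm_hardy2_sums[of "u h"] bound unfolding c sums_def
      by (intro LIMSEQ_le_const2) auto
    then have "norm (u h) \<le> M * norm h"
      by (rule power2_le_imp_le) (rule mult_nonneg_nonneg[OF M(1) norm_ge_zero])
    with c show ?thesis by (rule conjI)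
  qed
  obtain P0 where P0: "disc_coeffs F P0" using F unfolding multiplier_def by auto
  obtain M0 where M0: "0 \<le> M0" "\<And>z. z \<in> \<bbbD> \<Longrightarrow> norm (F z) \<le> M0" using F unfolding multiplier_def by auto
  have P0_lin: "P0 j (c *\<^sub>C x) = c *\<^sub>C P0 j x" for j c x
    using P0 unfolding disc_coeffs_def by (auto intro: clinearD)
  have c0: "hardy_coeff (u h) = a P0 h" and n0: "norm (u h) \<le> M0 * norm h" for h
    using coeff[OF P0 M0(1), of h] M0(2) by auto
  have u_scale: "u (c *\<^sub>C h) = c *\<^sub>C u h" for c h
    by (rule hardy2_eqI) (simp add: c0 a_def hardy_coeff_simps P0_lin scaleC_sum_right)
  have "bounded_linear u"
  proof (rule bounded_linear_intro[where K = M0])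
    show "u (h + k) = u h + u k" for h k
      by (rule hardy2_eqI) (simp add: c0 a_def hardy_coeff_simps blinfun.add_right sum.distrib)
    show "u (r *\<^sub>R h) = r *\<^sub>R u h" for r h
      using u_scale[of "complex_of_real r" h] by (simp add: scaleC_of_real)
    show "norm (u h) \<le> norm h * M0" for h using n0[of h] by (simp add: mult.commute)
  qed
  then have app: "mult_op F h = u h" for h
    unfolding mult_op_def u_def by (rule bounded_linear_Blinfun_apply[THEN fun_cong])
  show "clinear (mult_op F)" unfolding clinear_def app by (simp add: u_scale)
  show "hardy_coeff (mult_op F h) n = (\<Sum>j\<le>n. P j (hardy_coeff h (n - j)))" if "disc_coeffs F P"
    unfolding app using coeff[OF that M0(1), of h] M0(2) by (auto simp: a_def)
  show "norm (mult_op F) \<le> M" if "0 \<le> M" "\<And>z. z \<in> \<bbbD> \<Longrightarrow> norm (F z) \<le> M"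
    by (rule norm_blinfun_bound[OF that(1)]) (use coeff[OF P0 that(1)] that(2) app in auto)
  show "hardy_apply (mult_op F h) z = F z (hardy_apply h z)" if "z \<in> \<bbbD>"
  proof (rule sums_unique2)
    show "(\<lambda>n. z ^ n *\<^sub>C hardy_coeff (u h) n) sums hardy_apply (mult_op F h) z"
      unfolding app by (rule hardy_apply_sums[OF that])
    show "(\<lambda>n. z ^ n *\<^sub>C hardy_coeff (u h) n) sums F z (hardy_apply h z)"
      unfolding c0 a_def using cauchy_product_sums[OF P0 that hardy_coeff(1)[of h]]
      by (simp add: hardy_coeff(2))
  qed
qed

lemma multiplier_clinear:
  assumes "multiplier F" and z: "z \<in> \<bbbD>" shows "clinear (F z)"
  unfolding clinear_def
proof (intro allI)
  fix c x
  obtain P where P: "disc_coeffs F P" using assms(1) unfolding multiplier_def by auto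
  then have s: "(\<lambda>n. z ^ n *\<^sub>C P n x) sums F z x" for x using z unfolding disc_coeffs_def by auto
  have "(\<lambda>n. c *\<^sub>C z ^ n *\<^sub>C P n x) sums (c *\<^sub>C F z x)"
    by (rule bounded_linear.sums[OF bounded_linear_scaleC s])
  moreover have "c *\<^sub>C z ^ n *\<^sub>C P n x = z ^ n *\<^sub>C P n (c *\<^sub>C x)" for n
    using P unfolding disc_coeffs_def by (simp add: clinearD scaleC_scaleC mult.commute)
  ultimately show "F z (c *\<^sub>C x) = c *\<^sub>C F z x"
    using sums_unique2[OF s] by simp
qed

lemma norm_hardy_coeff_le: "norm (hardy_coeff f n) \<le> norm f"
proof -
  have "(norm (hardy_coeff f n))\<^sup>2 \<le> (norm f)\<^sup>2"
    using sum_le_suminf[OF summable_norm_hardy_coeff, of "{n}" f] sums_unique[OF norm_hardy2_sums[of f]]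
    by simp
  then show ?thesis by (rule power2_le_imp_le) simp
qed

lemma l2seq_finite: "l2seq (\<lambda>n. if n < N then a n else 0)"
  unfolding l2seq_def by (rule summable_finite[of "{..<N}"]) auto

subsection \<open>Isometric multiplication operators\<close>

definition trunc :: "nat \<Rightarrow> 'a::chilbert_space hardy2 \<Rightarrow> 'a hardy2"
  where "trunc N h = Hardy (hardy_series (\<lambda>n. if n < N then hardy_coeff h n else 0))"

text \<open>Truncation followed by reversal: \<open>N - Suc n\<close> permutes the indices below
  \<open>N\<close>.\<close>

definition flip :: "nat \<Rightarrow> 'a::chilbert_space hardy2 \<Rightarrow> 'a hardy2"
  where "flip N h = Hardy (hardy_series (\<lambda>n. if n < N then hardy_coeff h (N - Suc n) else 0))"

lemma hardy_coeff_trunc: "hardy_coeff (trunc N h) = (\<lambda>n. if n < N then hardy_coeff h n else 0)"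
  unfolding trunc_def by (rule hardy_coeff_Hardy[OF l2seq_finite])

lemma hardy_coeff_flip: "hardy_coeff (flip N h) = (\<lambda>n. if n < N then hardy_coeff h (N - Suc n) else 0)"
  unfolding flip_def by (rule hardy_coeff_Hardy[OF l2seq_finite])

lemma norm_trunc: "(norm (trunc N h))\<^sup>2 = (\<Sum>n<N. (norm (hardy_coeff h n))\<^sup>2)"
proof (rule sums_unique2[OF norm_hardy2_sums])
  have "(\<lambda>n. (norm (hardy_coeff (trunc N h) n))\<^sup>2) sums (\<Sum>n<N. (norm (hardy_coeff (trunc N h) n))\<^sup>2)"
    by (rule sums_finite) (auto simp: hardy_coeff_trunc)
  then show "(\<lambda>n. (norm (hardy_coeff (trunc N h) n))\<^sup>2) sums (\<Sum>n<N. (norm (hardy_coeff h n))\<^sup>2)"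
    by (simp add: hardy_coeff_trunc)
qed

lemma norm_flip: "norm (flip N h) = norm (trunc N h)"
proof -
  have "(norm (flip N h))\<^sup>2 = (\<Sum>n<N. (norm (hardy_coeff h (N - Suc n)))\<^sup>2)"
  proof (rule sums_unique2[OF norm_hardy2_sums])
    have "(\<lambda>n. (norm (hardy_coeff (flip N h) n))\<^sup>2) sums (\<Sum>n<N. (norm (hardy_coeff (flip N h) n))\<^sup>2)"
      by (rule sums_finite) (auto simp: hardy_coeff_flip)
    then show "(\<lambda>n. (norm (hardy_coeff (flip N h) n))\<^sup>2) sums (\<Sum>n<N. (norm (hardy_coeff h (N - Suc n)))\<^sup>2)"
      by (simp add: hardy_coeff_flip)
  qed
  also have "\<dots> = (norm (trunc N h))\<^sup>2"
    unfolding norm_trunc by (rule sum.nat_diff_reindex)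
  finally show ?thesis by (rule power2_eq_imp_eq) simp_all
qed

lemma norm_trunc_limit: "(\<lambda>N. (norm (trunc N h))\<^sup>2) \<longlonglongrightarrow> (norm h)\<^sup>2"
  unfolding norm_trunc using norm_hardy2_sums[of h] unfolding sums_def .

lemma norm_trunc_le: "norm (trunc N h) \<le> norm h"
proof (rule power2_le_imp_le)
  show "(norm (trunc N h))\<^sup>2 \<le> (norm h)\<^sup>2"
    unfolding norm_trunc
    using sum_le_suminf[OF summable_norm_hardy_coeff, of "{..<N}" h] sums_unique[OF norm_hardy2_sums[of h]]
    by simp
qed simp

lemma trunc_limit: "(\<lambda>N. trunc N h) \<longlonglongrightarrow> h"
proof -
  have eq: "(norm (h - trunc N h))\<^sup>2 = (norm h)\<^sup>2 - (norm (trunc N h))\<^sup>2" for N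
  proof (rule sums_unique2[OF norm_hardy2_sums])
    show "(\<lambda>n. (norm (hardy_coeff (h - trunc N h) n))\<^sup>2) sums ((norm h)\<^sup>2 - (norm (trunc N h))\<^sup>2)"
      using sums_diff[OF norm_hardy2_sums[of h] norm_hardy2_sums[of "trunc N h"]]
      by (rule sums_cong[THEN iffD1, rotated]) (simp add: hardy_coeff_simps hardy_coeff_trunc)
  qed
  have "(\<lambda>N. (norm h)\<^sup>2 - (norm (trunc N h))\<^sup>2) \<longlonglongrightarrow> (norm h)\<^sup>2 - (norm h)\<^sup>2"
    by (intro tendsto_diff tendsto_const norm_trunc_limit)
  then have "(\<lambda>N. (norm (h - trunc N h))\<^sup>2) \<longlonglongrightarrow> 0" unfolding eq by simp
  from tendsto_real_sqrt[OF this] have "(\<lambda>N. norm (h - trunc N h)) \<longlonglongrightarrow> 0" by simp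
  then have "(\<lambda>N. norm (trunc N h - h)) \<longlonglongrightarrow> 0" by (simp add: norm_minus_commute)
  then show ?thesis by (simp add: tendsto_norm_zero_iff LIM_zero_iff)
qed

text \<open>The operator is a contraction, so a lower bound on the dense set of polynomials
  suffices. There the boundary function is continuous, and the limit of the scalar functions
  \<open>f k\<close> is its squared norm, because \<open>V\<close> preserves norms; dominated
  convergence does the rest.\<close>

lemma isometric_mult_op:
  fixes \<Phi> :: "complex \<Rightarrow> 'u::chilbert_space \<Rightarrow>\<^sub>L 'y::chilbert_space" and s :: int and r :: "nat \<Rightarrow> real"
  assumes \<Phi>: "multiplier \<Phi>" "\<And>z. z \<in> \<bbbD> \<Longrightarrow> norm (\<Phi> z) \<le> 1" and s: "s \<noteq> 0"
    and r: "\<And>k. 0 \<le> r k" "\<And>k. r k < 1" "r \<longlonglongrightarrow> 1"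
    and bdry: "AE t in lebesgue_on {0..2*pi}. \<exists>V :: 'u \<Rightarrow>\<^sub>L 'y.
      (\<forall>x. norm (V x) = norm x) \<and> (\<forall>x. (\<lambda>k. \<Phi> (circ s (r k) t) x) \<longlonglongrightarrow> V x)"
  shows "norm (mult_op \<Phi> h) = norm h"
proof -
  let ?M = "lebesgue_on {0..2*pi}" and ?T = "mult_op \<Phi>"
  have T_le: "norm (?T g) \<le> norm g" for g
    by (rule norm_blinfun_le[OF norm_mult_op_le[OF \<Phi>(1)]]) (use \<Phi>(2) in auto)
  have iso: "norm (trunc N g) \<le> norm (?T (trunc N g))" for N g
  proof -
    define b where "b = hardy_coeff g"
    define a where "a = hardy_coeff (?T (trunc N g))"
    define p where "p z = (\<Sum>n<N. z ^ n *\<^sub>C b n)" for z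
    define C where "C = (\<Sum>n<N. norm (b n))\<^sup>2"
    define f where "f k t = (norm (\<Sum>n. circ s (r k) t ^ n *\<^sub>C a n))\<^sup>2" for k t
    have p_apply: "hardy_apply (trunc N g) z = p z" if "z \<in> \<bbbD>" for z
    proof (rule sums_unique2[OF hardy_apply_sums[OF that]])
      have "(\<lambda>n. z ^ n *\<^sub>C hardy_coeff (trunc N g) n) sums (\<Sum>n<N. z ^ n *\<^sub>C hardy_coeff (trunc N g) n)"
        by (rule sums_finite) (auto simp: hardy_coeff_trunc)
      then show "(\<lambda>n. z ^ n *\<^sub>C hardy_coeff (trunc N g) n) sums p z"
        by (simp add: hardy_coeff_trunc p_def b_def)
    qed
    have sa: "summable (\<lambda>n. r k ^ n * norm (a n))" for k
    proof (rule summable_circ[OF r(1,2)])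
      show "norm (a n) \<le> real (Suc n) * norm (?T (trunc N g))" for n
        unfolding a_def using norm_hardy_coeff_le[of "?T (trunc N g)" n]
          mult_right_mono[of 1 "real (Suc n)" "norm (?T (trunc N g))"] by simp
    qed
    note int_f = integrable_parseval[OF s r(1) sa] and pars_f = parseval[OF s r(1) sa]
    have f_eq: "f k t = (norm (\<Phi> (circ s (r k) t) (p (circ s (r k) t))))\<^sup>2" for k t
    proof -
      have D: "circ s (r k) t \<in> \<bbbD>" by (rule circ_in_disc[OF r(1,2)])
      have "(\<Sum>n. circ s (r k) t ^ n *\<^sub>C a n) = hardy_apply (?T (trunc N g)) (circ s (r k) t)"
        unfolding a_def by (rule sums_unique[OF hardy_apply_sums[OF D], symmetric])
      then show ?thesis by (simp only: f_def hardy_apply_mult_op[OF \<Phi>(1) D] p_apply[OF D])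
    qed
    have f_bound: "norm (f k t) \<le> C" for k t
    proof -
      have D: "circ s (r k) t \<in> \<bbbD>" by (rule circ_in_disc[OF r(1,2)])
      have "norm (\<Phi> (circ s (r k) t) (p (circ s (r k) t))) \<le> norm (p (circ s (r k) t))"
        by (rule norm_blinfun_le[OF \<Phi>(2)[OF D]])
      also have "\<dots> \<le> (\<Sum>n<N. norm (b n))"
        unfolding p_def
      proof (rule sum_norm_le)
        show "norm (circ s (r k) t ^ n *\<^sub>C b n) \<le> norm (b n)" for n
          using r(1)[of k] r(2)[of k]
          by (simp add: norm_scaleC norm_power norm_mult mult_left_le_one_le power_le_one less_imp_le)
      qed
      finally show ?thesis unfolding f_eq C_def by (simp add: power_mono)
    qed
    have lim: "AE t in ?M. (\<lambda>k. f k t) \<longlonglongrightarrow> (norm (p (cis (of_int s * t))))\<^sup>2"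
      using bdry
    proof eventually_elim
      case (elim t)
      then obtain V :: "'u \<Rightarrow>\<^sub>L 'y" where V: "\<And>x. norm (V x) = norm x"
        "\<And>x. (\<lambda>k. \<Phi> (circ s (r k) t) x) \<longlonglongrightarrow> V x" by blast
      \<comment> \<open>Complex linearity of \<open>V\<close> is inherited from the values of \<Phi>
        along the radius.\<close>
      have Vc: "V (c *\<^sub>C x) = c *\<^sub>C V x" for c x
      proof (rule LIMSEQ_unique[OF V(2)])
        show "(\<lambda>k. \<Phi> (circ s (r k) t) (c *\<^sub>C x)) \<longlonglongrightarrow> c *\<^sub>C V x"
          unfolding clinearD[OF multiplier_clinear[OF \<Phi>(1) circ_in_disc[OF r(1,2)]]]
          by (intro bounded_linear.tendsto[OF bounded_linear_scaleC] V(2))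
      qed
      define z where "z k = circ s (r k) t" for k
      define \<zeta> where "\<zeta> = cis (of_int s * t)"
      have z: "z \<longlonglongrightarrow> \<zeta>"
        using tendsto_mult[OF tendsto_of_real[OF r(3)] tendsto_const[of \<zeta>]] by (simp add: z_def[abs_def] \<zeta>_def)
      have "(\<lambda>k. \<Phi> (z k) (p (z k))) \<longlonglongrightarrow> V (p \<zeta>)"
      proof -
        have "(\<lambda>k. \<Sum>n<N. z k ^ n *\<^sub>C \<Phi> (z k) (b n)) \<longlonglongrightarrow> (\<Sum>n<N. \<zeta> ^ n *\<^sub>C V (b n))"
        proof (rule tendsto_sum)
          fix n
          have "bounded_bilinear (\<lambda>(c::complex) (x::'y). c *\<^sub>C x)"
            by (rule bounded_bilinear.intro)
              (auto simp: scaleC_add_left scaleC_add_right norm_scaleC scaleR_conv_of_real scaleC_scaleC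
                mult.commute intro!: exI[of _ 1] simp flip: scaleC_of_real)
          then show "(\<lambda>k. z k ^ n *\<^sub>C \<Phi> (z k) (b n)) \<longlonglongrightarrow> \<zeta> ^ n *\<^sub>C V (b n)"
            by (rule bounded_bilinear.tendsto) (intro tendsto_power z, unfold z_def, rule V(2))
        qed
        moreover have "\<Phi> (z k) (p (z k)) = (\<Sum>n<N. z k ^ n *\<^sub>C \<Phi> (z k) (b n))" for k
        proof -
          have "clinear (\<Phi> (z k))"
            unfolding z_def by (rule multiplier_clinear[OF \<Phi>(1) circ_in_disc[OF r(1,2)]])
          then show ?thesis by (simp add: p_def blinfun.sum_right clinearD)
        qed
        moreover have "V (p \<zeta>) = (\<Sum>n<N. \<zeta> ^ n *\<^sub>C V (b n))"
          by (simp add: p_def blinfun.sum_right Vc)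
        ultimately show ?thesis by simp
      qed
      from tendsto_power[OF tendsto_norm[OF this], of 2] show ?case
        unfolding f_eq V(1) z_def \<zeta>_def .
    qed
    have meas: "(\<lambda>t. (norm (p (cis (of_int s * t))))\<^sup>2) \<in> borel_measurable ?M"
      using continuous_imp_measurable_on_sets_lebesgue[OF continuous_circ_sum[where r = 1 and N = N and s = s and a = b]]
      by (simp add: p_def)
    have "(\<lambda>k. integral\<^sup>L ?M (f k)) \<longlonglongrightarrow> integral\<^sup>L ?M (\<lambda>t. (norm (p (cis (of_int s * t))))\<^sup>2)"
    proof (rule integral_dominated_convergence[OF meas _ _ lim])
      show "f k \<in> borel_measurable ?M" for k using int_f[of k] by (simp add: f_def[abs_def])
      show "integrable ?M (\<lambda>t. C)" by (intro continuous_imp_integrable_real continuous_intros)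
      show "AE t in ?M. norm (f k t) \<le> C" for k by (rule AE_I2) (rule f_bound)
    qed
    moreover have "integral\<^sup>L ?M (\<lambda>t. (norm (p (cis (of_int s * t))))\<^sup>2) = 2 * pi * (norm (trunc N g))\<^sup>2"
      using parseval_sum[OF s, where r = 1 and N = N and a = b] by (simp add: p_def norm_trunc b_def)
    \<comment> \<open>Replacing the radius \<open>r k\<close> by 1 only enlarges the coefficient
      sum, which is the direction needed.\<close>
    moreover have "integral\<^sup>L ?M (f k) \<le> 2 * pi * (norm (?T (trunc N g)))\<^sup>2" for k
    proof (rule sums_le[OF _ _ sums_mult[OF norm_hardy2_sums]])
      show "(\<lambda>n. 2 * pi * (r k ^ n * norm (a n))\<^sup>2) sums integral\<^sup>L ?M (f k)"
        using pars_f[of k] by (simp add: f_def[abs_def])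
      show "2 * pi * (r k ^ n * norm (a n))\<^sup>2 \<le> 2 * pi * (norm (hardy_coeff (?T (trunc N g)) n))\<^sup>2" for n
        unfolding a_def using r(1)[of k] r(2)[of k]
        by (intro mult_left_mono power_mono mult_left_le_one_le) (auto intro: power_le_one less_imp_le)
    qed
    ultimately have "2 * pi * (norm (trunc N g))\<^sup>2 \<le> 2 * pi * (norm (?T (trunc N g)))\<^sup>2"
      by (intro LIMSEQ_le_const2[of _ "2 * pi * (norm (trunc N g))\<^sup>2"]) auto
    then have "(norm (trunc N g))\<^sup>2 \<le> (norm (?T (trunc N g)))\<^sup>2" by simp
    then show ?thesis by (rule power2_le_imp_le) simp
  qed
  have "norm h \<le> norm (?T h)"
  proof (rule LIMSEQ_le)
    show "(\<lambda>N. norm (trunc N h)) \<longlonglongrightarrow> norm h" by (intro tendsto_norm trunc_limit)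
    show "(\<lambda>N. norm (?T (trunc N h))) \<longlonglongrightarrow> norm (?T h)"
      by (intro tendsto_norm blinfun.tendsto tendsto_const trunc_limit)
  qed (use iso in blast)
  with T_le show ?thesis by (rule order_antisym)
qed

subsection \<open>Reflection of the symbol\<close>

text \<open>Conjugating the argument compensates for the antilinearity of the adjoint, so
  analyticity is kept and Taylor coefficients pass to their adjoints.\<close>

definition reflect ::
    "(complex \<Rightarrow> 'u::chilbert_space \<Rightarrow>\<^sub>L 'y::chilbert_space) \<Rightarrow> complex \<Rightarrow> 'y \<Rightarrow>\<^sub>L 'u"
  where "reflect F z = adj (F (cnj z))"

lemma cnj_in_disc: "z \<in> \<bbbD> \<Longrightarrow> cnj z \<in> \<bbbD>"
  by (simp add: dist_norm)

lemma disc_coeffs_clinear: "disc_coeffs F P \<Longrightarrow> clinear (P n)"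
  by (simp add: disc_coeffs_def)

lemma disc_coeffs_reflect:
  assumes F: "multiplier F" and P: "disc_coeffs F P"
  shows "disc_coeffs (reflect F) (\<lambda>n. adj (P n))"
proof -
  obtain L where L: "\<And>n. norm (P n) \<le> L" using P unfolding disc_coeffs_def by auto
  note Pc = disc_coeffs_clinear[OF P]
  have L': "norm (adj (P n)) \<le> L" for n by (simp add: norm_adj Pc L)
  have "(\<lambda>n. z ^ n *\<^sub>C adj (P n) y) sums reflect F z y" if z: "z \<in> \<bbbD>" for z y
  proof (rule weak_sums)
    have "norm (adj (P n) y) \<le> L * norm y" for n
      using norm_blinfun[of "adj (P n)" y] mult_right_mono[OF L'[of n] norm_ge_zero[of y]] by (rule order_trans)
    then show "summable (\<lambda>n. z ^ n *\<^sub>C adj (P n) y)" by (rule summable_disc[OF z])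
    fix x
    have "(\<lambda>n. cnj z ^ n *\<^sub>C P n x) sums F (cnj z) x"
      using P cnj_in_disc[OF z] unfolding disc_coeffs_def by blast
    from bounded_linear.sums[OF bounded_linear_cinner_right this, of y]
    show "(\<lambda>n. cinner (z ^ n *\<^sub>C adj (P n) y) x) sums cinner (reflect F z y) x"
      by (simp add: cinner_scaleC_left cinner_scaleC_right cinner_adj_left Pc reflect_def
          multiplier_clinear[OF F cnj_in_disc[OF z]])
  qed
  then show ?thesis unfolding disc_coeffs_def using L' clinear_adj[OF Pc] by blast
qed

lemma norm_reflect: "multiplier F \<Longrightarrow> z \<in> \<bbbD> \<Longrightarrow> norm (reflect F z) = norm (F (cnj z))"
  unfolding reflect_def by (rule norm_adj[OF multiplier_clinear[OF _ cnj_in_disc]])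

lemma multiplier_reflect:
  assumes F: "multiplier F" shows "multiplier (reflect F)"
proof -
  obtain P where P: "disc_coeffs F P" using F unfolding multiplier_def by auto
  obtain M where M: "M \<ge> 0" "\<And>z. z \<in> \<bbbD> \<Longrightarrow> norm (F z) \<le> M" using F unfolding multiplier_def by auto
  have "\<forall>z\<in>\<bbbD>. norm (reflect F z) \<le> M"
    using M(2)[OF cnj_in_disc] norm_reflect[OF F] by simp
  then show ?thesis unfolding multiplier_def using disc_coeffs_reflect[OF F P] M(1) by blast
qed

lemma cinner_trunc: "cinner f (trunc N k) = (\<Sum>n<N. cinner (hardy_coeff f n) (hardy_coeff k n))"
proof -
  have "cinner f (trunc N k) = (\<Sum>n. if n < N then cinner (hardy_coeff f n) (hardy_coeff k n) else 0)"
    unfolding cinner_hardy2_def hardy_coeff_trunc by (intro suminf_cong) simp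
  also have "\<dots> = (\<Sum>n<N. if n < N then cinner (hardy_coeff f n) (hardy_coeff k n) else 0)"
    by (rule suminf_finite) auto
  finally show ?thesis by simp
qed

lemma cinner_flip: "cinner (flip N h) g = (\<Sum>n<N. cinner (hardy_coeff h (N - Suc n)) (hardy_coeff g n))"
proof -
  have "cinner (flip N h) g = (\<Sum>n. if n < N then cinner (hardy_coeff h (N - Suc n)) (hardy_coeff g n) else 0)"
    unfolding cinner_hardy2_def hardy_coeff_flip by (intro suminf_cong) simp
  also have "\<dots> = (\<Sum>n<N. if n < N then cinner (hardy_coeff h (N - Suc n)) (hardy_coeff g n) else 0)"
    by (rule suminf_finite) auto
  finally show ?thesis by simp
qed

text \<open>
  Finite sections of a lower triangular block Toeplitz matrix turn into those of the reflected
  symbol when the adjoint is conjugated by the reversal of coordinates.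
\<close>

lemma cinner_mult_op_reflect:
  assumes F: "multiplier F"
  shows "cinner (mult_op (reflect F) h) (trunc N k) = cinner (flip N h) (mult_op F (flip N k))"
proof -
  obtain P where P: "disc_coeffs F P" using F unfolding multiplier_def by auto
  let ?h = "hardy_coeff h" and ?k = "hardy_coeff k"
  have "cinner (mult_op (reflect F) h) (trunc N k) = (\<Sum>n<N. \<Sum>j\<le>n. cinner (?h (n - j)) (P j (?k n)))"
    unfolding cinner_trunc hardy_coeff_mult_op[OF multiplier_reflect[OF F] disc_coeffs_reflect[OF F P]]
    by (simp add: cinner_sum_left cinner_adj_left[OF disc_coeffs_clinear[OF P]])
  also have "\<dots> = (\<Sum>n<N. \<Sum>j\<le>n. cinner (?h (n - j)) (P j (?k ((n - j) + j))))"
    by (intro sum.cong refl) simp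
  also have "\<dots> = (\<Sum>i<N. \<Sum>j<N - i. cinner (?h i) (P j (?k (i + j))))"
    by (rule sum_triangle[where g = "\<lambda>j i. cinner (?h i) (P j (?k (i + j)))"])
  also have "\<dots> = (\<Sum>i<N. \<Sum>j\<le>N - Suc i. cinner (?h i) (P j (?k (N - Suc (N - Suc i - j)))))"
  proof (intro sum.cong)
    fix i assume "i \<in> {..<N}"
    then show "{..<N - i} = {..N - Suc i}" by auto
    fix j assume "j \<in> {..N - Suc i}"
    then have "N - Suc (N - Suc i - j) = i + j" using \<open>i \<in> _\<close> by auto
    then show "cinner (?h i) (P j (?k (i + j))) = cinner (?h i) (P j (?k (N - Suc (N - Suc i - j))))"
      by simp
  qed simp
  also have "\<dots> = (\<Sum>i<N. \<Sum>j\<le>N - Suc i. cinner (?h (N - Suc (N - Suc i))) (P j (?k (N - Suc (N - Suc i - j)))))"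
    by (intro sum.cong refl) (simp add: Suc_diff_Suc)
  also have "\<dots> = (\<Sum>n<N. \<Sum>j\<le>n. cinner (?h (N - Suc n)) (P j (?k (N - Suc (n - j)))))"
    by (rule sum.nat_diff_reindex[where g = "\<lambda>n. \<Sum>j\<le>n. cinner (?h (N - Suc n)) (P j (?k (N - Suc (n - j))))"])
  also have "\<dots> = cinner (flip N h) (mult_op F (flip N k))"
    unfolding cinner_flip hardy_coeff_mult_op[OF F P]
    by (intro sum.cong refl) (auto simp: cinner_sum_right hardy_coeff_flip intro!: sum.cong)
  finally show ?thesis .
qed

text \<open>Inequalities rather than equalities, because multiplication pushes
  \<open>flip N k\<close> beyond the first \<open>N\<close> coordinates, which test vectors
  \<open>flip N y\<close> do not see. The direction is the useful one: flipped vectors have the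
  smaller defects.\<close>

lemma norm_mult_op_reflect_le:
  assumes F: "multiplier F"
  shows "norm (adj (mult_op (reflect F)) (trunc N k)) \<le> norm (mult_op F (flip N k))"
    and "norm (trunc N (mult_op (reflect F) h)) \<le> norm (adj (mult_op F) (flip N h))"
proof -
  note cl = clinear_mult_op[OF F] clinear_mult_op[OF multiplier_reflect[OF F]]
  show "norm (adj (mult_op (reflect F)) (trunc N k)) \<le> norm (mult_op F (flip N k))"
  proof (rule norm_le_by_cinner)
    fix y
    have "cinner y (adj (mult_op (reflect F)) (trunc N k)) = cinner (flip N y) (mult_op F (flip N k))"
      by (simp add: cinner_adj_right[OF cl(2)] cinner_mult_op_reflect[OF F])
    moreover have "cmod (cinner (flip N y) (mult_op F (flip N k))) \<le> norm (mult_op F (flip N k)) * norm y"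
      using cinner_Cauchy_Schwarz[of "flip N y" "mult_op F (flip N k)"]
        mult_right_mono[of "norm (flip N y)" "norm y" "norm (mult_op F (flip N k))"] norm_trunc_le[of N y]
      by (simp add: norm_flip mult.commute)
    ultimately show "cmod (cinner (adj (mult_op (reflect F)) (trunc N k)) y) \<le> norm (mult_op F (flip N k)) * norm y"
      by (metis cinner_commute complex_mod_cnj)
  qed simp
  let ?g = "mult_op (reflect F) h"
  have "cinner (trunc N ?g) (trunc N ?g) = cinner ?g (trunc N ?g)"
    unfolding cinner_trunc by (simp add: hardy_coeff_trunc)
  also have "\<dots> = cinner (adj (mult_op F) (flip N h)) (flip N ?g)"
    by (simp add: cinner_mult_op_reflect[OF F] cinner_adj_left[OF cl(1)])
  finally have "(norm (trunc N ?g))\<^sup>2 = cmod (cinner (adj (mult_op F) (flip N h)) (flip N ?g))"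
    by (metis cinner_self norm_of_real abs_of_nonneg zero_le_power2)
  also have "\<dots> \<le> norm (adj (mult_op F) (flip N h)) * norm (trunc N ?g)"
    using cinner_Cauchy_Schwarz[of "adj (mult_op F) (flip N h)" "flip N ?g"] by (simp add: norm_flip)
  finally show "norm (trunc N ?g) \<le> norm (adj (mult_op F) (flip N h))"
    by (cases "norm (trunc N ?g) = 0") (simp_all add: power2_eq_square)
qed

text \<open>The form bound is transported at each finite level \<open>N\<close> by reversal of
  coordinates, and survives the limit because the approximate defects converge.\<close>

lemma form_prec_reflect:
  assumes F: "multiplier F" and G: "multiplier G" "\<And>z. z \<in> \<bbbD> \<Longrightarrow> norm (G z) \<le> 1"
    and prec: "form_prec (mult_op F) (mult_op G)"
  shows "form_prec (mult_op (reflect F)) (mult_op (reflect G))"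
proof -
  note G' = multiplier_reflect[OF G(1)]
  note cl = clinear_mult_op[OF F] clinear_mult_op[OF G(1)] clinear_mult_op[OF multiplier_reflect[OF F]]
    clinear_mult_op[OF G']
  have nG: "norm (mult_op G) \<le> 1" by (rule norm_mult_op_le[OF G(1)]) (use G(2) in auto)
  obtain c where c: "c \<ge> 0" "\<And>x y. cmod (cinner ((mult_op F - mult_op G) x) y)
      \<le> c * defect_norm (mult_op G) x * defect_norm (adj (mult_op G)) y"
    using prec unfolding form_prec_def by auto
  let ?D = "mult_op (reflect F) - mult_op (reflect G)"
  have "cmod (cinner (?D h) k) \<le> c * defect_norm (mult_op (reflect G)) h * defect_norm (adj (mult_op (reflect G))) k" for h k
  proof (rule LIMSEQ_le)
    \<comment> \<open>In \<open>?a\<close> only the image is truncated, in \<open>?b\<close> only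
      the argument of the adjoint. Both tend to the full defects, and at level \<open>N\<close> they
      dominate the defects of the flipped vectors.\<close>
    let ?a = "\<lambda>N. sqrt ((norm h)\<^sup>2 - (norm (trunc N (mult_op (reflect G) h)))\<^sup>2)"
    let ?b = "\<lambda>N. sqrt ((norm k)\<^sup>2 - (norm (adj (mult_op (reflect G)) (trunc N k)))\<^sup>2)"
    show "(\<lambda>N. cmod (cinner (?D h) (trunc N k))) \<longlonglongrightarrow> cmod (cinner (?D h) k)"
      by (intro tendsto_norm tendsto_cinner_right trunc_limit)
    show "(\<lambda>N. c * ?a N * ?b N) \<longlonglongrightarrow> c * defect_norm (mult_op (reflect G)) h * defect_norm (adj (mult_op (reflect G))) k"
      unfolding defect_norm_def
      by (intro tendsto_intros blinfun.tendsto trunc_limit)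
    have "cmod (cinner (?D h) (trunc N k)) \<le> c * ?a N * ?b N" for N
    proof -
      \<comment> \<open>Reversal exchanges the arguments: \<open>flip N k\<close> becomes the input
        and \<open>flip N h\<close> the test vector, so the two defects of \<open>G\<close> trade
        places.\<close>
      have "cinner (?D h) (trunc N k) = cinner (flip N h) ((mult_op F - mult_op G) (flip N k))"
        by (simp add: blinfun.diff_left cinner_diff_left cinner_diff_right cinner_mult_op_reflect F G)
      then have "cmod (cinner (?D h) (trunc N k)) = cmod (cinner ((mult_op F - mult_op G) (flip N k)) (flip N h))"
        by (metis cinner_commute complex_mod_cnj)
      also have "\<dots> \<le> c * defect_norm (mult_op G) (flip N k) * defect_norm (adj (mult_op G)) (flip N h)"
        by (rule c(2))
      also have "\<dots> \<le> c * ?b N * ?a N"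
      proof (intro mult_mono)
        have sq: "(norm (flip N u))\<^sup>2 \<le> (norm u)\<^sup>2" for u :: "'v::chilbert_space hardy2"
          by (simp add: norm_flip norm_trunc_le power_mono)
        show "defect_norm (mult_op G) (flip N k) \<le> ?b N"
          unfolding defect_norm_def
          using sq[of k] power_mono[OF norm_mult_op_reflect_le(1)[OF G(1), of N k] norm_ge_zero, of 2]
          by (intro real_sqrt_le_mono diff_mono)
        show "defect_norm (adj (mult_op G)) (flip N h) \<le> ?a N"
          unfolding defect_norm_def
          using sq[of h] power_mono[OF norm_mult_op_reflect_le(2)[OF G(1), of N h] norm_ge_zero, of 2]
          by (intro real_sqrt_le_mono diff_mono)
        show "0 \<le> c * ?b N"
          by (rule mult_nonneg_nonneg[OF c(1)])
            (rule order_trans[OF defect_norm_nonneg[OF nG] \<open>defect_norm (mult_op G) (flip N k) \<le> ?b N\<close>])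
      qed (use c(1) defect_norm_nonneg[OF nG] defect_norm_nonneg[of "adj (mult_op G)"] nG norm_adj[OF cl(2)] in auto)
      finally show ?thesis by (simp add: ac_simps)
    qed
    then show "\<exists>n. \<forall>N\<ge>n. cmod (cinner (?D h) (trunc N k)) \<le> c * ?a N * ?b N" by blast
  qed
  then show ?thesis unfolding form_prec_def using c(1) by blast
qed

lemma mult_op_cong: "(\<And>z. z \<in> \<bbbD> \<Longrightarrow> F z = G z) \<Longrightarrow> mult_op F = mult_op G"
  unfolding mult_op_def by (intro arg_cong[of _ _ Blinfun] ext arg_cong[of _ _ Hardy]) auto

lemma reflect_reflect: "multiplier F \<Longrightarrow> z \<in> \<bbbD> \<Longrightarrow> reflect (reflect F) z = F z"
  unfolding reflect_def by (simp add: adj_adj[OF multiplier_clinear])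

subsection \<open>Block operators\<close>

lemma bounded_linear_inl: "bounded_linear (\<lambda>x. (x, 0))" and bounded_linear_inr: "bounded_linear (\<lambda>y. (0, y))"
  by (intro bounded_linear_Pair bounded_linear_ident bounded_linear_zero)+

lemma bounded_linear_blocks:
  "bounded_linear (\<lambda>x. fst (A (x, 0)))" "bounded_linear (\<lambda>y. fst (A (0, y)))"
  "bounded_linear (\<lambda>x. snd (A (x, 0)))" "bounded_linear (\<lambda>y. snd (A (0, y)))"
  for A :: "('a::real_normed_vector \<times> 'b::real_normed_vector) \<Rightarrow>\<^sub>L ('c::real_normed_vector \<times> 'd::real_normed_vector)"
  by (rule bounded_linear_compose[OF bounded_linear_fst] bounded_linear_compose[OF bounded_linear_snd],
      rule bounded_linear_compose[OF blinfun.bounded_linear_right], rule bounded_linear_inl bounded_linear_inr)+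

lemma block_apply:
  "block11 A x = fst (A (x, 0))" "block12 A y = fst (A (0, y))"
  "block21 A x = snd (A (x, 0))" "block22 A y = snd (A (0, y))"
  for A :: "('a::chilbert_space \<times> 'b::chilbert_space) \<Rightarrow>\<^sub>L ('c::chilbert_space \<times> 'd::chilbert_space)"
  by (simp_all add: block11_def block12_def block21_def block22_def
      bounded_linear_Blinfun_apply bounded_linear_blocks)

lemma blocks_decompose: "A (x, y) = (block11 A x + block12 A y, block21 A x + block22 A y)"
  for A :: "('a::chilbert_space \<times> 'b::chilbert_space) \<Rightarrow>\<^sub>L ('c::chilbert_space \<times> 'd::chilbert_space)"
  using blinfun.add_right[of A "(x, 0)" "(0, y)"] by (simp add: block_apply prod_eq_iff)

lemma norm_inl [simp]: "norm (x, 0) = norm x" and norm_inr [simp]: "norm (0, y) = norm y"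
  by (simp_all add: norm_prod_def)

lemma norm_blocks_le:
  "norm (block11 A) \<le> norm A" "norm (block12 A) \<le> norm A"
  "norm (block21 A) \<le> norm A" "norm (block22 A) \<le> norm A"
proof -
  have "norm (fst (A p)) \<le> norm A * norm p" "norm (snd (A p)) \<le> norm A * norm p" for p
    using norm_blinfun[of A p] norm_fst_le[of "fst (A p)" "snd (A p)"] norm_snd_le[of "snd (A p)" "fst (A p)"]
    by simp_all
  from this[of "(_, 0)"] this[of "(0, _)"]
  show "norm (block11 A) \<le> norm A" "norm (block12 A) \<le> norm A"
    "norm (block21 A) \<le> norm A" "norm (block22 A) \<le> norm A"
    by (auto intro!: norm_blinfun_bound simp: block_apply)
qed

lemma clinear_blocks:
  assumes A: "clinear A"
  shows "clinear (block11 A)" "clinear (block12 A)" "clinear (block21 A)" "clinear (block22 A)"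
  using clinearD[OF A, of _ "(_, 0)"] clinearD[OF A, of _ "(0, _)"]
  by (simp_all add: clinear_def block_apply scaleC_prod_def)

lemma adj_blocks:
  assumes A: "clinear A"
  shows "block11 (adj A) = adj (block11 A)" "block12 (adj A) = adj (block21 A)"
    "block21 (adj A) = adj (block12 A)" "block22 (adj A) = adj (block22 A)"
proof -
  have e: "cinner (fst (A (x, y))) u + cinner (snd (A (x, y))) v
      = cinner x (fst (adj A (u, v))) + cinner y (snd (adj A (u, v)))" for x y u v
    using cinner_adj_right[OF A, of "(x, y)" "(u, v)"] by (simp add: cinner_prod_def)
  show "block11 (adj A) = adj (block11 A)"
    by (rule sym, rule adj_unique) (use e[of _ 0 _ 0] in \<open>simp add: block_apply\<close>)
  show "block12 (adj A) = adj (block21 A)"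
    by (rule sym, rule adj_unique) (use e[of _ 0 0] in \<open>simp add: block_apply\<close>)
  show "block21 (adj A) = adj (block12 A)"
    by (rule sym, rule adj_unique) (use e[of 0 _ _ 0] in \<open>simp add: block_apply\<close>)
  show "block22 (adj A) = adj (block22 A)"
    by (rule sym, rule adj_unique) (use e[of 0 _ 0] in \<open>simp add: block_apply\<close>)
qed

lemma multiplier_blocks:
  assumes \<Phi>: "multiplier \<Phi>"
  shows "multiplier (\<lambda>z. block11 (\<Phi> z))" "multiplier (\<lambda>z. block12 (\<Phi> z))"
    "multiplier (\<lambda>z. block21 (\<Phi> z))" "multiplier (\<lambda>z. block22 (\<Phi> z))"
proof -
  obtain P where P: "disc_coeffs \<Phi> P" using \<Phi> unfolding multiplier_def by auto
  obtain M where M: "M \<ge> 0" "\<And>z. z \<in> \<bbbD> \<Longrightarrow> norm (\<Phi> z) \<le> M" using \<Phi> unfolding multiplier_def by auto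
  obtain L where L: "\<And>n. norm (P n) \<le> L" using P unfolding disc_coeffs_def by auto
  have s: "(\<lambda>n. z ^ n *\<^sub>C P n x) sums \<Phi> z x" if "z \<in> \<bbbD>" for z x using P that unfolding disc_coeffs_def by blast
  note fs = bounded_linear.sums[OF bounded_linear_fst s] and sn = bounded_linear.sums[OF bounded_linear_snd s]
  note bounds = order_trans[OF norm_blocks_le(1) L] order_trans[OF norm_blocks_le(2) L]
    order_trans[OF norm_blocks_le(3) L] order_trans[OF norm_blocks_le(4) L]
    order_trans[OF norm_blocks_le(1) M(2)] order_trans[OF norm_blocks_le(2) M(2)]
    order_trans[OF norm_blocks_le(3) M(2)] order_trans[OF norm_blocks_le(4) M(2)]
  have "disc_coeffs (\<lambda>z. block11 (\<Phi> z)) (\<lambda>n. block11 (P n))" "disc_coeffs (\<lambda>z. block12 (\<Phi> z)) (\<lambda>n. block12 (P n))"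
    "disc_coeffs (\<lambda>z. block21 (\<Phi> z)) (\<lambda>n. block21 (P n))" "disc_coeffs (\<lambda>z. block22 (\<Phi> z)) (\<lambda>n. block22 (P n))"
    unfolding disc_coeffs_def
    using fs sn clinear_blocks[OF disc_coeffs_clinear[OF P]] bounds(1-4)
    by (auto simp: block_apply scaleC_prod_def)
  then show "multiplier (\<lambda>z. block11 (\<Phi> z))" "multiplier (\<lambda>z. block12 (\<Phi> z))"
    "multiplier (\<lambda>z. block21 (\<Phi> z))" "multiplier (\<lambda>z. block22 (\<Phi> z))"
    unfolding multiplier_def using M(1) bounds(5-8) by blast+
qed

section \<open>Hardy spaces of direct sums\<close>

lemma norm_prod_sq: "(norm (x, y))\<^sup>2 = (norm x)\<^sup>2 + (norm y)\<^sup>2"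
  by (simp add: norm_prod_def)

text \<open>The identification that lets multiplication by a block function act as a two by two
  matrix of multiplication operators.\<close>

definition hpair :: "'a::chilbert_space hardy2 \<Rightarrow> 'b::chilbert_space hardy2 \<Rightarrow> ('a \<times> 'b) hardy2"
  where "hpair w v = Hardy (hardy_series (\<lambda>n. (hardy_coeff w n, hardy_coeff v n)))"

lemma hardy_coeff_hpair: "hardy_coeff (hpair w v) = (\<lambda>n. (hardy_coeff w n, hardy_coeff v n))"
  unfolding hpair_def
  by (rule hardy_coeff_Hardy)
    (simp add: l2seq_def norm_prod_sq summable_add summable_norm_hardy_coeff)

lemma norm_hpair: "(norm (hpair w v))\<^sup>2 = (norm w)\<^sup>2 + (norm v)\<^sup>2"
  using sums_unique2[OF norm_hardy2_sums[of "hpair w v"], unfolded hardy_coeff_hpair norm_prod_sq]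
    sums_add[OF norm_hardy2_sums[of w] norm_hardy2_sums[of v]] by blast

lemma hardy_apply_hpair:
  assumes z: "z \<in> \<bbbD>" shows "hardy_apply (hpair w v) z = (hardy_apply w z, hardy_apply v z)"
proof -
  note s = hardy_apply_sums[OF z, of "hpair w v"]
  have "fst (hardy_apply (hpair w v) z) = hardy_apply w z"
    using bounded_linear.sums[OF bounded_linear_fst s] hardy_apply_sums[OF z, of w]
    by (simp add: hardy_coeff_hpair scaleC_prod_def sums_unique2)
  moreover have "snd (hardy_apply (hpair w v) z) = hardy_apply v z"
    using bounded_linear.sums[OF bounded_linear_snd s] hardy_apply_sums[OF z, of v]
    by (simp add: hardy_coeff_hpair scaleC_prod_def sums_unique2)
  ultimately show ?thesis by (simp add: prod_eq_iff)
qed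

lemma mult_op_hpair:
  assumes \<Phi>: "multiplier \<Phi>"
  shows "mult_op \<Phi> (hpair w v) =
    hpair (mult_op (\<lambda>z. block11 (\<Phi> z)) w + mult_op (\<lambda>z. block12 (\<Phi> z)) v)
      (mult_op (\<lambda>z. block21 (\<Phi> z)) w + mult_op (\<lambda>z. block22 (\<Phi> z)) v)"
  by (rule hardy2_apply_eqI)
    (simp add: hardy_apply_mult_op \<Phi> multiplier_blocks[OF \<Phi>] hardy_apply_hpair plus_hardy2.rep_eq
      blocks_decompose del: mem_ball)

section \<open>The Redheffer map\<close>

lemma clinear_inverse:
  fixes A :: "'a::complex_normed_vector \<Rightarrow>\<^sub>L 'b::complex_normed_vector"
  assumes A: "clinear A" and S: "S o\<^sub>L A = id_blinfun" "A o\<^sub>L S = id_blinfun"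
  shows "clinear S"
  unfolding clinear_def
proof (intro allI)
  fix c y
  have SA: "S (A x) = x" and AS: "A (S y) = y" for x y
    using arg_cong[OF S(1), of "\<lambda>Z. Z x"] arg_cong[OF S(2), of "\<lambda>Z. Z y"] by simp_all
  have "S (c *\<^sub>C A (S y)) = c *\<^sub>C S y"
    by (simp only: clinearD[OF A, symmetric] SA)
  then show "S (c *\<^sub>C y) = c *\<^sub>C S y" by (simp only: AS)
qed

text \<open>The inverse in the definition is traded for the state equation: any solution
  \<open>x\<close> computes the value of the image at \<open>u\<close>.\<close>

lemma
  fixes \<Phi> :: "complex \<Rightarrow> ('p::chilbert_space \<times> 'u::chilbert_space) \<Rightarrow>\<^sub>L ('q::chilbert_space \<times> 'y::chilbert_space)"
    and F :: "complex \<Rightarrow> 'q \<Rightarrow>\<^sub>L 'p"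
  assumes \<rho>: "norm (block11 (\<Phi> z)) \<le> \<rho>" "\<rho> < 1" and F: "norm (F z) \<le> 1"
  shows redheffer_state_exists: "\<exists>x. x = block11 (\<Phi> z) (F z x) + block12 (\<Phi> z) u"
    and redheffer_apply: "x = block11 (\<Phi> z) (F z x) + block12 (\<Phi> z) u \<Longrightarrow>
      redheffer \<Phi> F z u = block21 (\<Phi> z) (F z x) + block22 (\<Phi> z) u"
proof -
  let ?T = "block11 (\<Phi> z) o\<^sub>L F z"
  have "0 \<le> \<rho>" using \<rho>(1) norm_ge_zero order_trans by blast
  then have "norm ?T \<le> \<rho>"
    using norm_blinfun_compose[of "block11 (\<Phi> z)" "F z"] mult_mono[OF \<rho>(1) F] by simp
  then obtain S where S: "S o\<^sub>L (id_blinfun - ?T) = id_blinfun" "(id_blinfun - ?T) o\<^sub>L S = id_blinfun"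
    using inverse_id_minus \<rho>(2) by metis
  note inv = inv_op_eqI[OF S]
  have ST: "S (x - block11 (\<Phi> z) (F z x)) = x" for x
    using arg_cong[OF S(1), of "\<lambda>Z. Z x"] by (simp add: blinfun.diff_left)
  have TS: "S y - block11 (\<Phi> z) (F z (S y)) = y" for y
    using arg_cong[OF S(2), of "\<lambda>Z. Z y"] by (simp add: blinfun.diff_left)
  show "\<exists>x. x = block11 (\<Phi> z) (F z x) + block12 (\<Phi> z) u"
    using TS[of "block12 (\<Phi> z) u"] by (intro exI[of _ "S (block12 (\<Phi> z) u)"]) (simp add: diff_eq_eq add.commute)
  show "redheffer \<Phi> F z u = block21 (\<Phi> z) (F z x) + block22 (\<Phi> z) u"
    if "x = block11 (\<Phi> z) (F z x) + block12 (\<Phi> z) u"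
  proof -
    have "block12 (\<Phi> z) u = x - block11 (\<Phi> z) (F z x)" by (subst (1) that) simp
    then have "S (block12 (\<Phi> z) u) = x" using ST[of x] by (simp only:)
    then show ?thesis unfolding redheffer_def inv by (simp add: blinfun.add_left add.commute)
  qed
qed

text \<open>\<open>\<Phi> z\<close> contracts \<open>(F z x, u)\<close> to
  \<open>(x, redheffer \<Phi> F z u)\<close>, and the contraction \<open>F z\<close> lets the terms
  in \<open>x\<close> be cancelled.\<close>

lemma norm_redheffer_le:
  fixes \<Phi> :: "complex \<Rightarrow> ('p::chilbert_space \<times> 'u::chilbert_space) \<Rightarrow>\<^sub>L ('q::chilbert_space \<times> 'y::chilbert_space)"
    and F :: "complex \<Rightarrow> 'q \<Rightarrow>\<^sub>L 'p"
  assumes \<Phi>: "norm (\<Phi> z) \<le> 1" and \<rho>: "norm (block11 (\<Phi> z)) \<le> \<rho>" "\<rho> < 1" and F: "norm (F z) \<le> 1"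
  shows "norm (redheffer \<Phi> F z) \<le> 1"
proof (rule norm_blinfun_bound)
  fix u
  obtain x where x: "x = block11 (\<Phi> z) (F z x) + block12 (\<Phi> z) u"
    using redheffer_state_exists[where \<Phi> = \<Phi> and F = F and z = z, OF \<rho> F] by blast
  have "\<Phi> z (F z x, u) = (x, redheffer \<Phi> F z u)"
    using redheffer_apply[where \<Phi> = \<Phi> and F = F and z = z, OF \<rho> F x] x by (simp add: blocks_decompose)
  then have "(norm (x, redheffer \<Phi> F z u))\<^sup>2 \<le> (norm (F z x, u))\<^sup>2"
    using norm_blinfun_le[OF \<Phi>, of "(F z x, u)"] by (simp add: power_mono)
  moreover have "(norm (F z x))\<^sup>2 \<le> (norm x)\<^sup>2"
    using norm_blinfun_le[OF F] by (simp add: power_mono)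
  ultimately have "(norm (redheffer \<Phi> F z u))\<^sup>2 \<le> (norm u)\<^sup>2" unfolding norm_prod_sq by linarith
  from power2_le_imp_le[OF this norm_ge_zero] show "norm (redheffer \<Phi> F z u) \<le> 1 * norm u" by simp
qed simp

text \<open>An operator acting pointwise is multiplication by its symbol, and the Taylor
  coefficients of the symbol are read off from the images of constant functions. Redheffer images
  thereby become multipliers without any differentiation of inverses.\<close>

lemma
  fixes T :: "'u::chilbert_space hardy2 \<Rightarrow>\<^sub>L 'y::chilbert_space hardy2"
    and R :: "complex \<Rightarrow> 'u \<Rightarrow>\<^sub>L 'y"
  assumes T: "clinear T" and app: "\<And>h z. z \<in> \<bbbD> \<Longrightarrow> hardy_apply (T h) z = R z (hardy_apply h z)"
    and R: "\<And>z. z \<in> \<bbbD> \<Longrightarrow> norm (R z) \<le> 1"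
  shows mult_op_eqI: "mult_op R = T" and multiplierI: "multiplier R"
proof -
  have "Hardy (\<lambda>z. if z \<in> \<bbbD> then R z (hardy_apply h z) else 0) = T h" for h
  proof -
    have "(\<lambda>z. if z \<in> \<bbbD> then R z (hardy_apply h z) else 0) = hardy_apply (T h)"
      by (rule ext) (simp add: app hardy_apply_off_disc del: mem_ball)
    then show ?thesis by (simp only: hardy_apply_inverse)
  qed
  then show "mult_op R = T" unfolding mult_op_def by (simp only: blinfun_apply_inverse)
  define c :: "'u \<Rightarrow> 'u hardy2" where "c x = Hardy (hardy_series (\<lambda>n. if n < 1 then x else 0))" for x
  have c_coeff: "hardy_coeff (c x) = (\<lambda>n. if n < 1 then x else 0)" for x
    unfolding c_def by (rule hardy_coeff_Hardy[OF l2seq_finite])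
  have c_add: "c (x + y) = c x + c y" and c_scale: "c (k *\<^sub>C x) = k *\<^sub>C c x"
    and c_scaleR: "c (r *\<^sub>R x) = r *\<^sub>R c x" for x y k r
    by (rule hardy2_eqI, simp add: c_coeff hardy_coeff_simps)+
  have c_apply: "hardy_apply (c x) z = x" if "z \<in> \<bbbD>" for x z
  proof (rule sums_unique2[OF hardy_apply_sums[OF that]])
    have "(\<lambda>n. z ^ n *\<^sub>C hardy_coeff (c x) n) sums (\<Sum>n<1. z ^ n *\<^sub>C hardy_coeff (c x) n)"
      by (rule sums_finite) (auto simp: c_coeff)
    then show "(\<lambda>n. z ^ n *\<^sub>C hardy_coeff (c x) n) sums x" by (simp add: c_coeff)
  qed
  have c_norm: "norm (c x) = norm x" for x
  proof (rule power2_eq_imp_eq)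
    have "(\<lambda>n. (norm (hardy_coeff (c x) n))\<^sup>2) sums (\<Sum>n<1. (norm (hardy_coeff (c x) n))\<^sup>2)"
      by (rule sums_finite) (auto simp: c_coeff)
    then show "(norm (c x))\<^sup>2 = (norm x)\<^sup>2"
      using sums_unique2[OF norm_hardy2_sums[of "c x"]] by (simp add: c_coeff)
  qed simp_all
  define P where "P n = Blinfun (\<lambda>x. hardy_coeff (T (c x)) n)" for n
  have bound: "norm (hardy_coeff (T (c x)) n) \<le> norm x * norm T" for x n
    using norm_hardy_coeff_le[of "T (c x)" n] norm_blinfun[of T "c x"] by (simp add: c_norm mult.commute)
  have lin: "bounded_linear (\<lambda>x. hardy_coeff (T (c x)) n)" for n
    by (rule bounded_linear_intro[where K = "norm T"])
      (simp_all add: c_add c_scaleR blinfun.add_right blinfun.scaleR_right hardy_coeff_simps bound)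
  have P: "P n x = hardy_coeff (T (c x)) n" for n x
    unfolding P_def by (simp add: bounded_linear_Blinfun_apply[OF lin])
  have "disc_coeffs R P" unfolding disc_coeffs_def
  proof (intro conjI allI ballI)
    show "clinear (P n)" for n
      by (simp add: clinear_def P c_scale clinearD[OF T] hardy_coeff_simps)
    show "\<exists>M. \<forall>n. norm (P n) \<le> M"
      by (intro exI[of _ "norm T"] allI norm_blinfun_bound) (simp_all add: P bound mult.commute[of "norm T"])
    fix z x assume z: "z \<in> \<bbbD>"
    show "(\<lambda>n. z ^ n *\<^sub>C P n x) sums R z x"
      using hardy_apply_sums[OF z, of "T (c x)"] by (simp only: P app[OF z] c_apply[OF z])
  qed
  then show "multiplier R" unfolding multiplier_def using R by (auto intro!: exI[of _ 1])
qed

lemma schur_prec_iff: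
  assumes "multiplier F" "multiplier G" "\<And>z. z \<in> \<bbbD> \<Longrightarrow> norm (G z) \<le> 1"
  shows "F \<prec>\<^sub>\<infinity> G \<longleftrightarrow> form_prec (mult_op F) (mult_op G)"
  unfolding schur_prec_def form_prec_def
  by (rule op_prec_iff) (use assms in \<open>auto intro: clinear_mult_op norm_mult_op_le\<close>)

locale redheffer_data =
  fixes \<Phi> :: "complex \<Rightarrow> ('p::chilbert_space \<times> 'u::chilbert_space) \<Rightarrow>\<^sub>L ('q::chilbert_space \<times> 'y::chilbert_space)"
    and \<rho> :: real
  assumes multiplier_\<Phi>: "multiplier \<Phi>" and norm_\<Phi>: "z \<in> \<bbbD> \<Longrightarrow> norm (\<Phi> z) \<le> 1"
    and norm_block11: "z \<in> \<bbbD> \<Longrightarrow> norm (block11 (\<Phi> z)) \<le> \<rho>" and \<rho>: "0 \<le> \<rho>" "\<rho> < 1"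
begin

abbreviation "M11 \<equiv> mult_op (\<lambda>z. block11 (\<Phi> z))"
abbreviation "M12 \<equiv> mult_op (\<lambda>z. block12 (\<Phi> z))"
abbreviation "M21 \<equiv> mult_op (\<lambda>z. block21 (\<Phi> z))"
abbreviation "M22 \<equiv> mult_op (\<lambda>z. block22 (\<Phi> z))"

lemma clinear_M: "clinear M11" "clinear M12" "clinear M21" "clinear M22"
  by (rule clinear_mult_op multiplier_blocks[OF multiplier_\<Phi>])+

lemma norm_M11: "norm M11 \<le> \<rho>"
  by (rule norm_mult_op_le[OF multiplier_blocks(1)[OF multiplier_\<Phi>] \<rho>(1) norm_block11])

text \<open>The resolvent is formed once on the Hardy space. Evaluating its state equation at
  \<open>z\<close> gives the pointwise one, so the operator \<open>T\<close> built from it acts by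
  the Redheffer image.\<close>

lemma
  fixes F :: "complex \<Rightarrow> 'q \<Rightarrow>\<^sub>L 'p"
  assumes F: "multiplier F" "\<And>z. z \<in> \<bbbD> \<Longrightarrow> norm (F z) \<le> 1"
  shows multiplier_redheffer: "multiplier (redheffer \<Phi> F)"
    and mult_op_redheffer: "x = M11 (mult_op F x) + M12 h \<Longrightarrow>
      mult_op (redheffer \<Phi> F) h = M21 (mult_op F x) + M22 h"
proof -
  let ?A = "mult_op F"
  let ?T = "M11 o\<^sub>L ?A"
  have A: "norm ?A \<le> 1" by (rule norm_mult_op_le[OF F(1)]) (use F(2) in auto)
  have "norm ?T \<le> \<rho>"
    using norm_blinfun_compose[of M11 ?A] mult_mono[OF norm_M11 A] \<rho>(1) by simp
  then obtain S where S: "S o\<^sub>L (id_blinfun - ?T) = id_blinfun" "(id_blinfun - ?T) o\<^sub>L S = id_blinfun"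
    using inverse_id_minus \<rho>(2) by metis
  have ST: "S (x - M11 (?A x)) = x" for x
    using arg_cong[OF S(1), of "\<lambda>Z. Z x"] by (simp add: blinfun.diff_left)
  have TS: "S y = M11 (?A (S y)) + y" for y
    using arg_cong[OF S(2), of "\<lambda>Z. Z y"] by (simp add: blinfun.diff_left diff_eq_eq add.commute)
  note clA = clinear_mult_op[OF F(1)]
  have clS: "clinear S"
    by (rule clinear_inverse[OF _ S]) (intro clinear_diff clinear_compose clinear_id clinear_M clA)
  define T where "T = M22 + (M21 o\<^sub>L ?A o\<^sub>L S o\<^sub>L M12)"
  have T_apply: "T h = M21 (?A (S (M12 h))) + M22 h" for h
    unfolding T_def by (simp add: blinfun.add_left add.commute)
  have clT: "clinear T"
    unfolding T_def by (intro clinear_add clinear_compose clinear_M clA clS)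
  note ap = hardy_apply_mult_op[OF multiplier_blocks(1)[OF multiplier_\<Phi>]]
    hardy_apply_mult_op[OF multiplier_blocks(2)[OF multiplier_\<Phi>]]
    hardy_apply_mult_op[OF multiplier_blocks(3)[OF multiplier_\<Phi>]]
    hardy_apply_mult_op[OF multiplier_blocks(4)[OF multiplier_\<Phi>]] hardy_apply_mult_op[OF F(1)]
  have app: "hardy_apply (T h) z = redheffer \<Phi> F z (hardy_apply h z)" if z: "z \<in> \<bbbD>" for h z
  proof -
    let ?x = "hardy_apply (S (M12 h)) z"
    have "?x = block11 (\<Phi> z) (F z ?x) + block12 (\<Phi> z) (hardy_apply h z)"
      by (subst TS) (simp only: plus_hardy2.rep_eq ap[OF z])
    from redheffer_apply[where \<Phi> = \<Phi> and F = F and z = z, OF norm_block11[OF z] \<rho>(2) F(2)[OF z] this] show ?thesis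
      unfolding T_apply by (simp only: plus_hardy2.rep_eq ap[OF z])
  qed
  have R1: "norm (redheffer \<Phi> F z) \<le> 1" if "z \<in> \<bbbD>" for z
    by (rule norm_redheffer_le[where \<rho> = \<rho>]) (use that in \<open>auto intro: norm_\<Phi> norm_block11 \<rho> F(2)\<close>)
  show "multiplier (redheffer \<Phi> F)" by (rule multiplierI[OF clT]) (rule app R1, assumption)+
  have eq: "mult_op (redheffer \<Phi> F) = T" by (rule mult_op_eqI[OF clT]) (rule app R1, assumption)+
  show "mult_op (redheffer \<Phi> F) h = M21 (?A x) + M22 h" if "x = M11 (?A x) + M12 h"
  proof -
    have "M12 h = x - M11 (?A x)" by (subst (1) that) simp
    then have "S (M12 h) = x" using ST[of x] by (simp only:)
    then show ?thesis unfolding eq T_apply by simp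
  qed
qed

lemma norm_redheffer:
  "(\<And>z. z \<in> \<bbbD> \<Longrightarrow> norm (F z) \<le> 1) \<Longrightarrow> z \<in> \<bbbD> \<Longrightarrow> norm (redheffer \<Phi> F z) \<le> 1"
  by (rule norm_redheffer_le[where \<rho> = \<rho>]) (auto intro: norm_\<Phi> norm_block11 \<rho>)

lemma redheffer_prec_iff:
  fixes F G :: "complex \<Rightarrow> 'q \<Rightarrow>\<^sub>L 'p"
  assumes F: "multiplier F" "\<And>z. z \<in> \<bbbD> \<Longrightarrow> norm (F z) \<le> 1"
    and G: "multiplier G" "\<And>z. z \<in> \<bbbD> \<Longrightarrow> norm (G z) \<le> 1"
  shows "redheffer \<Phi> F \<prec>\<^sub>\<infinity> redheffer \<Phi> G
    \<longleftrightarrow> form_prec (mult_op (redheffer \<Phi> F)) (mult_op (redheffer \<Phi> G))"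
  by (rule schur_prec_iff[OF multiplier_redheffer[OF F] multiplier_redheffer[OF G] norm_redheffer[OF G(2)]])

lemma form_prec_redheffer_cancel:
  fixes F G :: "complex \<Rightarrow> 'q \<Rightarrow>\<^sub>L 'p"
  assumes iso: "\<And>h. norm (mult_op \<Phi> h) = norm h"
    and K: "multiplier K" "\<And>z. z \<in> \<bbbD> \<Longrightarrow> K z o\<^sub>L block12 (\<Phi> z) = id_blinfun"
      "\<And>z. z \<in> \<bbbD> \<Longrightarrow> block12 (\<Phi> z) o\<^sub>L K z = id_blinfun"
    and F: "multiplier F" "\<And>z. z \<in> \<bbbD> \<Longrightarrow> norm (F z) \<le> 1"
    and G: "multiplier G" "\<And>z. z \<in> \<bbbD> \<Longrightarrow> norm (G z) \<le> 1"
    and prec: "form_prec (mult_op (redheffer \<Phi> F)) (mult_op (redheffer \<Phi> G))"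
      "form_prec (mult_op (redheffer \<Phi> G)) (mult_op (redheffer \<Phi> F))"
  shows "form_prec (mult_op F) (mult_op G)"
proof -
  note ap = hardy_apply_mult_op[OF multiplier_blocks(2)[OF multiplier_\<Phi>]] hardy_apply_mult_op[OF K(1)]
  interpret isometric_colligation M11 M12 M21 M22 "mult_op K" \<rho>
  proof
    show "(norm (M11 w + M12 v))\<^sup>2 + (norm (M21 w + M22 v))\<^sup>2 = (norm w)\<^sup>2 + (norm v)\<^sup>2" for w v
      using norm_hpair[of w v] iso[of "hpair w v"] unfolding mult_op_hpair[OF multiplier_\<Phi>] by (metis norm_hpair)
    show "M12 (mult_op K x) = x" for x
    proof (rule hardy2_apply_eqI)
      show "hardy_apply (M12 (mult_op K x)) z = hardy_apply x z" if z: "z \<in> \<bbbD>" for z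
        using arg_cong[OF K(3)[OF z], of "\<lambda>Z. Z (hardy_apply x z)"] by (simp add: ap[OF z] del: mem_ball)
    qed
    show "mult_op K (M12 v) = v" for v
    proof (rule hardy2_apply_eqI)
      show "hardy_apply (mult_op K (M12 v)) z = hardy_apply v z" if z: "z \<in> \<bbbD>" for z
        using arg_cong[OF K(2)[OF z], of "\<lambda>Z. Z (hardy_apply v z)"] by (simp add: ap[OF z] del: mem_ball)
    qed
  qed (fact clinear_M norm_M11 \<rho>)+
  have img: "is_image (mult_op H) (mult_op (redheffer \<Phi> H))"
    if H: "multiplier H" "\<And>z. z \<in> \<bbbD> \<Longrightarrow> norm (H z) \<le> 1" for H
    unfolding is_image_def
  proof (intro conjI allI impI)
    note mR = multiplier_redheffer[OF H]
    show "clinear (mult_op H)" "clinear (mult_op (redheffer \<Phi> H))"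
      by (rule clinear_mult_op[OF H(1)], rule clinear_mult_op[OF mR])
    show "norm (mult_op H) \<le> 1" by (rule norm_mult_op_le[OF H(1)]) (use H(2) in auto)
    show "norm (mult_op (redheffer \<Phi> H)) \<le> 1"
      by (rule norm_mult_op_le[OF mR]) (use norm_redheffer[OF H(2)] in auto)
  qed (rule mult_op_redheffer[OF H])
  show ?thesis by (rule form_prec_image_cancel[OF img[OF F] img[OF G] prec])
qed

end

text \<open>Contractivity of the adjoint on \<open>(k, 0)\<close> bounds the sum of the squared
  norms of both adjoint entries of the first row at \<open>k\<close>. The right inverse
  \<open>K\<close> keeps the second entry at least norm k / \<kappa>, which leaves the factor 1 - 1
  / \<kappa>^2 for the first.\<close>

lemma norm_block11_bound:
  fixes A :: "('p::chilbert_space \<times> 'u::chilbert_space) \<Rightarrow>\<^sub>L ('q::chilbert_space \<times> 'y::chilbert_space)"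
  assumes A: "clinear A" "norm A \<le> 1" and K: "clinear K" "norm K \<le> \<kappa>" "block12 A o\<^sub>L K = id_blinfun"
    and \<kappa>: "1 \<le> \<kappa>"
  shows "norm (block11 A) \<le> sqrt (1 - 1 / \<kappa>\<^sup>2)"
proof -
  note cl = clinear_blocks[OF A(1)]
  have nonneg: "0 \<le> 1 - 1 / \<kappa>\<^sup>2" using \<kappa> by (simp add: divide_le_eq)
  have "norm (adj (block11 A) k) \<le> sqrt (1 - 1 / \<kappa>\<^sup>2) * norm k" for k
  proof (rule power2_le_imp_le)
    have "adj K (adj (block12 A) k) = k"
      using arg_cong[OF adj_compose[OF cl(2) K(1)], of "\<lambda>Z. Z k"] by (simp add: K(3))
    then have "norm k \<le> norm (adj K) * norm (adj (block12 A) k)" by (metis norm_blinfun)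
    also have "\<dots> \<le> \<kappa> * norm (adj (block12 A) k)"
      using K(1,2) by (intro mult_right_mono) (simp_all add: norm_adj)
    finally have "(norm k)\<^sup>2 \<le> \<kappa>\<^sup>2 * (norm (adj (block12 A) k))\<^sup>2"
      by (metis power_mono norm_ge_zero power_mult_distrib)
    then have 1: "(norm k)\<^sup>2 / \<kappa>\<^sup>2 \<le> (norm (adj (block12 A) k))\<^sup>2"
      using \<kappa> by (simp add: pos_divide_le_eq mult.commute)
    have "adj A (k, 0) = (adj (block11 A) k, adj (block12 A) k)"
      by (simp add: blocks_decompose adj_blocks[OF A(1)])
    moreover have "norm (adj A (k, 0)) \<le> norm k"
      using norm_blinfun_le[of "adj A" "(k, 0)"] A by (simp add: norm_adj)
    ultimately have "(norm (adj (block11 A) k, adj (block12 A) k))\<^sup>2 \<le> (norm k)\<^sup>2"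
      by (simp add: power_mono del: norm_Pair)
    then have "(norm (adj (block11 A) k))\<^sup>2 \<le> (norm k)\<^sup>2 - (norm k)\<^sup>2 / \<kappa>\<^sup>2"
      using 1 by (simp add: norm_prod_sq)
    then show "(norm (adj (block11 A) k))\<^sup>2 \<le> (sqrt (1 - 1 / \<kappa>\<^sup>2) * norm k)\<^sup>2"
      using nonneg by (simp add: power_mult_distrib left_diff_distrib)
  qed (use nonneg in simp)
  then have "norm (adj (block11 A)) \<le> sqrt (1 - 1 / \<kappa>\<^sup>2)"
    using nonneg by (intro norm_blinfun_bound) auto
  then show ?thesis by (simp add: norm_adj[OF cl(1)])
qed

lemma redheffer_dataI:
  assumes \<Phi>: "multiplier \<Phi>" "\<And>z. z \<in> \<bbbD> \<Longrightarrow> norm (\<Phi> z) \<le> 1"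
    and K: "multiplier K" "\<And>z. z \<in> \<bbbD> \<Longrightarrow> block12 (\<Phi> z) o\<^sub>L K z = id_blinfun"
  shows "\<exists>\<rho>. redheffer_data \<Phi> \<rho>"
proof -
  obtain M where M: "M \<ge> 0" "\<And>z. z \<in> \<bbbD> \<Longrightarrow> norm (K z) \<le> M" using K(1) unfolding multiplier_def by auto
  \<comment> \<open>Raising the bound to at least 1 keeps the expression under the root
    nonnegative.\<close>
  define \<kappa> where "\<kappa> = max M 1"
  have \<kappa>: "1 \<le> \<kappa>" "\<And>z. z \<in> \<bbbD> \<Longrightarrow> norm (K z) \<le> \<kappa>"
    unfolding \<kappa>_def using M(2) by (auto simp: le_max_iff_disj)
  have pos: "0 < 1 / \<kappa>\<^sup>2" "1 / \<kappa>\<^sup>2 \<le> 1" using \<kappa>(1) by (simp_all add: divide_le_eq)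
  have "redheffer_data \<Phi> (sqrt (1 - 1 / \<kappa>\<^sup>2))"
  proof
    show "norm (block11 (\<Phi> z)) \<le> sqrt (1 - 1 / \<kappa>\<^sup>2)" if z: "z \<in> \<bbbD>" for z
      by (rule norm_block11_bound[OF multiplier_clinear[OF \<Phi>(1) z] \<Phi>(2)[OF z]
            multiplier_clinear[OF K(1) z] \<kappa>(2)[OF z] K(2)[OF z] \<kappa>(1)])
  qed (use \<Phi> pos in auto)
  then show ?thesis ..
qed

text \<open>Let \<open>x\<close> and \<open>v\<close> be the states of the original and of the
  reflected system. Computing the inner product of \<open>F w x\<close> with \<open>v\<close>
  through either state equation gives the same feedback term, which cancels; what remains says that
  the two resolvent parts are adjoint.\<close>

lemma reflect_redheffer:
  fixes \<Phi> :: "complex \<Rightarrow> ('p::chilbert_space \<times> 'u::chilbert_space) \<Rightarrow>\<^sub>L ('q::chilbert_space \<times> 'y::chilbert_space)"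
    and F :: "complex \<Rightarrow> 'q \<Rightarrow>\<^sub>L 'p"
  assumes \<Phi>: "multiplier \<Phi>" and F: "multiplier F" "\<And>z. z \<in> \<bbbD> \<Longrightarrow> norm (F z) \<le> 1"
    and \<rho>: "\<And>z. z \<in> \<bbbD> \<Longrightarrow> norm (block11 (\<Phi> z)) \<le> \<rho>" "\<rho> < 1" and z: "z \<in> \<bbbD>"
  shows "reflect (redheffer \<Phi> F) z = redheffer (reflect \<Phi>) (reflect F) z"
  unfolding reflect_def[of "redheffer \<Phi> F"]
proof (rule adj_unique)
  fix u y
  define w where "w = cnj z"
  have w: "w \<in> \<bbbD>" unfolding w_def by (rule cnj_in_disc[OF z])
  note cl\<Phi> = multiplier_clinear[OF \<Phi> w] and clF = multiplier_clinear[OF F(1) w]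
  note clb = clinear_blocks[OF cl\<Phi>]
  have refl: "reflect \<Phi> z = adj (\<Phi> w)" "reflect F z = adj (F w)" by (simp_all add: reflect_def w_def)
  have \<rho>': "norm (block11 (reflect \<Phi> z)) \<le> \<rho>"
    using \<rho>(1)[OF w] by (simp add: refl adj_blocks[OF cl\<Phi>] norm_adj[OF clb(1)])
  have F': "norm (reflect F z) \<le> 1" using F(2)[OF w] by (simp add: refl norm_adj[OF clF])
  obtain x where x: "x = block11 (\<Phi> w) (F w x) + block12 (\<Phi> w) u"
    using redheffer_state_exists[where \<Phi> = \<Phi> and F = F and z = w, OF \<rho>(1)[OF w] \<rho>(2) F(2)[OF w]] by blast
  obtain v where v: "v = block11 (reflect \<Phi> z) (reflect F z v) + block12 (reflect \<Phi> z) y"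
    using redheffer_state_exists[where \<Phi> = "reflect \<Phi>" and F = "reflect F" and z = z, OF \<rho>' \<rho>(2) F'] by blast
  have "cinner (F w x) v = cinner (block11 (\<Phi> w) (F w x)) (adj (F w) v) + cinner (block21 (\<Phi> w) (F w x)) y"
    by (subst v) (simp add: cinner_add_right refl adj_blocks[OF cl\<Phi>] cinner_adj_right clb)
  moreover have "cinner (F w x) v = cinner x (adj (F w) v)" by (simp add: cinner_adj_right[OF clF])
  moreover have "cinner x (adj (F w) v) = cinner (block11 (\<Phi> w) (F w x)) (adj (F w) v)
      + cinner (block12 (\<Phi> w) u) (adj (F w) v)"
    by (subst (1) x) (simp add: cinner_add_left)
  ultimately have "cinner (block21 (\<Phi> w) (F w x)) y = cinner (block12 (\<Phi> w) u) (adj (F w) v)" by simp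
  then show "cinner (redheffer \<Phi> F (cnj z) u) y = cinner u (redheffer (reflect \<Phi>) (reflect F) z y)"
    unfolding redheffer_apply[where \<Phi> = \<Phi> and F = F and z = w, OF \<rho>(1)[OF w] \<rho>(2) F(2)[OF w] x, unfolded w_def]
      redheffer_apply[where \<Phi> = "reflect \<Phi>" and F = "reflect F" and z = z, OF \<rho>' \<rho>(2) F' v]
    by (simp add: cinner_add_left cinner_add_right refl adj_blocks[OF cl\<Phi>] cinner_adj_right clb flip: w_def)
qed

subsection \<open>Boundary values\<close>

definition radius :: "nat \<Rightarrow> real"
  where "radius k = 1 - inverse (real (Suc k))"

lemma radius: "0 \<le> radius k" "radius k < 1" "radius \<longlonglongrightarrow> 1"
proof -
  show "0 \<le> radius k" "radius k < 1" by (simp_all add: radius_def inverse_le_1_iff)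
  show "radius \<longlonglongrightarrow> 1"
    using tendsto_diff[OF tendsto_const[of 1] LIMSEQ_inverse_real_of_nat] by (simp add: radius_def[abs_def])
qed

text \<open>The point at radius r lies at distance 1 - r from \<open>cis t\<close>, hence in the
  region of aperture 2; any aperture above 1 would do.\<close>

lemma radial_limit:
  fixes F :: "complex \<Rightarrow> 'u::chilbert_space \<Rightarrow>\<^sub>L 'y::chilbert_space"
  assumes "nontangential_sot_limit F (cis t) V"
  shows "(\<lambda>k. F (circ 1 (radius k) t) x) \<longlonglongrightarrow> V x"
proof -
  have lim: "((\<lambda>z. F z x) \<longlongrightarrow> V x) (at (cis t) within stolz_region 2 (cis t))"
    using assms unfolding nontangential_sot_limit_def by simp
  have "circ 1 (radius k) t \<in> stolz_region 2 (cis t) \<and> circ 1 (radius k) t \<noteq> cis t" for k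
  proof
    note r = radius(1,2)[of k]
    have "cmod (circ 1 (radius k) t - cis t) = cmod (of_real (radius k - 1) * cis t)"
      by (simp add: algebra_simps)
    also have "\<dots> = 1 - radius k" using r by (simp only: norm_mult norm_of_real) simp
    finally have d: "cmod (circ 1 (radius k) t - cis t) = 1 - radius k" .
    have n: "cmod (circ 1 (radius k) t) = radius k" using r by (simp add: norm_mult)
    show "circ 1 (radius k) t \<in> stolz_region 2 (cis t)"
      unfolding stolz_region_def mem_Collect_eq d n
      by (intro conjI circ_in_disc r) (use r in simp)
    show "circ 1 (radius k) t \<noteq> cis t" using d r by auto
  qed
  moreover have "(\<lambda>k. circ 1 (radius k) t) \<longlonglongrightarrow> cis t"
    using tendsto_mult[OF tendsto_of_real[OF radius(3)] tendsto_const[of "cis t"]] by simp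
  ultimately have "filterlim (\<lambda>k. circ 1 (radius k) t) (at (cis t) within stolz_region 2 (cis t)) sequentially"
    by (simp add: filterlim_at)
  then show ?thesis by (rule filterlim_compose[OF lim])
qed

lemma unitary_op_apply:
  fixes V :: "'a::chilbert_space \<Rightarrow>\<^sub>L 'b::chilbert_space"
  assumes "unitary_op V"
  shows "norm (V x) = norm x" "V (adj V y) = y" "norm (adj V y) = norm y"
proof -
  have V: "clinear V" "adj V o\<^sub>L V = id_blinfun" "V o\<^sub>L adj V = id_blinfun"
    using assms unfolding unitary_op_def by auto
  have VV: "adj V (V x) = x" "V (adj V y) = y" for x y
    using arg_cong[OF V(2), of "\<lambda>Z. Z x"] arg_cong[OF V(3), of "\<lambda>Z. Z y"] by simp_all
  have n: "norm (V x) = norm x" for x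
  proof (rule power2_eq_imp_eq)
    have "cinner (V x) (V x) = cinner x x" using cinner_adj_right[OF V(1), of x "V x"] VV by simp
    then show "(norm (V x))\<^sup>2 = (norm x)\<^sup>2" unfolding cinner_self of_real_eq_iff .
  qed simp_all
  show "norm (V x) = norm x" "V (adj V y) = y" by (rule n, rule VV)
  show "norm (adj V y) = norm y" using n[of "adj V y"] by (simp add: VV)
qed

text \<open>Strong convergence does not pass to adjoints in general. Here the limit is unitary:
  expanding the squared distance and using contractivity bounds it by twice the gap between the
  squared norm of \<open>y\<close> and the real part of <y, A k (adj V y)>. This gap closes because
  \<open>V\<close> is co-isometric.\<close>

lemma adj_tendsto:
  fixes A :: "nat \<Rightarrow> 'a::chilbert_space \<Rightarrow>\<^sub>L 'b::chilbert_space"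
  assumes A: "\<And>k. clinear (A k)" "\<And>k. norm (A k) \<le> 1" and V: "unitary_op V"
    and lim: "\<And>x. (\<lambda>k. A k x) \<longlonglongrightarrow> V x"
  shows "(\<lambda>k. adj (A k) y) \<longlonglongrightarrow> adj V y"
proof -
  note u = unitary_op_apply[OF V]
  have bound: "(norm (adj (A k) y - adj V y))\<^sup>2 \<le> 2 * (norm y)\<^sup>2 - 2 * Re (cinner y (A k (adj V y)))" for k
  proof -
    have "norm (adj (A k) y) \<le> norm y" using A by (intro norm_blinfun_le) (simp add: norm_adj)
    then have "(norm (adj (A k) y))\<^sup>2 \<le> (norm y)\<^sup>2" by (simp add: power_mono)
    then show ?thesis
      using norm_sq_diff[of "adj (A k) y" "adj V y"] by (simp add: cinner_adj_left A u(3))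
  qed
  have "(\<lambda>k. 2 * (norm y)\<^sup>2 - 2 * Re (cinner y (A k (adj V y))))
      \<longlonglongrightarrow> 2 * (norm y)\<^sup>2 - 2 * Re (cinner y (V (adj V y)))"
    by (intro tendsto_intros tendsto_cinner_right lim)
  then have "(\<lambda>k. 2 * (norm y)\<^sup>2 - 2 * Re (cinner y (A k (adj V y)))) \<longlonglongrightarrow> 0"
    by (simp add: u(2) cinner_self del: of_real_power)
  then have "(\<lambda>k. (norm (adj (A k) y - adj V y))\<^sup>2) \<longlonglongrightarrow> 0"
    by (rule tendsto_sandwich[OF _ _ tendsto_const, rotated 2]) (simp_all add: bound)
  from tendsto_real_sqrt[OF this] have "(\<lambda>k. norm (adj (A k) y - adj V y)) \<longlonglongrightarrow> 0" by simp
  then show ?thesis by (simp add: tendsto_norm_zero_iff LIM_zero_iff)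
qed

lemma
  fixes \<Phi> :: "complex \<Rightarrow> 'u::chilbert_space \<Rightarrow>\<^sub>L 'y::chilbert_space"
  assumes \<Phi>: "multiplier \<Phi>" "\<And>z. z \<in> \<bbbD> \<Longrightarrow> norm (\<Phi> z) \<le> 1" and inner: "two_sided_inner \<Phi>"
  shows two_sided_inner_isometric: "norm (mult_op \<Phi> h) = norm h"
    and two_sided_inner_reflect_isometric: "norm (mult_op (reflect \<Phi>) k) = norm k"
proof -
  show "norm (mult_op \<Phi> h) = norm h"
  proof (rule isometric_mult_op[OF \<Phi> _ radius])
    show "AE t in lebesgue_on {0..2*pi}. \<exists>V :: 'u \<Rightarrow>\<^sub>L 'y. (\<forall>x. norm (V x) = norm x) \<and>
        (\<forall>x. (\<lambda>k. \<Phi> (circ 1 (radius k) t) x) \<longlonglongrightarrow> V x)"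
      using inner unfolding two_sided_inner_def
    proof eventually_elim
      case (elim t)
      then obtain V where V: "nontangential_sot_limit \<Phi> (cis t) V" "unitary_op V" by auto
      show ?case
        by (intro exI[of _ V] conjI allI unitary_op_apply(1)[OF V(2)] radial_limit[OF V(1)])
    qed
  qed simp_all
  show "norm (mult_op (reflect \<Phi>) k) = norm k"
  proof (rule isometric_mult_op[OF multiplier_reflect[OF \<Phi>(1)] _ _ radius])
    show "norm (reflect \<Phi> z) \<le> 1" if "z \<in> \<bbbD>" for z
      using \<Phi>(2)[OF cnj_in_disc[OF that]] norm_reflect[OF \<Phi>(1) that] by simp
    \<comment> \<open>Running the circle backwards keeps the parameter \<open>t\<close>, so the
      exceptional null set of \<Phi> is used unchanged.\<close>
    show "AE t in lebesgue_on {0..2*pi}. \<exists>V :: 'y \<Rightarrow>\<^sub>L 'u. (\<forall>x. norm (V x) = norm x) \<and>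
        (\<forall>x. (\<lambda>k. reflect \<Phi> (circ (-1) (radius k) t) x) \<longlonglongrightarrow> V x)"
      using inner unfolding two_sided_inner_def
    proof eventually_elim
      case (elim t)
      then obtain V where V: "nontangential_sot_limit \<Phi> (cis t) V" "unitary_op V" by auto
      have refl: "reflect \<Phi> (circ (-1) (radius k) t) = adj (\<Phi> (circ 1 (radius k) t))" for k
        by (simp add: reflect_def cis_cnj)
      note D = circ_in_disc[OF radius(1,2)]
      have "(\<lambda>k. reflect \<Phi> (circ (-1) (radius k) t) y) \<longlonglongrightarrow> adj V y" for y
        unfolding refl
        by (rule adj_tendsto[OF multiplier_clinear[OF \<Phi>(1) D] \<Phi>(2)[OF D] V(2) radial_limit[OF V(1)]])
      then show ?case
        by (intro exI[of _ "adj V"] conjI allI unitary_op_apply(3)[OF V(2)])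
    qed
  qed simp_all
qed

section \<open>Cancellation of the Redheffer map on the Schur class\<close>

lemma Hinf_inverse:
  assumes "has_Hinf_inverse K"
  shows "multiplier (\<lambda>z. inv_op (K z))"
    and "z \<in> \<bbbD> \<Longrightarrow> inv_op (K z) o\<^sub>L K z = id_blinfun" "z \<in> \<bbbD> \<Longrightarrow> K z o\<^sub>L inv_op (K z) = id_blinfun"
proof -
  have K: "(\<lambda>z. inv_op (K z)) \<in> Hinf" "\<And>z. z \<in> \<bbbD> \<Longrightarrow> invertible_op (K z)"
    using assms unfolding has_Hinf_inverse_def by auto
  show "multiplier (\<lambda>z. inv_op (K z))" by (rule Hinf_multiplier[OF K(1)])
  assume "z \<in> \<bbbD>"
  then obtain B where B: "B o\<^sub>L K z = id_blinfun" "K z o\<^sub>L B = id_blinfun"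
    using K(2) unfolding invertible_op_def by auto
  show "inv_op (K z) o\<^sub>L K z = id_blinfun" "K z o\<^sub>L inv_op (K z) = id_blinfun"
    unfolding inv_op_eqI[OF B] by (rule B)+
qed

theorem proposition3p8:
  fixes \<Phi> :: "complex \<Rightarrow> ('e'::chilbert_space \<times> 'u::chilbert_space) \<Rightarrow>\<^sub>L ('e::chilbert_space \<times> 'y::chilbert_space)"
    and F G :: "complex \<Rightarrow> 'e \<Rightarrow>\<^sub>L 'e'"
  assumes "separable_space (euclidean :: 'u topology)"
    and "separable_space (euclidean :: 'y topology)"
    and "separable_space (euclidean :: 'e topology)"
    and "separable_space (euclidean :: 'e' topology)"
    and "\<Phi> \<in> schur"
    and "two_sided_inner \<Phi>"
    and "has_Hinf_inverse (\<lambda>z. block12 (\<Phi> z)) \<or> has_Hinf_inverse (\<lambda>z. block21 (\<Phi> z))"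
    and "F \<in> schur"
    and "G \<in> schur"
    and "redheffer \<Phi> F \<sim>\<^sub>\<infinity> redheffer \<Phi> G"
  shows "F \<sim>\<^sub>\<infinity> G"
proof -
  note mult = Hinf_multiplier[OF schur_imp_Hinf]
  note \<Phi> = mult[OF assms(5)] schur_norm[OF assms(5)]
  note F = mult[OF assms(8)] schur_norm[OF assms(8)]
  note G = mult[OF assms(9)] schur_norm[OF assms(9)]
  have iff_FG: "F \<prec>\<^sub>\<infinity> G \<longleftrightarrow> form_prec (mult_op F) (mult_op G)"
    "G \<prec>\<^sub>\<infinity> F \<longleftrightarrow> form_prec (mult_op G) (mult_op F)"
    by (rule schur_prec_iff[OF F(1) G], assumption, rule schur_prec_iff[OF G(1) F])
  from assms(7) show ?thesis
  proof
    assume inv: "has_Hinf_inverse (\<lambda>z. block12 (\<Phi> z))"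
    note K = Hinf_inverse[OF inv]
    obtain \<rho> where "redheffer_data \<Phi> \<rho>" using redheffer_dataI[OF \<Phi> K(1) K(3)] by auto
    then interpret redheffer_data \<Phi> \<rho> .
    have iff: "redheffer \<Phi> F \<prec>\<^sub>\<infinity> redheffer \<Phi> G
        \<longleftrightarrow> form_prec (mult_op (redheffer \<Phi> F)) (mult_op (redheffer \<Phi> G))"
      "redheffer \<Phi> G \<prec>\<^sub>\<infinity> redheffer \<Phi> F
        \<longleftrightarrow> form_prec (mult_op (redheffer \<Phi> G)) (mult_op (redheffer \<Phi> F))"
      by (rule redheffer_prec_iff[OF F G], assumption, assumption, rule redheffer_prec_iff[OF G F])
    have prec: "form_prec (mult_op (redheffer \<Phi> F)) (mult_op (redheffer \<Phi> G))"
      "form_prec (mult_op (redheffer \<Phi> G)) (mult_op (redheffer \<Phi> F))"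
      using assms(10) unfolding schur_equiv_def iff by simp_all
    have "form_prec (mult_op F) (mult_op G)"
      by (rule form_prec_redheffer_cancel[OF two_sided_inner_isometric[OF \<Phi> assms(6)] K F G prec])
    moreover have "form_prec (mult_op G) (mult_op F)"
      by (rule form_prec_redheffer_cancel[OF two_sided_inner_isometric[OF \<Phi> assms(6)] K G F prec(2,1)])
    ultimately show ?thesis
      unfolding schur_equiv_def iff_FG by simp
  next
    \<comment> \<open>Pointwise adjoints exchange the off-diagonal blocks, so the reflected function
      has an invertible \<open>block12\<close>, with the reflected inverse.\<close>
    assume inv: "has_Hinf_inverse (\<lambda>z. block21 (\<Phi> z))"
    note K = Hinf_inverse[OF inv] and K' = multiplier_reflect[OF Hinf_inverse(1)[OF inv]]
    have adj_K: "reflect (\<lambda>z. inv_op (block21 (\<Phi> z))) z o\<^sub>L block12 (reflect \<Phi> z) = id_blinfun"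
      "block12 (reflect \<Phi> z) o\<^sub>L reflect (\<lambda>z. inv_op (block21 (\<Phi> z))) z = id_blinfun"
      if z: "z \<in> \<bbbD>" for z
    proof -
      note D = cnj_in_disc[OF z]
      note cl = multiplier_clinear[OF \<Phi>(1) D]
      show "reflect (\<lambda>z. inv_op (block21 (\<Phi> z))) z o\<^sub>L block12 (reflect \<Phi> z) = id_blinfun"
        "block12 (reflect \<Phi> z) o\<^sub>L reflect (\<lambda>z. inv_op (block21 (\<Phi> z))) z = id_blinfun"
        unfolding reflect_def adj_blocks(2)[OF cl]
          adj_compose[OF clinear_blocks(3)[OF cl] multiplier_clinear[OF K(1) D], symmetric]
          adj_compose[OF multiplier_clinear[OF K(1) D] clinear_blocks(3)[OF cl], symmetric]
        by (simp_all only: K(2,3)[OF D] adj_id)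
    qed
    have \<Phi>': "norm (reflect \<Phi> z) \<le> 1" if "z \<in> \<bbbD>" for z
      using \<Phi>(2)[OF cnj_in_disc[OF that]] norm_reflect[OF \<Phi>(1) that] by simp
    obtain \<rho> where "redheffer_data (reflect \<Phi>) \<rho>"
      using redheffer_dataI[OF multiplier_reflect[OF \<Phi>(1)] \<Phi>' K' adj_K(2)] by auto
    then interpret refl: redheffer_data "reflect \<Phi>" \<rho> .
    \<comment> \<open>The bound is carried back to \<Phi> itself, since its own Redheffer images
      must be known to be multipliers before they are reflected.\<close>
    have block11: "norm (block11 (\<Phi> z)) \<le> \<rho>" if z: "z \<in> \<bbbD>" for z
      using refl.norm_block11[OF cnj_in_disc[OF z]] multiplier_clinear[OF \<Phi>(1) z]
      by (simp add: reflect_def adj_blocks norm_adj clinear_blocks)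
    interpret redheffer_data \<Phi> \<rho>
      by unfold_locales (use \<Phi> block11 refl.\<rho> in auto)
    have cancel: "form_prec (mult_op A) (mult_op B)"
      if A: "multiplier A" "\<And>z. z \<in> \<bbbD> \<Longrightarrow> norm (A z) \<le> 1"
        and B: "multiplier B" "\<And>z. z \<in> \<bbbD> \<Longrightarrow> norm (B z) \<le> 1"
        and prec: "redheffer \<Phi> A \<prec>\<^sub>\<infinity> redheffer \<Phi> B" "redheffer \<Phi> B \<prec>\<^sub>\<infinity> redheffer \<Phi> A"
      for A B :: "complex \<Rightarrow> 'e \<Rightarrow>\<^sub>L 'e'"
    proof -
      have refl_prec: "form_prec (mult_op (redheffer (reflect \<Phi>) (reflect C))) (mult_op (redheffer (reflect \<Phi>) (reflect D)))"
        if C: "multiplier C" "\<And>z. z \<in> \<bbbD> \<Longrightarrow> norm (C z) \<le> 1"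
          and D: "multiplier D" "\<And>z. z \<in> \<bbbD> \<Longrightarrow> norm (D z) \<le> 1"
          and CD: "redheffer \<Phi> C \<prec>\<^sub>\<infinity> redheffer \<Phi> D" for C D :: "complex \<Rightarrow> 'e \<Rightarrow>\<^sub>L 'e'"
      proof -
        have "redheffer \<Phi> C \<prec>\<^sub>\<infinity> redheffer \<Phi> D
            \<longleftrightarrow> form_prec (mult_op (redheffer \<Phi> C)) (mult_op (redheffer \<Phi> D))"
          by (rule redheffer_prec_iff[OF C D])
        with CD have p: "form_prec (mult_op (redheffer \<Phi> C)) (mult_op (redheffer \<Phi> D))" by (rule iffD1[rotated])
        have "form_prec (mult_op (reflect (redheffer \<Phi> C))) (mult_op (reflect (redheffer \<Phi> D)))"
          by (rule form_prec_reflect[OF multiplier_redheffer[OF C] multiplier_redheffer[OF D] norm_redheffer[OF D(2)] p])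
        moreover have "mult_op (reflect (redheffer \<Phi> C)) = mult_op (redheffer (reflect \<Phi>) (reflect C))"
          by (rule mult_op_cong, rule reflect_redheffer[OF \<Phi>(1) C block11 \<rho>(2)])
        moreover have "mult_op (reflect (redheffer \<Phi> D)) = mult_op (redheffer (reflect \<Phi>) (reflect D))"
          by (rule mult_op_cong, rule reflect_redheffer[OF \<Phi>(1) D block11 \<rho>(2)])
        ultimately show ?thesis by (simp only:)
      qed
      have nA: "norm (reflect A z) \<le> 1" and nB: "norm (reflect B z) \<le> 1" if "z \<in> \<bbbD>" for z
        using A(2)[OF cnj_in_disc[OF that]] B(2)[OF cnj_in_disc[OF that]]
          norm_reflect[OF A(1) that] norm_reflect[OF B(1) that] by simp_all
      note mA = multiplier_reflect[OF A(1)] and mB = multiplier_reflect[OF B(1)]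
      have p: "form_prec (mult_op (reflect A)) (mult_op (reflect B))"
        by (rule refl.form_prec_redheffer_cancel[OF two_sided_inner_reflect_isometric[OF \<Phi> assms(6)]
              K' adj_K mA nA mB nB refl_prec[OF A B prec(1)] refl_prec[OF B A prec(2)]])
      \<comment> \<open>A second reflection restores \<open>A\<close> and \<open>B\<close> on the
        disc, and \<open>mult_op\<close> depends on no other values.\<close>
      have "form_prec (mult_op (reflect (reflect A))) (mult_op (reflect (reflect B)))"
        by (rule form_prec_reflect[OF mA mB nB p])
      moreover have "mult_op (reflect (reflect A)) = mult_op A" "mult_op (reflect (reflect B)) = mult_op B"
        by (rule mult_op_cong, rule reflect_reflect[OF A(1)], assumption,
            rule mult_op_cong, rule reflect_reflect[OF B(1)], assumption)
      ultimately show ?thesis by (simp only:)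
    qed
    show ?thesis
      unfolding schur_equiv_def iff_FG
    proof
      have "redheffer \<Phi> F \<prec>\<^sub>\<infinity> redheffer \<Phi> G" "redheffer \<Phi> G \<prec>\<^sub>\<infinity> redheffer \<Phi> F"
        using assms(10) unfolding schur_equiv_def by simp_all
      then show "form_prec (mult_op F) (mult_op G)" "form_prec (mult_op G) (mult_op F)"
        using cancel[of F G] cancel[of G F] F G by blast+
    qed
  qed
qed

end
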